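(* Consider the random field $X^{Q_1}$ generated under the true parameter $(\theta^*,\sigma^* )$ and the estimators $(\hat s,\hat\kappa,\hat\eta)$ described in the context. Write $\xi_{k,\ell}=\langle\xi,e_{k,\ell}\rangle_{\theta^*}$ and assume that $\{\xi_{k,\ell}\}_{k,\ell\ge1}$ are independent, that $\sup_{k,\ell\ge1}\lambda_{k,\ell}^{1+\alpha}\mathbb E[\xi_{k,\ell}^4]<\infty$, and that at least one of the following holds: (i) $\mathbb E[\xi_{k,\ell}]=0$ for all $k,\ell\ge1$ and $\sup_{k,\ell\ge1}\lambda_{k,\ell}^{1+\alpha}\mathbb E[\xi_{k,\ell}^2]<\infty$; (ii) $\mathbb E[\|A_{\theta^*}^{(1+\alpha)/2}\xi\|_{\theta^*}^2]=\sum_{k,\ell\ge1}\lambda_{k,\ell}^{1+\alpha}\mathbb E[\xi_{k,\ell}^2]<\infty$. (Here $\lambda_{k,\ell}$, $e_{k,\ell}$ are evaluated at $\theta^*$.) Then for any $\gamma<\min\{\tfrac12,1-\alpha\}-\tfrac{\rho}{2}$, as $N\to\infty$ and $m\to\infty$, $$m^{1/2}N^\gamma\begin{pmatrix}\hat s-s^*\\ \hat\kappa-\kappa^*\\ \hat\eta-\eta^*\end{pmatrix}\longrightarrow 0\quad\text{in probability}.$$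
   Context: Model. Let $D=[0,1]^2$, $\alpha\in(0,1)$ a known constant, $\theta=(\theta_0,\theta_1,\eta_1,\theta_2)\in\mathbb R^3\times(0,\infty)$, $\sigma>0$. Put $-A_\theta=\theta_2(\partial_y^2+\partial_z^2)+\theta_1\partial_y+\eta_1\partial_z+\theta_0$ and, for $k,\ell\in\mathbb N$, $$e_{k,\ell}(y,z)=2\sin(\pi ky)\sin(\pi\ell z)e^{-\frac{\theta_1}{2\theta_2}y}e^{-\frac{\eta_1}{2\theta_2}z},\qquad \lambda_{k,\ell}=-\theta_0+\frac{\theta_1^2+\eta_1^2}{4\theta_2}+\pi^2(k^2+\ell^2)\theta_2,$$ so $A_\theta e_{k,\ell}=\lambda_{k,\ell}e_{k,\ell}$. Let $\langle f,g\rangle_\theta=\int_0^1\int_0^1 f(y,z)g(y,z)e^{\frac{\theta_1}{\theta_2}y}e^{\frac{\eta_1}{\theta_2}z}\,dy\,dz$, $\|f\|_\theta=\langle f,f\rangle_\theta^{1/2}$, and $H_\theta=\{f:D\to\mathbb R:\ \|f\|_\theta<\infty,\ f=0\text{ on }\partial D\}$. Let $\{w_{k,\ell}\}_{k,\ell\ge1}$ be independent real standard Brownian motions and $\xi$ a random element of $H_\theta$ independent of them. The $Q_1$-Wiener process is $\langle W^{Q_1}_t,f\rangle_\theta=\sum_{k,\ell\ge1}\lambda_{k,\ell}^{-\alpha/2}\langle f,e_{k,\ell}\rangle_\theta w_{k,\ell}(t)$, and $X^{Q_1}$ is the mild solution on $[0,1]\times D$ of $dX_t=-A_\theta X_t\,dt+\sigma\,dW_t^{Q_1}$,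 $X_0=\xi$, $X_t|_{\partial D}=0$, i.e. $X_t^{Q_1}(y,z)=\sum_{k,\ell\ge1}x^{Q_1}_{k,\ell}(t)e_{k,\ell}(y,z)$ with $$x_{k,\ell}^{Q_1}(t)=e^{-\lambda_{k,\ell}t}\langle\xi,e_{k,\ell}\rangle_\theta+\sigma\lambda_{k,\ell}^{-\alpha/2}\int_0^te^{-\lambda_{k,\ell}(t-s)}\,dw_{k,\ell}(s).$$ The parameter $(\theta,\sigma)$ ranges over a compact convex $\Theta\subset\mathbb R^3\times(0,\infty)^2$; the data are generated with the true value $(\theta^*,\sigma^* )=(\theta_0^*,\theta_1^*,\eta_1^*,\theta_2^*,\sigma^* )\in\mathrm{Int}\,\Theta$, for which $\lambda_{1,1}^*>0$. Observations and thinning in space. $X_{t_i}(y_{j_1},z_{j_2})$ is observed at $t_i=i\Delta_N$, $\Delta_N=1/N$, $i=0,\dots,N$, $y_{j_1}=j_1/M_1$, $z_{j_2}=j_2/M_2$, $0\le j_1\le M_1$, $0\le j_2\le M_2$. Let $\overline m_1\le M_1$, $\overline m_2\le M_2$ with $\overline m_1\overline m_2=O(N^\rho)$ for some $0<\rho<\min\{1,2(1-\alpha)\}$, $\overline y_{j}=\lfloor M_1/\overline m_1\rfloor\, j/M_1$ ($0\le j\le\overline m_1$), $\overline z_{j}=\lfloor M_2/\overline m_2\rfloor\, j/M_2$ ($0\le j\le\overline m_2$). Fix $\delta\in(0,1/2)$, and let $J_1,J_2,m_1,m_2\ge1$ be such that $\overline y_{J_1}<\delta\le\overline y_{J_1+1}<\cdots<\overline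 y_{J_1+m_1}\le1-\delta<\overline y_{J_1+m_1+1}$ and $\overline z_{J_2}<\delta\le\overline z_{J_2+1}<\cdots<\overline z_{J_2+m_2}\le1-\delta<\overline z_{J_2+m_2+1}$. Put $\widetilde y_{j_1}=\overline y_{J_1+j_1}$ ($1\le j_1\le m_1$), $\widetilde z_{j_2}=\overline z_{J_2+j_2}$ ($1\le j_2\le m_2$), and $m=m_1m_2$ (so $m=O(N^\rho)$). Estimators. Let $s=\sigma^2/\theta_2$, $\kappa=\theta_1/\theta_2$, $\eta=\eta_1/\theta_2$, with true values $s^*,\kappa^*,\eta^*$. With $\Delta_iX(y,z)=X_{t_i}(y,z)-X_{t_{i-1}}(y,z)$ let $Z_N^{Q_1}(y,z)=\frac{1}{N\Delta_N^\alpha}\sum_{i=1}^N(\Delta_iX^{Q_1}(y,z))^2$ and $$U^{(1)}_{N,m}(s,\kappa,\eta)=\sum_{j_1=1}^{m_1}\sum_{j_2=1}^{m_2}\Bigl(Z_N^{Q_1}(\widetilde y_{j_1},\widetilde z_{j_2})-\frac{\Gamma(1-\alpha)}{4\pi\alpha}\,s\,e^{-(\kappa\widetilde y_{j_1}+\eta\widetilde z_{j_2})}\Bigr)^2 .$$ $(\hat s,\hat\kappa,\hat\eta)$ is a minimizer of $U^{(1)}_{N,m}$ over $\Xi_1$, a compact convex subset of $(0,\infty)\times\mathbb R^2$ with $(s^*,\kappa^*,\eta^* )\in\mathrm{Int}\,\Xi_1$. Here $\Gamma$ is the Gamma function.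
   Formalization: The formal theorem additionally requires m_1 ≥ 2 and m_2 ≥ 2 for all large N; with m_1 = 1 (allowed as stated) s and κ enter the contrast only through s·exp(-κ·y), so minimizers are not unique and the claim fails. *)

theory Defs
  imports "HOL-Probability.Probability"
begin

text \<open>A drift parameter is \<open>\<theta> = (\<theta>\<^sub>0, \<theta>\<^sub>1, \<eta>\<^sub>1, \<theta>\<^sub>2)\<close>; a point of space is \<open>p = (y, z)\<close>.\<close>

type_synonym drift = "real \<times> real \<times> real \<times> real"

definition unit_square :: "(real \<times> real) set" where
  "unit_square = {0..1} \<times> {0..1}"

definition modes :: "(nat \<times> nat) set" where
  "modes = {1..} \<times> {1..}"

definition eigenfun :: "drift \<Rightarrow> nat \<Rightarrow> nat \<Rightarrow> real \<times> real \<Rightarrow> real" where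
  "eigenfun = (\<lambda>(\<theta>0, \<theta>1, \<eta>1, \<theta>2) k l (y, z).
     2 * sin (pi * real k * y) * sin (pi * real l * z)
       * exp (- (\<theta>1 / (2 * \<theta>2)) * y) * exp (- (\<eta>1 / (2 * \<theta>2)) * z))"

definition eigenval :: "drift \<Rightarrow> nat \<Rightarrow> nat \<Rightarrow> real" where
  "eigenval = (\<lambda>(\<theta>0, \<theta>1, \<eta>1, \<theta>2) k l.
     - \<theta>0 + (\<theta>1\<^sup>2 + \<eta>1\<^sup>2) / (4 * \<theta>2) + pi\<^sup>2 * ((real k)\<^sup>2 + (real l)\<^sup>2) * \<theta>2)"

definition weight :: "drift \<Rightarrow> real \<times> real \<Rightarrow> real" where
  "weight = (\<lambda>(\<theta>0, \<theta>1, \<eta>1, \<theta>2) (y, z). exp (\<theta>1 / \<theta>2 * y) * exp (\<eta>1 / \<theta>2 * z))"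

definition inner_wt :: "drift \<Rightarrow> (real \<times> real \<Rightarrow> real) \<Rightarrow> (real \<times> real \<Rightarrow> real) \<Rightarrow> real" where
  "inner_wt \<theta> f g = (LINT p:unit_square|lborel. f p * g p * weight \<theta> p)"

text \<open>Elements of \<open>H\<^sub>\<theta>\<close> are functions rather than equivalence classes, and the boundary condition
  is imposed pointwise. Values outside the unit square are irrelevant. The squared norm is written
  as a nonnegative integral, because \<open>inner_wt\<close> is 0 on non-integrable products.\<close>

definition H_space :: "drift \<Rightarrow> (real \<times> real \<Rightarrow> real) set" where
  "H_space \<theta> = {f. set_borel_measurable lborel unit_square f
     \<and> (\<integral>\<^sup>+p\<in>unit_square. ennreal ((f p)\<^sup>2 * weight \<theta> p) \<partial>lborel) < \<infinity>
     \<and> (\<forall>p\<in>frontier unit_square. f p = 0)}"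

definition fourier_coeff :: "drift \<Rightarrow> (real \<times> real \<Rightarrow> real) \<Rightarrow> nat \<Rightarrow> nat \<Rightarrow> real" where
  "fourier_coeff \<theta> f k l = inner_wt \<theta> f (eigenfun \<theta> k l)"

text \<open>\<open>\<parallel>A\<^sup>r f\<parallel>\<^sup>2\<close> for the spectrally defined power
  \<open>A\<^sup>r f = (\<Sum>k,l. \<lambda>\<^sub>k\<^sub>l\<^sup>r \<langle>f, e\<^sub>k\<^sub>l\<rangle> e\<^sub>k\<^sub>l)\<close>, with value \<open>\<infinity>\<close> when \<open>f\<close> is outside the
  domain of \<open>A\<^sup>r\<close>. All eigenvalues are assumed positive.\<close>

definition power_norm_sq :: "drift \<Rightarrow> real \<Rightarrow> (real \<times> real \<Rightarrow> real) \<Rightarrow> ennreal" where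
  "power_norm_sq \<theta> r f =
     (\<Sum>\<^sub>\<infinity>(k, l)\<in>modes. ennreal (((eigenval \<theta> k l) powr r * fourier_coeff \<theta> f k l)\<^sup>2))"

definition brownian_motion :: "'w measure \<Rightarrow> (real \<Rightarrow> 'w \<Rightarrow> real) \<Rightarrow> bool" where
  "brownian_motion M w \<longleftrightarrow>
     (\<forall>t\<ge>0. w t \<in> borel_measurable M)
   \<and> (AE \<omega> in M. w 0 \<omega> = 0)
   \<and> (\<forall>n \<tau>. 0 \<le> \<tau> 0 \<and> mono_on {..n} \<tau> \<longrightarrow>
        prob_space.indep_vars M (\<lambda>_. borel) (\<lambda>i \<omega>. w (\<tau> (Suc i)) \<omega> - w (\<tau> i) \<omega>) {..<n::nat})
   \<and> (\<forall>s t. 0 \<le> s \<and> s < t \<longrightarrow>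
        distributed M lborel (\<lambda>\<omega>. w t \<omega> - w s \<omega>) (normal_density 0 (sqrt (t - s))))
   \<and> (AE \<omega> in M. continuous_on {0..} (\<lambda>t. w t \<omega>))"

text \<open>A step function on \<open>{0..t}\<close> is given by its number \<open>n\<close> of steps, its partition points
  \<open>\<tau> 0 \<le> \<dots> \<le> \<tau> n\<close> and its values \<open>a 0, \<dots>, a (n - 1)\<close>.\<close>

definition step_fun :: "nat \<Rightarrow> (nat \<Rightarrow> real) \<Rightarrow> (nat \<Rightarrow> real) \<Rightarrow> real \<Rightarrow> real" where
  "step_fun n \<tau> a s = (\<Sum>i<n. a i * indicator {\<tau> i<..\<tau> (Suc i)} s)"

definition step_integral ::
    "(real \<Rightarrow> 'w \<Rightarrow> real) \<Rightarrow> nat \<Rightarrow> (nat \<Rightarrow> real) \<Rightarrow> (nat \<Rightarrow> real) \<Rightarrow> 'w \<Rightarrow> real" where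
  "step_integral w n \<tau> a \<omega> = (\<Sum>i<n. a i * (w (\<tau> (Suc i)) \<omega> - w (\<tau> i) \<omega>))"

text \<open>\<open>I\<close> is (a version of) \<open>\<integral>\<^sub>0\<^sup>t f(s) dw(s)\<close>: the mean-square limit of the integrals of step
  functions approximating the deterministic integrand \<open>f\<close> in \<open>L\<^sup>2[0,t]\<close>.\<close>

definition has_wiener_integral ::
    "'w measure \<Rightarrow> (real \<Rightarrow> 'w \<Rightarrow> real) \<Rightarrow> (real \<Rightarrow> real) \<Rightarrow> real \<Rightarrow> ('w \<Rightarrow> real) \<Rightarrow> bool" where
  "has_wiener_integral M w f t I \<longleftrightarrow>
     I \<in> borel_measurable M
   \<and> (\<exists>n \<tau> a.
        (\<forall>j::nat. 0 \<le> \<tau> j 0 \<and> mono_on {..n j} (\<tau> j) \<and> \<tau> j (n j) \<le> t)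
      \<and> (\<lambda>j. \<integral>\<^sup>+s\<in>{0..t}. ennreal ((f s - step_fun (n j) (\<tau> j) (a j) s)\<^sup>2) \<partial>lborel) \<longlonglongrightarrow> 0
      \<and> (\<lambda>j. \<integral>\<^sup>+\<omega>. ennreal ((I \<omega> - step_integral w (n j) (\<tau> j) (a j) \<omega>)\<^sup>2) \<partial>M) \<longlonglongrightarrow> 0)"

definition gen_events :: "'w measure \<Rightarrow> ('i \<Rightarrow> 'w \<Rightarrow> real) \<Rightarrow> 'i set \<Rightarrow> 'w set set" where
  "gen_events M Y I = sigma_sets (space M) (\<Union>i\<in>I. {Y i -` B \<inter> space M | B. B \<in> sets borel})"

definition independent_brownian_motions ::
    "'w measure \<Rightarrow> (nat \<Rightarrow> nat \<Rightarrow> real \<Rightarrow> 'w \<Rightarrow> real) \<Rightarrow> bool" where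
  "independent_brownian_motions M w \<longleftrightarrow>
     (\<forall>(k, l)\<in>modes. brownian_motion M (w k l))
   \<and> prob_space.indep_vars M (\<lambda>_. PiM {0..} (\<lambda>_. borel))
       (\<lambda>(k, l) \<omega>. \<lambda>t\<in>{0..}. w k l t \<omega>) modes"

text \<open>\<open>H\<^sub>\<theta>\<close> is separable, so its Borel sets are generated by the functionals \<open>\<langle>\<cdot>, f\<rangle>\<close>.\<close>

definition random_element_H :: "'w measure \<Rightarrow> drift \<Rightarrow> ('w \<Rightarrow> real \<times> real \<Rightarrow> real) \<Rightarrow> bool" where
  "random_element_H M \<theta> \<xi> \<longleftrightarrow>
     (\<forall>\<omega>\<in>space M. \<xi> \<omega> \<in> H_space \<theta>)
   \<and> (\<forall>f\<in>H_space \<theta>. (\<lambda>\<omega>. inner_wt \<theta> (\<xi> \<omega>) f) \<in> borel_measurable M)"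

definition independent_of_noise ::
    "'w measure \<Rightarrow> drift \<Rightarrow> ('w \<Rightarrow> real \<times> real \<Rightarrow> real)
       \<Rightarrow> (nat \<Rightarrow> nat \<Rightarrow> real \<Rightarrow> 'w \<Rightarrow> real) \<Rightarrow> bool" where
  "independent_of_noise M \<theta> \<xi> w \<longleftrightarrow>
     prob_space.indep_set M
       (gen_events M (\<lambda>f \<omega>. inner_wt \<theta> (\<xi> \<omega>) f) (H_space \<theta>))
       (gen_events M (\<lambda>((k, l), t). w k l t) (modes \<times> {0..}))"

text \<open>\<open>x\<close> is the family of coordinate processes on \<open>[0,1]\<close>; at each time they are determined up to
  a null set, as the Wiener integral is.\<close>

definition coordinate_processes ::
    "'w measure \<Rightarrow> real \<Rightarrow> drift \<Rightarrow> real \<Rightarrow> (nat \<Rightarrow> nat \<Rightarrow> real \<Rightarrow> 'w \<Rightarrow> real)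
       \<Rightarrow> ('w \<Rightarrow> real \<times> real \<Rightarrow> real) \<Rightarrow> (nat \<Rightarrow> nat \<Rightarrow> real \<Rightarrow> 'w \<Rightarrow> real) \<Rightarrow> bool" where
  "coordinate_processes M \<alpha> \<theta> \<sigma> w \<xi> x \<longleftrightarrow>
     (\<forall>(k, l)\<in>modes. \<forall>t\<in>{0..1}.
        x k l t \<in> borel_measurable M
      \<and> (\<exists>I. has_wiener_integral M (w k l) (\<lambda>s. exp (- eigenval \<theta> k l * (t - s))) t I
           \<and> (AE \<omega> in M. x k l t \<omega> =
                exp (- eigenval \<theta> k l * t) * fourier_coeff \<theta> (\<xi> \<omega>) k l
                + \<sigma> * eigenval \<theta> k l powr (- \<alpha> / 2) * I \<omega>)))"

text \<open>The series \<open>X\<^sub>t(p) = (\<Sum>k,l. x\<^sub>k\<^sub>l(t) e\<^sub>k\<^sub>l(p))\<close> is read as an unordered series in \<open>L\<^sup>2\<close> of the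
  underlying probability space, for each \<open>t\<close> and \<open>p\<close>; it does not converge absolutely pathwise.\<close>

definition mild_solution ::
    "'w measure \<Rightarrow> real \<Rightarrow> drift \<Rightarrow> real \<Rightarrow> (nat \<Rightarrow> nat \<Rightarrow> real \<Rightarrow> 'w \<Rightarrow> real)
       \<Rightarrow> ('w \<Rightarrow> real \<times> real \<Rightarrow> real) \<Rightarrow> (real \<Rightarrow> real \<times> real \<Rightarrow> 'w \<Rightarrow> real) \<Rightarrow> bool" where
  "mild_solution M \<alpha> \<theta> \<sigma> w \<xi> X \<longleftrightarrow>
     (\<exists>x. coordinate_processes M \<alpha> \<theta> \<sigma> w \<xi> x
        \<and> (\<forall>t\<in>{0..1}. \<forall>p\<in>unit_square.
             X t p \<in> borel_measurable M
           \<and> ((\<lambda>F. \<integral>\<^sup>+\<omega>. ennreal ((X t p \<omega>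
                  - (\<Sum>(k, l)\<in>F. x k l t \<omega> * eigenfun \<theta> k l p))\<^sup>2) \<partial>M) \<longlongrightarrow> 0)
               (finite_subsets_at_top modes)))"

text \<open>The thinned grid \<open>\<lfloor>M/mb\<rfloor> j / M\<close> in one space direction.\<close>

definition grid :: "nat \<Rightarrow> nat \<Rightarrow> nat \<Rightarrow> real" where
  "grid M mb j = real ((M div mb) * j) / real M"

text \<open>The points of the thinned grid lying in \<open>[\<delta>, 1 - \<delta>]\<close> are those with index
  \<open>J + 1, \<dots>, J + m\<close>. The grid points are increasing in the index because \<open>mb \<le> M\<close>, and
  the indices are \<open>0, \<dots>, mb\<close>.\<close>

definition design_window :: "real \<Rightarrow> nat \<Rightarrow> nat \<Rightarrow> nat \<Rightarrow> nat \<Rightarrow> bool" where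
  "design_window \<delta> M mb J m \<longleftrightarrow>
     mb \<le> M \<and> 1 \<le> J \<and> 1 \<le> m \<and> J + m + 1 \<le> mb
   \<and> grid M mb J < \<delta> \<and> \<delta> \<le> grid M mb (J + 1)
   \<and> grid M mb (J + m) \<le> 1 - \<delta> \<and> 1 - \<delta> < grid M mb (J + m + 1)"

definition realized_Z ::
    "real \<Rightarrow> (real \<Rightarrow> real \<times> real \<Rightarrow> 'w \<Rightarrow> real) \<Rightarrow> nat \<Rightarrow> real \<times> real \<Rightarrow> 'w \<Rightarrow> real" where
  "realized_Z \<alpha> X N p \<omega> =
     1 / (real N * (1 / real N) powr \<alpha>)
       * (\<Sum>i=1..N. (X (real i / real N) p \<omega> - X (real (i - 1) / real N) p \<omega>)\<^sup>2)"

text \<open>\<open>y\<close> and \<open>z\<close> are the thinned observation points, indexed from 1, and the last argument is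
  \<open>(s, \<kappa>, \<eta>)\<close>.\<close>

definition contrast ::
    "real \<Rightarrow> (real \<Rightarrow> real \<times> real \<Rightarrow> 'w \<Rightarrow> real) \<Rightarrow> nat \<Rightarrow> nat \<Rightarrow> nat
       \<Rightarrow> (nat \<Rightarrow> real) \<Rightarrow> (nat \<Rightarrow> real) \<Rightarrow> 'w \<Rightarrow> real \<times> real \<times> real \<Rightarrow> real" where
  "contrast \<alpha> X N m1 m2 y z \<omega> = (\<lambda>(s, \<kappa>, \<eta>).
     \<Sum>j1=1..m1. \<Sum>j2=1..m2.
       (realized_Z \<alpha> X N (y j1, z j2) \<omega>
          - Gamma (1 - \<alpha>) / (4 * pi * \<alpha>) * s * exp (- (\<kappa> * y j1 + \<eta> * z j2)))\<^sup>2)"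

definition tends_to_0_in_prob ::
    "'w measure \<Rightarrow> (nat \<Rightarrow> 'w \<Rightarrow> 'b::real_normed_vector) \<Rightarrow> bool" where
  "tends_to_0_in_prob M Y \<longleftrightarrow>
     (\<forall>\<epsilon>>0. (\<lambda>N. measure M {\<omega> \<in> space M. norm (Y N \<omega>) > \<epsilon>}) \<longlonglongrightarrow> 0)"

end

theory Submission
  imports Defs
begin

text \<open>A minimizer of the contrast is at most twice as far from the data as the limit surface is, and
  the exponential surfaces are separated linearly in the parameter, uniformly over the designs.
  Hence the squared error of the estimator times \<open>m\<close> is dominated by the sum over the design of the
  squared errors of the rescaled quadratic variations, and a bound of order \<open>N\<^sup>-\<^sup>2\<^sup>r\<close> for
  each of them, with \<open>r < min (1/2) (1 - \<alpha>)\<close>, suffices.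

  The increments of the field split into a Gaussian noise part, the contribution of the initial
  condition, and an arbitrarily small truncation error. The last two have quadratic variation of
  mean \<open>O(N\<^sup>-\<^sup>1)\<close> after rescaling. The variance of the quadratic variation of the noise is
  computed by Isserlis' formula and the geometric decay of the covariances of the
  Ornstein--Uhlenbeck increments. Its mean is a lattice sum of
  \<open>\<lambda>\<^sup>-\<^sup>1\<^sup>-\<^sup>\<alpha> (1 - e\<^sup>-\<^sup>\<lambda>\<^sup>/\<^sup>N)\<close> over the spectrum, compared with an integral in polar
  coordinates; the oscillating factors \<open>cos (2 \<pi> k y)\<close> are removed by summation by parts, at the
  cost of one row of the lattice.\<close>

section \<open>The kernel\<close>

text \<open>Up to \<sigma>^2, \<open>kern \<alpha> D x\<close> is the stationary variance of an
  increment over time D of the mode with eigenvalue x: the intensity x^(-\<alpha>) times (1 - e^(-x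
  D)) / x. Its integral over the quadrant, at argument a (x^2 + y^2) with a = pi^2 \<theta>2, is
  D^\<alpha> Gamma(1-\<alpha>) pi / (4 a \<alpha>), whence the constant Gamma(1-\<alpha>) / (4 pi
  \<alpha>) of the contrast.

  The rate is the relative error of this approximation. The lower-order part of the eigenvalues
  shifts the spectral sum by O(D), and one row of the lattice is bounded by O(D^b) for b < \<alpha>
  + 1/2. After division by D^\<alpha> and with r = b - \<alpha>, these are the conditions r <= 1 -
  \<alpha> and r < 1/2. The sum of m mean squared errors of order N^(-2r), multiplied by
  N^(2\<gamma>), vanishes when m N^(2\<gamma> - 2r) does; m = O(N^\<rho>) explains the loss
  \<rho>/2.

  The field is only a mean-square limit of its series, so every estimate is made on square
  truncations with constants independent of the size of the square, which is chosen last.\<close>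

definition kern :: "real \<Rightarrow> real \<Rightarrow> real \<Rightarrow> real" where
  "kern \<alpha> D x = x powr (-1-\<alpha>) * (1 - exp (-x*D))"

lemma kern_measurable [measurable]: "kern \<alpha> D \<in> borel_measurable borel"
  unfolding kern_def[abs_def] by measurable

lemma kern_nonneg: "0 \<le> x \<Longrightarrow> 0 \<le> D \<Longrightarrow> 0 \<le> kern \<alpha> D x"
  by (auto simp: kern_def)

text \<open>Interpolates between the bounds x and 1 of 1 - e^(-x): in either branch of the case
  split the relevant bound is at most x^b.\<close>

lemma one_minus_exp_le_powr:
  fixes x b :: real
  assumes "0 \<le> x" "0 \<le> b" "b \<le> 1"
  shows "1 - exp (-x) \<le> x powr b"
proof (cases "x \<le> 1")
  case True
  have "1 - exp (-x) \<le> x" using exp_ge_add_one_self[of "-x"] by simp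
  also have "x \<le> x powr b"
  proof (cases "x = 0")
    case False
    then have "x powr 1 \<le> x powr b" using True assms by (intro powr_mono') auto
    then show ?thesis using assms False by simp
  qed simp
  finally show ?thesis .
next
  case False
  then have "1 \<le> x powr b" using assms by (intro ge_one_powr_ge_zero) auto
  then show ?thesis using exp_gt_zero[of "-x"] by linarith
qed

text \<open>The free exponent b converts decay in the eigenvalue into powers of the time step: a
  larger b gains smallness in D and loses summability in x. The later choices of b are governed by
  this balance.\<close>

lemma kern_le_powr:
  assumes "0 < x" "0 \<le> D" "0 \<le> b" "b \<le> 1"
  shows "kern \<alpha> D x \<le> D powr b * x powr (b - 1 - \<alpha>)"
proof -
  have "kern \<alpha> D x \<le> x powr (-1-\<alpha>) * (x*D) powr b"
    unfolding kern_def using one_minus_exp_le_powr[of "x*D" b] assms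
    by (intro mult_left_mono) auto
  also have "\<dots> = D powr b * (x powr (-1-\<alpha>) * x powr b)"
    using assms by (simp add: powr_mult)
  also have "x powr (-1-\<alpha>) * x powr b = x powr (b - 1 - \<alpha>)"
    by (simp add: powr_add[symmetric] algebra_simps)
  finally show ?thesis .
qed

lemma kern_deriv:
  assumes "0 < x"
  shows "(kern \<alpha> D has_real_derivative
     (x powr (-1-\<alpha>) * (D * exp (-x*D)) - (1+\<alpha>) * x powr (-2-\<alpha>) * (1 - exp (-x*D)))) (at x)"
proof -
  have "((\<lambda>x. x powr (-1-\<alpha>)) has_real_derivative (-1-\<alpha>) * x powr ((-1-\<alpha>)-1)) (at x)"
    using assms by (rule has_real_derivative_powr)
  moreover have "(-1-\<alpha>) - 1 = -2-\<alpha>" by simp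
  ultimately have 1: "((\<lambda>x. x powr (-1-\<alpha>)) has_real_derivative (-1-\<alpha>) * x powr (-2-\<alpha>)) (at x)"
    by metis
  have 2: "((\<lambda>x. 1 - exp (-x*D)) has_real_derivative D * exp (-x*D)) (at x)"
    by (auto intro!: derivative_eq_intros)
  show ?thesis unfolding kern_def[abs_def]
    by (rule DERIV_cong[OF DERIV_mult[OF 1 2]]) (simp add: algebra_simps)
qed

text \<open>With u = t D, the inequality (1 + u) e^(-u) <= 1 gives u e^(-u) <= 1 - e^(-u), which
  makes the derivative nonpositive. Both the comparison with integrals and the summation by parts
  rest on this monotonicity.\<close>

lemma kern_antimono:
  assumes "0 < x" "x \<le> y" "0 \<le> D" "0 \<le> \<alpha>"
  shows "kern \<alpha> D y \<le> kern \<alpha> D x"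
proof (rule DERIV_nonpos_imp_nonincreasing[OF assms(2)])
  fix t assume t: "x \<le> t" "t \<le> y"
  then have t0: "0 < t" using assms by simp
  have "t * D * exp (-t*D) \<le> 1 - exp (-t*D)"
  proof -
    have "(1 + t*D) * exp (-(t*D)) \<le> exp (t*D) * exp (-(t*D))"
      using exp_ge_add_one_self[of "t*D"] by (intro mult_right_mono) auto
    then show ?thesis by (simp add: exp_minus algebra_simps)
  qed
  also have "\<dots> \<le> (1+\<alpha>) * (1 - exp (-t*D))"
  proof -
    have "0 \<le> \<alpha> * (1 - exp (-t*D))" using assms t0 by simp
    then show ?thesis by (simp add: algebra_simps)
  qed
  finally have "t powr (-2-\<alpha>) * (t * D * exp (-t*D)) \<le> t powr (-2-\<alpha>) * ((1+\<alpha>) * (1 - exp (-t*D)))"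
    by (intro mult_left_mono) auto
  moreover have "t powr (-2-\<alpha>) * t = t powr (-1-\<alpha>)"
  using powr_mult_base[of t "-2-\<alpha>"] t0 by (simp add: mult.commute)
  ultimately have "t powr (-1-\<alpha>) * (D * exp (-t*D)) - (1+\<alpha>) * t powr (-2-\<alpha>) * (1 - exp (-t*D)) \<le> 0"
  proof -
    assume *: "t powr (-2-\<alpha>) * (t * D * exp (-t*D)) \<le> t powr (-2-\<alpha>) * ((1+\<alpha>) * (1 - exp (-t*D)))"
      and e: "t powr (-2-\<alpha>) * t = t powr (-1-\<alpha>)"
    have "t powr (-1-\<alpha>) * (D * exp (-t*D)) = t powr (-2-\<alpha>) * (t * D * exp (-t*D))"
      by (simp add: e[symmetric])
    with * show ?thesis by (simp only: mult.assoc mult.left_commute diff_le_0_iff_le)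
  qed
  with kern_deriv[OF t0] show "\<exists>d. (kern \<alpha> D has_real_derivative d) (at t) \<and> d \<le> 0" by blast
qed

text \<open>Mean value theorem on [m, infinity): the two terms of the derivative are at most D
  t^(-1-\<alpha>) and (1+\<alpha>) D t^(-1-\<alpha>) in size, which add up to the constant. The
  factor D turns a bounded shift of the eigenvalues into an error of order D.\<close>

lemma kern_diff_le:
  assumes "0 < m" "m \<le> x" "m \<le> y" "0 \<le> D" "0 \<le> \<alpha>"
  shows "\<bar>kern \<alpha> D x - kern \<alpha> D y\<bar> \<le> (2+\<alpha>) * D * m powr (-1-\<alpha>) * \<bar>x - y\<bar>"
proof -
  have "norm (kern \<alpha> D x - kern \<alpha> D y) \<le> (2+\<alpha>) * D * m powr (-1-\<alpha>) * norm (x - y)"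
  proof (rule field_differentiable_bound[where S="{m..}"
        and f' = "\<lambda>x. x powr (-1-\<alpha>) * (D * exp (-x*D)) - (1+\<alpha>) * x powr (-2-\<alpha>) * (1 - exp (-x*D))"])
    fix t :: real assume t: "t \<in> {m..}"
    then have t0: "0 < t" using assms by simp
    show "(kern \<alpha> D has_field_derivative
        t powr (-1-\<alpha>) * (D * exp (-t*D)) - (1+\<alpha>) * t powr (-2-\<alpha>) * (1 - exp (-t*D))) (at t within {m..})"
      using kern_deriv[OF t0] by (rule has_field_derivative_at_within)
    have e: "t powr (-2-\<alpha>) * t = t powr (-1-\<alpha>)"
    using powr_mult_base[of t "-2-\<alpha>"] t0 by (simp add: mult.commute)
    have 1: "0 \<le> t powr (-1-\<alpha>) * (D * exp (-t*D))" using assms by simp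
    have 2: "t powr (-1-\<alpha>) * (D * exp (-t*D)) \<le> t powr (-1-\<alpha>) * D"
      using assms t0 by (intro mult_left_mono mult_left_le) auto
    have 3: "0 \<le> (1+\<alpha>) * t powr (-2-\<alpha>) * (1 - exp (-t*D))" using assms t0 by simp
    have "(1+\<alpha>) * t powr (-2-\<alpha>) * (1 - exp (-t*D)) \<le> (1+\<alpha>) * t powr (-2-\<alpha>) * (t*D)"
      using assms t0 exp_ge_add_one_self[of "-t*D"] by (intro mult_left_mono) auto
    also have "\<dots> = (1+\<alpha>) * D * t powr (-1-\<alpha>)" by (simp add: e[symmetric])
    finally have 4: "(1+\<alpha>) * t powr (-2-\<alpha>) * (1 - exp (-t*D)) \<le> (1+\<alpha>) * D * t powr (-1-\<alpha>)" .
    have "\<bar>t powr (-1-\<alpha>) * (D * exp (-t*D)) - (1+\<alpha>) * t powr (-2-\<alpha>) * (1 - exp (-t*D))\<bar>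
       \<le> (2+\<alpha>) * D * t powr (-1-\<alpha>)"
      using 1 2 3 4 by (simp add: abs_le_iff algebra_simps)
    also have "\<dots> \<le> (2+\<alpha>) * D * m powr (-1-\<alpha>)"
      using assms t by (intro mult_left_mono powr_mono2') auto
    finally show "norm (t powr (-1-\<alpha>) * (D * exp (-t*D)) - (1+\<alpha>) * t powr (-2-\<alpha>) * (1 - exp (-t*D)))
       \<le> (2+\<alpha>) * D * m powr (-1-\<alpha>)" by simp
  qed (use assms in auto)
  then show ?thesis by simp
qed

text \<open>Tonelli, starting from \<open>kern \<alpha> D x = \<integral>\<^sub>0\<^sup>D x\<^sup>-\<^sup>\<alpha> e\<^sup>-\<^sup>x\<^sup>s ds\<close>.\<close>

lemma nn_integral_kern:
  assumes al: "0 < \<alpha>" "\<alpha> < 1" and D: "0 < D"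
  shows "(\<integral>\<^sup>+x. ennreal (kern \<alpha> D x) * indicator {0<..} x \<partial>lborel)
     = ennreal (D powr \<alpha> * Gamma (1 - \<alpha>) / \<alpha>)"
proof -
  have 1: "ennreal (kern \<alpha> D x) = (\<integral>\<^sup>+s. ennreal (x powr (-\<alpha>) * exp (-x* s)) * indicator {0..D} s \<partial>lborel)"
    if x: "0 < x" for x
  proof -
    have "((\<lambda>s. x powr (-\<alpha>) * exp (-x* s)) has_integral
        (- (x powr (-1-\<alpha>)) * exp (-x*D) - (- (x powr (-1-\<alpha>)) * exp (-x*0)))) {0..D}"
    proof (rule fundamental_theorem_of_calculus)
      show "0 \<le> D" using D by simp
      fix s assume "s \<in> {0..D}"
      have e: "x powr (-1-\<alpha>) * x = x powr (-\<alpha>)"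
      using powr_mult_base[of x "-1-\<alpha>"] x by (simp add: mult.commute)
      show "((\<lambda>s. - (x powr (-1-\<alpha>)) * exp (-x* s)) has_vector_derivative x powr (-\<alpha>) * exp (-x* s)) (at s within {0..D})"
        unfolding has_real_derivative_iff_has_vector_derivative[symmetric]
        by (auto intro!: derivative_eq_intros simp: e[symmetric])
    qed
    from nn_integral_has_integral_lebesgue'[OF _ this]
    show ?thesis by (simp add: kern_def algebra_simps)
  qed
  have 2: "(\<integral>\<^sup>+x. ennreal (x powr (-\<alpha>) * exp (-x* s)) * indicator {0<..} x \<partial>lborel)
      = ennreal (Gamma (1-\<alpha>) * s powr (\<alpha>-1))" if s: "0 < s" for s
  proof -
    have "ennreal (Gamma (1-\<alpha>)) = (\<integral>\<^sup>+t. ennreal (indicator {0..} t * t powr (-\<alpha>) / exp t) \<partial>lborel)"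
      using Gamma_conv_nn_integral_real[of "1-\<alpha>"] al by simp
    also have "\<dots> = ennreal \<bar>s\<bar> * (\<integral>\<^sup>+x. ennreal (indicator {0..} (0+s*x) * (0+s*x) powr (-\<alpha>) / exp (0+s*x)) \<partial>lborel)"
      using s by (intro nn_integral_real_affine) auto
    also have "(\<integral>\<^sup>+x. ennreal (indicator {0..} (0+s*x) * (0+s*x) powr (-\<alpha>) / exp (0+s*x)) \<partial>lborel)
      = (\<integral>\<^sup>+x. ennreal (s powr (-\<alpha>)) * (ennreal (x powr (-\<alpha>) * exp (-x* s)) * indicator {0<..} x) \<partial>lborel)"
      using s by (intro nn_integral_cong)
        (auto simp: indicator_def zero_le_mult_iff powr_mult exp_minus field_simps ennreal_mult''[symmetric])
    also have "\<dots> = ennreal (s powr (-\<alpha>)) * (\<integral>\<^sup>+x. (ennreal (x powr (-\<alpha>) * exp (-x* s)) * indicator {0<..} x) \<partial>lborel)"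
      by (rule nn_integral_cmult) measurable
    finally have eq: "ennreal (Gamma (1-\<alpha>)) = ennreal (s powr (1-\<alpha>)) * (\<integral>\<^sup>+x. (ennreal (x powr (-\<alpha>) * exp (-x* s)) * indicator {0<..} x) \<partial>lborel)"
    proof -
      have e: "s * s powr (-\<alpha>) = s powr (1-\<alpha>)"
      using powr_mult_base[of s "-\<alpha>"] s by simp
      assume "ennreal (Gamma (1-\<alpha>)) = ennreal \<bar>s\<bar> * (ennreal (s powr (-\<alpha>)) * (\<integral>\<^sup>+x. (ennreal (x powr (-\<alpha>) * exp (-x* s)) * indicator {0<..} x) \<partial>lborel))"
      then show ?thesis using s by (simp add: mult.assoc[symmetric] ennreal_mult''[symmetric] e)
    qed
    have "ennreal (Gamma (1-\<alpha>) * s powr (\<alpha>-1)) = ennreal (s powr (\<alpha>-1)) * ennreal (Gamma (1-\<alpha>))"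
      by (simp add: ennreal_mult''[symmetric] mult.commute)
    also have "\<dots> = ennreal (s powr (\<alpha>-1) * s powr (1-\<alpha>)) * (\<integral>\<^sup>+x. (ennreal (x powr (-\<alpha>) * exp (-x* s)) * indicator {0<..} x) \<partial>lborel)"
      by (simp add: eq mult.assoc ennreal_mult'')
    also have "s powr (\<alpha>-1) * s powr (1-\<alpha>) = 1" using s by (simp add: powr_add[symmetric])
    finally show ?thesis by simp
  qed
  have 3: "(\<integral>\<^sup>+s. ennreal (Gamma (1-\<alpha>) * s powr (\<alpha>-1)) * indicator {0..D} s \<partial>lborel)
     = ennreal (D powr \<alpha> * Gamma (1 - \<alpha>) / \<alpha>)"
  proof -
    have "((\<lambda>s. s powr (\<alpha>-1)) has_integral (D powr (\<alpha>-1+1) / (\<alpha>-1+1))) {0..D}"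
      using al D by (intro has_integral_powr_from_0) auto
    then have "((\<lambda>s. Gamma (1-\<alpha>) * s powr (\<alpha>-1)) has_integral (Gamma (1-\<alpha>) * (D powr \<alpha> / \<alpha>))) {0..D}"
      by (intro has_integral_mult_right) simp
    from nn_integral_has_integral_lebesgue'[OF _ this] al show ?thesis
      by (simp add: mult.commute Gamma_real_nonneg)
  qed
  have "(\<integral>\<^sup>+x. ennreal (kern \<alpha> D x) * indicator {0<..} x \<partial>lborel)
    = (\<integral>\<^sup>+x. \<integral>\<^sup>+s. ennreal (x powr (-\<alpha>) * exp (-x* s)) * indicator {0..D} s * indicator {0<..} x \<partial>lborel \<partial>lborel)"
    by (intro nn_integral_cong) (auto simp: 1 indicator_def)
  also have "\<dots> = (\<integral>\<^sup>+s. \<integral>\<^sup>+x. ennreal (x powr (-\<alpha>) * exp (-x* s)) * indicator {0..D} s * indicator {0<..} x \<partial>lborel \<partial>lborel)"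
    by (rule lborel_pair.Fubini') measurable
  also have "\<dots> = (\<integral>\<^sup>+s. (\<integral>\<^sup>+x. ennreal (x powr (-\<alpha>) * exp (-x* s)) * indicator {0<..} x \<partial>lborel) * indicator {0..D} s \<partial>lborel)"
    by (intro nn_integral_cong) (auto simp: indicator_def)
  also have "\<dots> = (\<integral>\<^sup>+s. ennreal (Gamma (1-\<alpha>) * s powr (\<alpha>-1)) * indicator {0..D} s \<partial>lborel)"
  \<comment> \<open>The formula \<open>2\<close> is restricted to s > 0; at s = 0 the inner integral
    diverges, so this point is discarded as a null set.\<close>
  proof (rule nn_integral_cong_AE)
    show "AE s in lborel. (\<integral>\<^sup>+x. ennreal (x powr (-\<alpha>) * exp (-x* s)) * indicator {0<..} x \<partial>lborel) * indicator {0..D} s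
       = ennreal (Gamma (1-\<alpha>) * s powr (\<alpha>-1)) * indicator {0..D} s"
      using AE_lborel_singleton[of 0]
    proof eventually_elim
      case (elim s)
      then show ?case using 2[of s] by (auto simp: indicator_def)
    qed
  qed
  also note 3
  finally show ?thesis .
qed

section \<open>Substitutions on the half-line and polar coordinates on the quadrant\<close>

lemma nn_integral_square_subst:
  fixes f :: "real \<Rightarrow> real"
  assumes [measurable]: "f \<in> borel_measurable borel"
  shows "(\<integral>\<^sup>+x. ennreal (f x) * indicator {0<..} x \<partial>lborel)
     = (\<integral>\<^sup>+y. ennreal (2 * y * f (y\<^sup>2)) * indicator {0<..} y \<partial>lborel)"
proof -
  \<comment> \<open>Exhaustion: the substitution is made on the compact intervals [0, n^2], and
    monotone convergence carries it to the half-line. The endpoint 0 is a null set.\<close>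
  have lim: "(SUP n. \<integral>\<^sup>+x. ennreal (g x) * indicator {0..u n} x \<partial>lborel) = (\<integral>\<^sup>+x. ennreal (g x) * indicator {0<..} x \<partial>lborel)"
    if [measurable]: "g \<in> borel_measurable borel" and u: "incseq u" "\<And>x. \<exists>n. x \<le> u n" for g and u :: "nat \<Rightarrow> real"
  proof -
    have "(SUP n. \<integral>\<^sup>+x. ennreal (g x) * indicator {0..u n} x \<partial>lborel)
      = (\<integral>\<^sup>+x. (SUP n. ennreal (g x) * indicator {0..u n} x) \<partial>lborel)"
    proof (rule nn_integral_monotone_convergence_SUP[symmetric])
      show "incseq (\<lambda>n x. ennreal (g x) * indicator {0..u n} x)"
        using u(1) by (fastforce simp: incseq_def le_fun_def indicator_def split: if_splits intro: order_trans)
    qed measurable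
    also have "\<dots> = (\<integral>\<^sup>+x. ennreal (g x) * indicator {0<..} x \<partial>lborel)"
    proof (rule nn_integral_cong_AE)
      show "AE x in lborel. (SUP n. ennreal (g x) * indicator {0..u n} x) = ennreal (g x) * indicator {0<..} x"
        using AE_lborel_singleton[of 0]
      proof eventually_elim
        case (elim x)
        show ?case
        proof (cases "0 < x")
          case True
          obtain n where "x \<le> u n" using u by blast
          then show ?thesis using True
            by (intro antisym SUP_least) (auto simp: indicator_def intro!: SUP_upper2[of n])
        next
          case False
          then show ?thesis using elim by (simp add: indicator_def)
        qed
      qed
    qed
    finally show ?thesis .
  qed
  have "(\<integral>\<^sup>+x. f x * indicator {0\<^sup>2..(real n)\<^sup>2} x \<partial>lborel) = (\<integral>\<^sup>+x. f (x\<^sup>2) * (2*x) * indicator {0..real n} x \<partial>lborel)" for n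
    by (rule nn_integral_substitution)
       (auto intro!: derivative_eq_intros continuous_intros simp: set_borel_measurable_def)
  then have eq: "(\<integral>\<^sup>+x. ennreal (f x) * indicator {0..(real n)\<^sup>2} x \<partial>lborel) = (\<integral>\<^sup>+x. ennreal (2 * x * f (x\<^sup>2)) * indicator {0..real n} x \<partial>lborel)" for n
    by (simp add: ennreal_mult'' ennreal_indicator mult.assoc[symmetric]) (simp add: mult_ac)
  have "\<exists>n. x \<le> (real n)\<^sup>2" for x
  proof -
    obtain n where n: "\<bar>x\<bar> + 1 \<le> real n" using real_arch_simple by blast
    have "\<bar>x\<bar> + 1 \<le> (\<bar>x\<bar> + 1)\<^sup>2" by (simp add: power2_eq_square algebra_simps)
    also have "\<dots> \<le> (real n)\<^sup>2" using n by (intro power_mono) auto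
    finally have "x \<le> (real n)\<^sup>2" by linarith
    then show ?thesis ..
  qed
  then have "(\<integral>\<^sup>+x. ennreal (f x) * indicator {0<..} x \<partial>lborel) = (SUP n. \<integral>\<^sup>+x. ennreal (f x) * indicator {0..(real n)\<^sup>2} x \<partial>lborel)"
    by (intro lim[symmetric]) (auto simp: incseq_def intro!: power_mono)
  also have "\<dots> = (SUP n. \<integral>\<^sup>+x. ennreal (2 * x * f (x\<^sup>2)) * indicator {0..real n} x \<partial>lborel)"
    by (simp add: eq)
  also have "\<dots> = (\<integral>\<^sup>+y. ennreal (2 * y * f (y\<^sup>2)) * indicator {0<..} y \<partial>lborel)"
    by (intro lim) (auto simp: incseq_def intro: real_arch_simple)
  finally show ?thesis .
qed

lemma nn_integral_halfline_scale:
  fixes f :: "real \<Rightarrow> ennreal"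
  assumes [measurable]: "f \<in> borel_measurable borel" and c: "0 < c"
  shows "(\<integral>\<^sup>+x. f x * indicator {0<..} x \<partial>lborel) = ennreal c * (\<integral>\<^sup>+x. f (c*x) * indicator {0<..} x \<partial>lborel)"
proof -
  have "(\<integral>\<^sup>+x. f x * indicator {0<..} x \<partial>lborel)
     = ennreal \<bar>c\<bar> * (\<integral>\<^sup>+x. f (0+c*x) * indicator {0<..} (0+c*x) \<partial>lborel)"
    using c by (intro nn_integral_real_affine) auto
  also have "(\<integral>\<^sup>+x. f (0+c*x) * indicator {0<..} (0+c*x) \<partial>lborel) = (\<integral>\<^sup>+x. f (c*x) * indicator {0<..} x \<partial>lborel)"
    using c by (intro nn_integral_cong) (auto simp: indicator_def zero_less_mult_iff)
  finally show ?thesis using c by simp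
qed

text \<open>Polar coordinates by the substitution \<open>x = s y\<close>, as in the classical computation of the
  Gaussian integral.\<close>

lemma nn_integral_quadrant_radial:
  fixes f :: "real \<Rightarrow> real"
  assumes [measurable]: "f \<in> borel_measurable borel" and a: "0 < a"
  shows "(\<integral>\<^sup>+y. (\<integral>\<^sup>+x. ennreal (f (a * (x\<^sup>2 + y\<^sup>2))) * indicator {0<..} x \<partial>lborel) * indicator {0<..} y \<partial>lborel)
     = ennreal (pi / (4*a)) * (\<integral>\<^sup>+u. ennreal (f u) * indicator {0<..} u \<partial>lborel)" (is "?L = _ * ?I")
proof -
  have inner: "(\<integral>\<^sup>+x. ennreal (f (a * (x\<^sup>2 + y\<^sup>2))) * indicator {0<..} x \<partial>lborel)
     = (\<integral>\<^sup>+s. ennreal (y * f (a * (1 + s\<^sup>2) * y\<^sup>2)) * indicator {0<..} s \<partial>lborel)" if y: "0 < y" for y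
  proof -
    have "(\<integral>\<^sup>+x. ennreal (f (a * (x\<^sup>2 + y\<^sup>2))) * indicator {0<..} x \<partial>lborel)
       = ennreal y * (\<integral>\<^sup>+s. ennreal (f (a * ((y* s)\<^sup>2 + y\<^sup>2))) * indicator {0<..} s \<partial>lborel)"
      using y by (intro nn_integral_halfline_scale) auto
    also have "\<dots> = (\<integral>\<^sup>+s. ennreal y * (ennreal (f (a * ((y* s)\<^sup>2 + y\<^sup>2))) * indicator {0<..} s) \<partial>lborel)"
      by (rule nn_integral_cmult[symmetric]) measurable
    also have "\<dots> = (\<integral>\<^sup>+s. ennreal (y * f (a * (1 + s\<^sup>2) * y\<^sup>2)) * indicator {0<..} s \<partial>lborel)"
      using y by (intro nn_integral_cong) (simp add: ennreal_mult'[symmetric] mult.assoc[symmetric], simp add: power_mult_distrib algebra_simps)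
    finally show ?thesis .
  qed
  \<comment> \<open>For a fixed slope s the integrand depends on y only through b y^2 with b = a (1
    + s^2), so the square substitution and a rescaling lead back to the radial integral; the factor
    1 / (1 + s^2) that remains is the angular density.\<close>
  have outer: "(\<integral>\<^sup>+y. ennreal (y * f (a * (1 + s\<^sup>2) * y\<^sup>2)) * indicator {0<..} y \<partial>lborel)
     = ennreal (1 / (2 * a) * (1 / (1 + s\<^sup>2))) * ?I" for s
  proof -
    define b where "b = a * (1 + s\<^sup>2)"
    have b: "0 < b" using a by (auto simp: b_def intro!: mult_pos_pos add_pos_nonneg)
    have I: "?I = ennreal b * (\<integral>\<^sup>+u. ennreal (f (b * u)) * indicator {0<..} u \<partial>lborel)"
      using b by (intro nn_integral_halfline_scale) auto
    have I': "(\<integral>\<^sup>+u. ennreal (f (b * u)) * indicator {0<..} u \<partial>lborel) = ennreal (1/b) * ?I"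
    proof -
      have "ennreal (1/b) * ennreal b = 1" using b by (subst ennreal_mult[symmetric]) auto
      then show ?thesis unfolding I mult.assoc[symmetric] by simp
    qed
    have "(\<integral>\<^sup>+y. ennreal (y * f (b * y\<^sup>2)) * indicator {0<..} y \<partial>lborel)
       = (\<integral>\<^sup>+y. ennreal (1/2) * (ennreal (2 * y * f (b * y\<^sup>2)) * indicator {0<..} y) \<partial>lborel)"
      proof (intro nn_integral_cong)
      fix y :: real
      have "ennreal (y * f (b * y\<^sup>2)) = ennreal (1/2) * ennreal (2 * y * f (b * y\<^sup>2))"
        by (subst ennreal_mult'[symmetric]) auto
      then show "ennreal (y * f (b * y\<^sup>2)) * indicator {0<..} y = ennreal (1/2) * (ennreal (2 * y * f (b * y\<^sup>2)) * indicator {0<..} y)"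
        by (simp only: mult.assoc)
    qed
    also have "\<dots> = ennreal (1/2) * (\<integral>\<^sup>+y. (ennreal (2 * y * f (b * y\<^sup>2)) * indicator {0<..} y) \<partial>lborel)"
      by (rule nn_integral_cmult) measurable
    finally have E1: "(\<integral>\<^sup>+y. ennreal (y * f (b * y\<^sup>2)) * indicator {0<..} y \<partial>lborel)
      = ennreal (1/2) * (\<integral>\<^sup>+y. (ennreal (2 * y * f (b * y\<^sup>2)) * indicator {0<..} y) \<partial>lborel)" .
    have E2: "(\<integral>\<^sup>+y. (ennreal (2 * y * f (b * y\<^sup>2)) * indicator {0<..} y) \<partial>lborel)
       = (\<integral>\<^sup>+u. ennreal (f (b * u)) * indicator {0<..} u \<partial>lborel)"
      by (rule nn_integral_square_subst[symmetric]) measurable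
    have E3: "ennreal (1/2) * (ennreal (1/b) * ?I) = ennreal (1/2 * (1/b)) * ?I"
      using b by (subst mult.assoc[symmetric], subst ennreal_mult[symmetric]) auto
    have E4: "1/2 * (1/b) = 1 / (2 * a) * (1 / (1 + s\<^sup>2))" by (simp add: b_def)
    show ?thesis unfolding b_def[symmetric] E1 E2 I' E3 E4 ..
  qed
  \<comment> \<open>The slopes in (0, infinity) sweep a quarter turn; together with 1 / (2 a) this
    gives pi / (4 a).\<close>
  have arc: "(\<integral>\<^sup>+s. ennreal (1 / (1 + s\<^sup>2)) * indicator {0<..} s \<partial>lborel) = ennreal (pi/2)"
  proof -
    have "(\<integral>\<^sup>+s. ennreal (1 / (1 + s\<^sup>2)) * indicator {0..} s \<partial>lborel) = ennreal (pi/2 - arctan 0)"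
    proof (rule nn_integral_FTC_atLeast[where F = arctan])
      show "DERIV arctan x :> 1 / (1 + x\<^sup>2)" for x :: real
        using DERIV_arctan[of x] by (simp add: inverse_eq_divide)
    qed (auto intro: tendsto_arctan_at_top)
    moreover have "(\<integral>\<^sup>+s. ennreal (1 / (1 + s\<^sup>2)) * indicator {0..} s \<partial>lborel) = (\<integral>\<^sup>+s. ennreal (1 / (1 + s\<^sup>2)) * indicator {0<..} s \<partial>lborel)"
      using AE_lborel_singleton[of 0] by (intro nn_integral_cong_AE) (auto elim!: eventually_mono simp: indicator_def)
    ultimately show ?thesis by simp
  qed
  have "?L = (\<integral>\<^sup>+y. \<integral>\<^sup>+s. ennreal (y * f (a * (1 + s\<^sup>2) * y\<^sup>2)) * indicator {0<..} s * indicator {0<..} y \<partial>lborel \<partial>lborel)"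
  proof (intro nn_integral_cong)
    fix y :: real
    show "(\<integral>\<^sup>+x. ennreal (f (a * (x\<^sup>2 + y\<^sup>2))) * indicator {0<..} x \<partial>lborel) * indicator {0<..} y
      = (\<integral>\<^sup>+s. ennreal (y * f (a * (1 + s\<^sup>2) * y\<^sup>2)) * indicator {0<..} s * indicator {0<..} y \<partial>lborel)"
      by (cases "0 < y") (simp_all add: inner)
  qed
  also have "\<dots> = (\<integral>\<^sup>+s. \<integral>\<^sup>+y. ennreal (y * f (a * (1 + s\<^sup>2) * y\<^sup>2)) * indicator {0<..} s * indicator {0<..} y \<partial>lborel \<partial>lborel)"
    by (rule lborel_pair.Fubini') measurable
  also have "\<dots> = (\<integral>\<^sup>+s. (\<integral>\<^sup>+y. ennreal (y * f (a * (1 + s\<^sup>2) * y\<^sup>2)) * indicator {0<..} y \<partial>lborel) * indicator {0<..} s \<partial>lborel)"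
    by (intro nn_integral_cong) (auto simp: indicator_def)
  also have "\<dots> = (\<integral>\<^sup>+s. (ennreal (1/(2*a)) * ?I) * (ennreal (1 / (1 + s\<^sup>2)) * indicator {0<..} s) \<partial>lborel)"
  proof (intro nn_integral_cong)
    fix s :: real
    have "ennreal (1 / (2 * a) * (1 / (1 + s\<^sup>2))) = ennreal (1 / (2 * a)) * ennreal (1 / (1 + s\<^sup>2))"
      using a by (intro ennreal_mult) auto
    note outer[of s, unfolded this]
    moreover have "p * q * I * r = p * I * (q * r)" for p q I r :: ennreal by (simp only: mult_ac)
    ultimately show "(\<integral>\<^sup>+y. ennreal (y * f (a * (1 + s\<^sup>2) * y\<^sup>2)) * indicator {0<..} y \<partial>lborel) * indicator {0<..} s
      = ennreal (1 / (2 * a)) * ?I * (ennreal (1 / (1 + s\<^sup>2)) * indicator {0<..} s)"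
      by simp
  qed
  also have "\<dots> = ennreal (1/(2*a)) * ?I * (\<integral>\<^sup>+s. ennreal (1 / (1 + s\<^sup>2)) * indicator {0<..} s \<partial>lborel)"
    by (rule nn_integral_cmult) measurable
  finally have "?L = ennreal (1/(2*a)) * ?I * ennreal (pi/2)" unfolding arc .
  moreover have "p * I * q = (p * q) * I" for p q I :: ennreal by (simp only: mult_ac)
  moreover have "ennreal (1/(2*a)) * ennreal (pi/2) = ennreal (pi / (4*a))"
    using a by (subst ennreal_mult[symmetric]) auto
  ultimately show ?thesis by metis
qed

section \<open>Lattice sums and integrals\<close>

text \<open>The value at k is charged to the interval (k-1, k], where f is larger. The first
  interval is (0, 1], so a singularity of f at 0 stays inside the integral.\<close>

lemma sum_le_nn_integral_antimono:
  fixes f :: "real \<Rightarrow> ennreal"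
  assumes f: "\<And>x y. 0 < x \<Longrightarrow> x \<le> y \<Longrightarrow> f y \<le> f x"
  shows "(\<Sum>k=1..n. f (real k)) \<le> (\<integral>\<^sup>+x. f x * indicator {0<..} x \<partial>lborel)"
proof -
  have "(\<Sum>k=1..n. f (real k)) = (\<Sum>k=1..n. \<integral>\<^sup>+x. f (real k) * indicator {real k - 1<..real k} x \<partial>lborel)"
    by (intro sum.cong refl) (simp add: nn_integral_cmult_indicator)
  also have "\<dots> = (\<integral>\<^sup>+x. (\<Sum>k=1..n. f (real k) * indicator {real k - 1<..real k} x) \<partial>lborel)"
    by (intro nn_integral_sum[symmetric]) auto
  also have "\<dots> \<le> (\<integral>\<^sup>+x. f x * indicator {0<..} x \<partial>lborel)"
  proof (rule nn_integral_mono)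
    fix x :: real
    define K where "K = nat \<lceil>x\<rceil>"
    have K: "k = K" if "k \<in> {1..n}" "real k - 1 < x" "x \<le> real k" for k
      using that ceiling_unique[of "int k" x] unfolding K_def by simp
    have "(\<Sum>k=1..n. f (real k) * indicator {real k - 1<..real k} x)
       = (\<Sum>k\<in>{1..n}. if k = K then f (real K) * indicator {real K - 1<..real K} x else 0)"
      using K by (intro sum.cong) (auto simp: indicator_def)
    also have "\<dots> \<le> f (real K) * (indicator {real K - 1<..real K} x * indicator {1..} K)"
      by (auto simp: sum.delta)
    also have "\<dots> \<le> f x * indicator {0<..} x"
      using f[of x "real K"] by (auto simp: indicator_def)
    finally show "(\<Sum>k=1..n. f (real k) * indicator {real k - 1<..real k} x) \<le> f x * indicator {0<..} x" .
  qed
  finally show ?thesis .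
qed

text \<open>Here k is paired with (k, k+1], where f is smaller; the price is that the integral
  starts at 1 and the strip next to 0 has to be estimated separately.\<close>

lemma nn_integral_le_sum_antimono:
  fixes f :: "real \<Rightarrow> ennreal"
  assumes f: "\<And>x y. 0 < x \<Longrightarrow> x \<le> y \<Longrightarrow> f y \<le> f x"
  shows "(\<integral>\<^sup>+x. f x * indicator {1<..real n + 1} x \<partial>lborel) \<le> (\<Sum>k=1..n. f (real k))"
proof -
  have "(\<integral>\<^sup>+x. f x * indicator {1<..real n + 1} x \<partial>lborel)
     \<le> (\<integral>\<^sup>+x. (\<Sum>k=1..n. f (real k) * indicator {real k<..real k + 1} x) \<partial>lborel)"
  proof (rule nn_integral_mono)
    fix x :: real
    define z where "z = \<lceil>x\<rceil>"
    define K where "K = nat (z - 1)"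
    show "f x * indicator {1<..real n + 1} x \<le> (\<Sum>k=1..n. f (real k) * indicator {real k<..real k + 1} x)"
    proof (cases "1 < x \<and> x \<le> real n + 1")
      case True
      have ge: "2 \<le> z" "z \<le> int n + 1"
        using True by (auto simp: z_def ceiling_le_iff le_ceiling_iff)
      then have K: "K \<in> {1..n}" "real K = of_int z - 1"
        by (auto simp: K_def)
      have KK: "real K < x" "x \<le> real K + 1"
        using ceiling_correct[of x] K by (auto simp: z_def)
      have "f x * indicator {1<..real n + 1} x \<le> f (real K) * indicator {real K<..real K + 1} x"
        using True KK K f[of "real K" x] by (auto simp: indicator_def)
      also have "\<dots> \<le> (\<Sum>k=1..n. f (real k) * indicator {real k<..real k + 1} x)"
        by (rule member_le_sum[OF K(1)]) auto
      finally show ?thesis .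
    qed (auto simp: indicator_def)
  qed
  also have "\<dots> = (\<Sum>k=1..n. \<integral>\<^sup>+x. f (real k) * indicator {real k<..real k + 1} x \<partial>lborel)"
    by (intro nn_integral_sum) auto
  also have "\<dots> = (\<Sum>k=1..n. f (real k))"
    by (intro sum.cong refl) (simp add: nn_integral_cmult_indicator)
  finally show ?thesis .
qed

section \<open>The kernel summed over the lattice points of the quadrant\<close>

abbreviation radial_kern :: "real \<Rightarrow> real \<Rightarrow> real \<Rightarrow> real \<Rightarrow> real \<Rightarrow> real" where
  "radial_kern \<alpha> a D x y \<equiv> kern \<alpha> D (a * (x\<^sup>2 + y\<^sup>2))"

lemma radial_kern_antimono:
  assumes "0 < x" "x \<le> x'" "0 < y" "y \<le> y'" "0 < a" "0 \<le> D" "0 \<le> \<alpha>"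
  shows "radial_kern \<alpha> a D x' y' \<le> radial_kern \<alpha> a D x y"
proof (rule kern_antimono)
  show "0 < a * (x\<^sup>2 + y\<^sup>2)" using assms by (intro mult_pos_pos add_pos_pos) auto
  show "a * (x\<^sup>2 + y\<^sup>2) \<le> a * (x'\<^sup>2 + y'\<^sup>2)"
    using assms by (intro mult_left_mono add_mono power_mono) auto
qed (use assms in auto)

lemma nn_integral_radial_kern:
  assumes "0 < \<alpha>" "\<alpha> < 1" "0 < D" "0 < a"
  shows "(\<integral>\<^sup>+y. (\<integral>\<^sup>+x. ennreal (radial_kern \<alpha> a D x y) * indicator {0<..} x \<partial>lborel) * indicator {0<..} y \<partial>lborel)
     = ennreal (D powr \<alpha> * Gamma (1 - \<alpha>) * pi / (4 * a * \<alpha>))"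
proof -
  have "0 \<le> D powr \<alpha> * Gamma (1 - \<alpha>) / \<alpha>" using assms by (simp add: Gamma_real_nonneg)
  then show ?thesis
    unfolding nn_integral_quadrant_radial[OF kern_measurable assms(4)] nn_integral_kern[OF assms(1-3)]
    using assms by (subst ennreal_mult[symmetric]) (auto simp: field_simps)
qed

text \<open>The comparison is made along rows and then across them. The cells (k-1, k] x (l-1, l]
  lie inside the quadrant, so the upper bound carries no error term; the whole error sits in the
  lower bound.\<close>

lemma sum_radial_kern_le:
  assumes "0 < \<alpha>" "\<alpha> < 1" "0 < D" "0 < a"
  shows "(\<Sum>l=1..n. \<Sum>k=1..n. radial_kern \<alpha> a D (real k) (real l))
     \<le> D powr \<alpha> * Gamma (1 - \<alpha>) * pi / (4 * a * \<alpha>)"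
proof -
  have nn: "0 \<le> radial_kern \<alpha> a D x y" for x y
    using assms by (intro kern_nonneg) auto
  have "ennreal (\<Sum>l=1..n. \<Sum>k=1..n. radial_kern \<alpha> a D (real k) (real l))
     = (\<Sum>l=1..n. \<Sum>k=1..n. ennreal (radial_kern \<alpha> a D (real k) (real l)))"
    using nn by (simp add: sum_nonneg)
  also have "\<dots> \<le> (\<Sum>l=1..n. \<integral>\<^sup>+x. ennreal (radial_kern \<alpha> a D x (real l)) * indicator {0<..} x \<partial>lborel)"
    using assms by (intro sum_mono sum_le_nn_integral_antimono ennreal_leI radial_kern_antimono) auto
  also have "\<dots> \<le> (\<integral>\<^sup>+y. (\<integral>\<^sup>+x. ennreal (radial_kern \<alpha> a D x y) * indicator {0<..} x \<partial>lborel) * indicator {0<..} y \<partial>lborel)"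
    using assms
    by (intro sum_le_nn_integral_antimono nn_integral_mono)
       (auto simp: indicator_def intro!: ennreal_leI radial_kern_antimono)
  also note nn_integral_radial_kern[OF assms]
  finally show ?thesis
    using assms by (subst (asm) ennreal_le_iff) (auto simp: Gamma_real_nonneg)
qed

text \<open>One-dimensional factor of a product majorant of \<open>radial_kern\<close> near the
  axes. The power -p is integrable at 0 for p < 1, and the power -2p at infinity for p > 1/2; with p
  = 1 + \<alpha> - b these conditions read b > \<alpha> and b < \<alpha> + 1/2.\<close>

definition edge_weight :: "real \<Rightarrow> real \<Rightarrow> real" where
  "edge_weight p y = (if y \<le> 1 then y powr (-p) else y powr (-2*p))"

lemma edge_weight_measurable [measurable]: "edge_weight p \<in> borel_measurable borel"
  unfolding edge_weight_def[abs_def] by measurable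

lemma edge_weight_nonneg: "0 \<le> edge_weight p y"
  by (simp add: edge_weight_def)

lemma nn_integral_edge_weight:
  assumes p: "1/2 < p" "p < 1"
  shows "(\<integral>\<^sup>+y. ennreal (edge_weight p y) * indicator {0<..} y \<partial>lborel) \<le> ennreal (1/(1-p) + 1/(2*p-1))"
proof -
  have "((\<lambda>y. y powr (-p)) has_integral (1 powr (-p+1) / (-p+1))) {0..1}"
    using p by (intro has_integral_powr_from_0) auto
  from nn_integral_has_integral_lebesgue'[OF _ this]
  have 1: "(\<integral>\<^sup>+y. ennreal (y powr (-p)) * indicator {0..1} y \<partial>lborel) = ennreal (1/(1-p))" by simp
  have "((\<lambda>y. y powr (-2*p)) has_integral (-(1 powr (-2*p+1)) / (-2*p+1))) {1..}"
    using p by (intro has_integral_powr_to_inf) auto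
  from nn_integral_has_integral_lebesgue'[OF _ this]
  moreover have "-(1 powr (-2*p+1)) / (-2*p+1) = 1/(2*p-1)" using p by (simp add: divide_simps)
  ultimately have 2: "(\<integral>\<^sup>+y. ennreal (y powr (-2*p)) * indicator {1..} y \<partial>lborel) = ennreal (1/(2*p-1))"
    by simp
  have "(\<integral>\<^sup>+y. ennreal (edge_weight p y) * indicator {0<..} y \<partial>lborel)
     \<le> (\<integral>\<^sup>+y. ennreal (y powr (-p)) * indicator {0..1} y + ennreal (y powr (-2*p)) * indicator {1..} y \<partial>lborel)"
    by (intro nn_integral_mono) (auto simp: edge_weight_def indicator_def)
  also have "\<dots> = ennreal (1/(1-p)) + ennreal (1/(2*p-1))"
    unfolding 1[symmetric] 2[symmetric] by (intro nn_integral_add) auto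
  also have "\<dots> = ennreal (1/(1-p) + 1/(2*p-1))" using p by (intro ennreal_plus[symmetric]) auto
  finally show ?thesis .
qed

text \<open>After \<open>kern_le_powr\<close> it remains to bound (x^2 + y^2)^(-p) by a product. If
  both coordinates are at most 1, x^2 + y^2 >= x y suffices. If one exceeds 1, the other is dropped
  from the sum and its factor, which is at least 1, is inserted for free.\<close>

lemma radial_kern_le_edge_weight:
  assumes "0 < x" "0 < y" "x \<le> 1 \<or> y \<le> 1" "0 < a" "0 \<le> D" "0 \<le> b" "b \<le> 1"
    and p: "p = 1 + \<alpha> - b" "0 < p"
  shows "radial_kern \<alpha> a D x y \<le> D powr b * a powr (-p) * (edge_weight p x * edge_weight p y)"
proof -
  have pos: "0 < x\<^sup>2 + y\<^sup>2" using assms by (intro add_pos_pos) auto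
  have "(x\<^sup>2 + y\<^sup>2) powr (-p) \<le> edge_weight p x * edge_weight p y"
  proof -
    have small: "(x\<^sup>2 + y\<^sup>2) powr (-p) \<le> x powr (-p) * y powr (-p)"
    proof -
      have "2 * (x * y) \<le> x\<^sup>2 + y\<^sup>2" using sum_squares_bound[of x y] by simp
      moreover have "0 < x * y" using assms by simp
      ultimately have "x * y \<le> x\<^sup>2 + y\<^sup>2" by linarith
      then have "(x\<^sup>2 + y\<^sup>2) powr (-p) \<le> (x * y) powr (-p)"
        using assms by (intro powr_mono2') auto
      then show ?thesis using assms by (simp add: powr_mult)
    qed
    have large: "(u\<^sup>2 + v\<^sup>2) powr (-p) \<le> u powr (-p) * v powr (-2*p)" if "0 < u" "u \<le> 1" "0 < v" for u v :: real
    proof -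
      have "(u\<^sup>2 + v\<^sup>2) powr (-p) \<le> (v\<^sup>2) powr (-p)" using that p by (intro powr_mono2') auto
      also have "\<dots> = 1 powr (-p) * v powr (-2*p)" using that
        by (simp add: powr_powr flip: powr_numeral)
      also have "\<dots> \<le> u powr (-p) * v powr (-2*p)"
        using that p by (intro mult_right_mono powr_mono2') auto
      finally show ?thesis .
    qed
    show ?thesis
      using small large[of x y] large[of y x] assms by (auto simp: edge_weight_def add.commute mult.commute)
  qed
  then have "(a * (x\<^sup>2 + y\<^sup>2)) powr (-p) \<le> a powr (-p) * (edge_weight p x * edge_weight p y)"
    using assms pos by (simp add: powr_mult mult_left_mono)
  then have "D powr b * (a * (x\<^sup>2 + y\<^sup>2)) powr (-p) \<le> D powr b * (a powr (-p) * (edge_weight p x * edge_weight p y))"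
    by (intro mult_left_mono) auto
  moreover have "radial_kern \<alpha> a D x y \<le> D powr b * (a * (x\<^sup>2 + y\<^sup>2)) powr (b - 1 - \<alpha>)"
    using assms pos by (intro kern_le_powr mult_pos_pos) auto
  moreover have "b - 1 - \<alpha> = -p" using p by simp
  ultimately show ?thesis by (simp add: mult.assoc)
qed

text \<open>The lattice sum dominates the integral over (1, n+1]^2, which in the limit misses from
  the quadrant only the region where some coordinate is at most 1, and that region costs O(D^b). The
  constant C is fixed before D; the truncation is absorbed by \<epsilon>, with a threshold for n
  that may depend on D.\<close>

lemma sum_radial_kern_ge:
  assumes al: "0 < \<alpha>" "\<alpha> < 1" and a: "0 < a" and b: "\<alpha> < b" "b \<le> 1" "b < \<alpha> + 1/2"
  shows "\<exists>C. \<forall>D>0. \<forall>\<epsilon>>0. \<forall>\<^sub>F n in sequentially.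
     D powr \<alpha> * Gamma (1 - \<alpha>) * pi / (4 * a * \<alpha>) - C * D powr b - \<epsilon>
       \<le> (\<Sum>l=1..n. \<Sum>k=1..n. radial_kern \<alpha> a D (real k) (real l))"
proof -
  define p where "p = 1 + \<alpha> - b"
  have p: "1/2 < p" "p < 1" using b by (auto simp: p_def)
  define K where "K = 1/(1-p) + 1/(2*p-1)"
  have K: "0 \<le> K" using p by (simp add: K_def)
  define C where "C = a powr (-p) * (K * K)"
  have "\<forall>\<^sub>F n in sequentially.
     D powr \<alpha> * Gamma (1 - \<alpha>) * pi / (4 * a * \<alpha>) - C * D powr b - \<epsilon>
       \<le> (\<Sum>l=1..n. \<Sum>k=1..n. radial_kern \<alpha> a D (real k) (real l))" if D: "0 < D" and e: "0 < \<epsilon>" for D \<epsilon>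
  proof -
    define F where "F x y = ennreal (radial_kern \<alpha> a D x y)" for x y
    define Q where "Q = D powr \<alpha> * Gamma (1 - \<alpha>) * pi / (4 * a * \<alpha>)"
    have nn: "0 \<le> radial_kern \<alpha> a D x y" for x y
      using a D by (intro kern_nonneg) auto
    have [measurable]: "case_prod F \<in> borel_measurable (borel \<Otimes>\<^sub>M borel)"
      unfolding F_def[abs_def] by measurable
    have [measurable]: "F x \<in> borel_measurable borel" "(\<lambda>x. F x y) \<in> borel_measurable borel" for x y
      unfolding F_def[abs_def] by measurable
    define T where "T n = (\<integral>\<^sup>+y. \<integral>\<^sup>+x. F x y * indicator {1<..real n+1} x * indicator {1<..real n+1} y \<partial>lborel \<partial>lborel)" for n :: nat
    have Tle: "T n \<le> ennreal (\<Sum>l=1..n. \<Sum>k=1..n. radial_kern \<alpha> a D (real k) (real l))" for n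
    proof -
      have "T n = (\<integral>\<^sup>+y. (\<integral>\<^sup>+x. F x y * indicator {1<..real n+1} x \<partial>lborel) * indicator {1<..real n+1} y \<partial>lborel)"
        unfolding T_def by (intro nn_integral_cong nn_integral_multc) measurable
      also have "\<dots> \<le> (\<Sum>l=1..n. (\<integral>\<^sup>+x. F x (real l) * indicator {1<..real n+1} x \<partial>lborel))"
        using D a al unfolding F_def
        by (intro nn_integral_le_sum_antimono nn_integral_mono)
           (auto simp: indicator_def intro!: ennreal_leI radial_kern_antimono)
      also have "\<dots> \<le> (\<Sum>l=1..n. \<Sum>k=1..n. F (real k) (real l))"
        using D a al unfolding F_def
        by (intro sum_mono nn_integral_le_sum_antimono ennreal_leI radial_kern_antimono) auto
      also have "\<dots> = ennreal (\<Sum>l=1..n. \<Sum>k=1..n. radial_kern \<alpha> a D (real k) (real l))"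
        unfolding F_def using nn by (simp add: sum_nonneg)
      finally show ?thesis .
    qed
    have ind: "indicator {1<..real n+1} x \<le> (indicator {1<..real m+1} x :: ennreal)" if "n \<le> m" for n m x
      using that by (auto simp: indicator_def)
    have step: "F x y * indicator {1<..real n+1} x * indicator {1<..real n+1} y
        \<le> F x y * indicator {1<..real (Suc n)+1} x * indicator {1<..real (Suc n)+1} y" for x y n
      by (intro mult_mono ind) auto
    have Tmono: "incseq T"
      unfolding T_def by (intro incseq_SucI nn_integral_mono step)
    have SUP: "(SUP n. T n) = (\<integral>\<^sup>+y. \<integral>\<^sup>+x. F x y * indicator {1<..} x * indicator {1<..} y \<partial>lborel \<partial>lborel)"
    proof -
      have 1: "(SUP n. F x y * indicator {1<..real n+1} x * indicator {1<..real n+1} y) = F x y * indicator {1<..} x * indicator {1<..} y" for x y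
      proof (cases "1 < x \<and> 1 < y")
        case True
        obtain n where n: "max x y \<le> real n" using real_arch_simple by blast
        show ?thesis
        proof (rule antisym)
          show "(SUP n. F x y * indicator {1<..real n+1} x * indicator {1<..real n+1} y) \<le> F x y * indicator {1<..} x * indicator {1<..} y"
            using True by (intro SUP_least) (auto simp: indicator_def)
          show "F x y * indicator {1<..} x * indicator {1<..} y \<le> (SUP n. F x y * indicator {1<..real n+1} x * indicator {1<..real n+1} y)"
            using True n by (intro SUP_upper2[of n]) (auto simp: indicator_def)
        qed
      qed (auto simp: indicator_def)
      have 2: "(SUP n. \<integral>\<^sup>+x. F x y * indicator {1<..real n+1} x * indicator {1<..real n+1} y \<partial>lborel)
        = (\<integral>\<^sup>+x. F x y * indicator {1<..} x * indicator {1<..} y \<partial>lborel)" for y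
        unfolding 1[symmetric] by (rule nn_integral_monotone_convergence_SUP[symmetric])
          (use step in \<open>auto intro!: incseq_SucI le_funI\<close>)
      show ?thesis unfolding T_def 2[symmetric]
        by (rule nn_integral_monotone_convergence_SUP[symmetric])
          (use step in \<open>auto intro!: incseq_SucI le_funI nn_integral_mono\<close>)
    qed
    have "ennreal Q = (\<integral>\<^sup>+y. \<integral>\<^sup>+x. F x y * indicator {0<..} x * indicator {0<..} y \<partial>lborel \<partial>lborel)"
      unfolding Q_def nn_integral_radial_kern[OF al D a, symmetric] F_def
      by (intro nn_integral_cong nn_integral_multc[symmetric]) measurable
    \<comment> \<open>Where both coordinates exceed 1 the first summand already suffices; on the
      rest of the quadrant the product majorant takes over.\<close>
    also have "\<dots> \<le> (\<integral>\<^sup>+y. \<integral>\<^sup>+x. F x y * indicator {1<..} x * indicator {1<..} y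
        + ennreal (D powr b * a powr (-p)) * (ennreal (edge_weight p y) * indicator {0<..} y) * (ennreal (edge_weight p x) * indicator {0<..} x)  \<partial>lborel \<partial>lborel)"
    proof (intro nn_integral_mono)
      fix x y :: real
      have "F x y \<le> ennreal (D powr b * a powr (-p)) * ennreal (edge_weight p y) * ennreal (edge_weight p x)"
        if "0 < x" "0 < y" "x \<le> 1 \<or> y \<le> 1"
      proof -
        have "F x y \<le> ennreal (D powr b * a powr (-p) * (edge_weight p x * edge_weight p y))"
          unfolding F_def using that a D b al p
          by (intro ennreal_leI radial_kern_le_edge_weight) (auto simp: p_def)
        then show ?thesis
          by (simp add: ennreal_mult edge_weight_nonneg mult_ac)
      qed
      then show "F x y * indicator {0<..} x * indicator {0<..} y \<le> F x y * indicator {1<..} x * indicator {1<..} y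
        + ennreal (D powr b * a powr (-p)) * (ennreal (edge_weight p y) * indicator {0<..} y) * (ennreal (edge_weight p x) * indicator {0<..} x)"
        by (auto simp: indicator_def)
    qed
    also have "\<dots> = (SUP n. T n) + (\<integral>\<^sup>+y. \<integral>\<^sup>+x. ennreal (D powr b * a powr (-p)) * (ennreal (edge_weight p y) * indicator {0<..} y) * (ennreal (edge_weight p x) * indicator {0<..} x)  \<partial>lborel \<partial>lborel)"
      unfolding SUP by (subst nn_integral_add[symmetric]) (auto simp: nn_integral_add)
    also have "(\<integral>\<^sup>+y. \<integral>\<^sup>+x. ennreal (D powr b * a powr (-p)) * (ennreal (edge_weight p y) * indicator {0<..} y) * (ennreal (edge_weight p x) * indicator {0<..} x)  \<partial>lborel \<partial>lborel)
       = ennreal (D powr b * a powr (-p)) * ((\<integral>\<^sup>+y. (ennreal (edge_weight p y) * indicator {0<..} y) \<partial>lborel) * (\<integral>\<^sup>+x. (ennreal (edge_weight p x) * indicator {0<..} x) \<partial>lborel))"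
      (is "(\<integral>\<^sup>+y. \<integral>\<^sup>+x. ?c * ?A y * ?A x \<partial>lborel \<partial>lborel) = _")
    proof -
      have "(\<integral>\<^sup>+y. \<integral>\<^sup>+x. ?c * ?A y * ?A x \<partial>lborel \<partial>lborel) = (\<integral>\<^sup>+y. ?c * ?A y * (\<integral>\<^sup>+x. ?A x \<partial>lborel) \<partial>lborel)"
        by (intro nn_integral_cong nn_integral_cmult) measurable
      also have "\<dots> = (\<integral>\<^sup>+y. ?c * ?A y \<partial>lborel) * (\<integral>\<^sup>+x. ?A x \<partial>lborel)"
        by (intro nn_integral_multc) measurable
      also have "(\<integral>\<^sup>+y. ?c * ?A y \<partial>lborel) = ?c * (\<integral>\<^sup>+y. ?A y \<partial>lborel)"
        by (intro nn_integral_cmult) measurable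
      finally show ?thesis by (simp only: mult.assoc)
    qed
    also have "\<dots> \<le> ennreal (D powr b * a powr (-p)) * (ennreal K * ennreal K)"
      unfolding K_def using nn_integral_edge_weight[OF p] by (intro mult_left_mono mult_mono) auto
    also have "\<dots> = ennreal (C * D powr b)"
      using K unfolding C_def by (simp add: ennreal_mult mult_ac)
    finally have Q: "ennreal Q \<le> (SUP n. T n) + ennreal (C * D powr b)" by simp
    have Cn: "0 \<le> C * D powr b" using K by (simp add: C_def)
    show ?thesis
    \<comment> \<open>A negative lower bound is trivial and has to be set aside, because
      \<open>ennreal\<close> sends negative reals to 0.\<close>
    proof (cases "Q - C * D powr b - \<epsilon> < 0")
      case True
      then show ?thesis unfolding Q_def[symmetric]
        by (intro always_eventually allI)
          (meson less_imp_le nn order_trans sum_nonneg)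
    next
      case False
      \<comment> \<open>If no \<open>T n\<close> exceeded this value, neither would the supremum,
        and the full integral Q would be at most Q - \<epsilon>. This is where \<epsilon> is
        spent.\<close>
      have "\<exists>n. ennreal (Q - C * D powr b - \<epsilon>) < T n"
      proof (rule ccontr)
        assume "\<not> ?thesis"
        then have "(SUP n. T n) \<le> ennreal (Q - C * D powr b - \<epsilon>)" by (intro SUP_least) (auto simp: not_less)
        then have "ennreal Q \<le> ennreal (Q - C * D powr b - \<epsilon>) + ennreal (C * D powr b)"
          using Q by (meson add_right_mono order_trans)
        also have "\<dots> = ennreal (Q - \<epsilon>)"
          using False Cn by (subst ennreal_plus[symmetric]) auto
        finally have "Q \<le> Q - \<epsilon>"
          using False Cn e by (subst (asm) ennreal_le_iff) auto
        with e show False by simp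
      qed
      then obtain n0 where n0: "ennreal (Q - C * D powr b - \<epsilon>) < T n0" by blast
      show ?thesis unfolding Q_def[symmetric]
      proof (rule eventually_sequentiallyI[of n0])
        fix n assume "n0 \<le> n"
        then have "ennreal (Q - C * D powr b - \<epsilon>) \<le> ennreal (\<Sum>l=1..n. \<Sum>k=1..n. radial_kern \<alpha> a D (real k) (real l))"
          using n0 Tle[of n] incseqD[OF Tmono, of n0 n] by (meson less_imp_le order_trans)
        then show "Q - C * D powr b - \<epsilon> \<le> (\<Sum>l=1..n. \<Sum>k=1..n. radial_kern \<alpha> a D (real k) (real l))"
          by (subst (asm) ennreal_le_iff) (auto intro!: sum_nonneg nn)
      qed
    qed
  qed
  then show ?thesis by blast
qed

section \<open>Spectral sums with oscillating factors\<close>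

text \<open>The eigenvalues with a = pi^2 \<theta>2, where c collects the part that does not depend
  on the mode. The constant c may be negative; the condition imposed below is 2 a + c > 0, the
  positivity of the (1,1) eigenvalue.\<close>

definition quad_eigenval :: "real \<Rightarrow> real \<Rightarrow> nat \<Rightarrow> nat \<Rightarrow> real" where
  "quad_eigenval a c k l = a * ((real k)\<^sup>2 + (real l)\<^sup>2) + c"

text \<open>On the modes s = k^2 + l^2 is at least 2, so an affine function of s that is above c0 s
  at s = 2 and has slope at least c0 stays above it. Positivity of a single eigenvalue thus makes
  all of them comparable from below to k^2 + l^2.\<close>

lemma quad_eigenval_ge:
  assumes "0 < a" "0 < 2 * a + c"
  shows "\<exists>c0>0. c0 \<le> a \<and> (\<forall>k\<ge>1. \<forall>l\<ge>1. c0 * ((real k)\<^sup>2 + (real l)\<^sup>2) \<le> quad_eigenval a c k l)"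
proof -
  define m where "m = min ((2*a+c)/2) a"
  have m: "0 < m" "m \<le> a" using assms by (auto simp: m_def)
  have m': "m \<le> (2*a+c)/2" unfolding m_def by (rule min.cobounded1)
  have "m * ((real k)\<^sup>2 + (real l)\<^sup>2) \<le> quad_eigenval a c k l" if "1 \<le> k" "1 \<le> l" for k l
  proof -
    have "1 \<le> (real k)\<^sup>2" "1 \<le> (real l)\<^sup>2" using that by (auto intro!: one_le_power)
    then have "m * ((real k)\<^sup>2 + (real l)\<^sup>2 - 2) \<le> a * ((real k)\<^sup>2 + (real l)\<^sup>2 - 2)"
      using m by (intro mult_right_mono) auto
    moreover have "2 * m \<le> 2 * a + c" using m' by simp
    ultimately show ?thesis
      unfolding quad_eigenval_def by (simp add: algebra_simps)
  qed
  with m show ?thesis by blast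
qed

lemma sum_powr_le:
  assumes "1 < (q::real)"
  shows "\<exists>C\<ge>0. \<forall>n. (\<Sum>k=1..n. real k powr (-q)) \<le> C"
proof (intro exI conjI allI)
  have s: "summable (\<lambda>k. real k powr (-q))" using assms by (simp add: summable_real_powr_iff)
  show "0 \<le> (\<Sum>k. real k powr (-q))" using s by (intro suminf_nonneg) auto
  show "(\<Sum>k=1..n. real k powr (-q)) \<le> (\<Sum>k. real k powr (-q))" for n
    using s by (intro sum_le_suminf) auto
qed

text \<open>By k^2 + l^2 >= k l the double series is dominated by a product of two convergent
  one-dimensional series.\<close>

lemma double_sum_powr_le:
  assumes "0 < \<beta>"
  shows "\<exists>C\<ge>0. \<forall>n. (\<Sum>l=1..n. \<Sum>k=1..n. ((real k)\<^sup>2 + (real l)\<^sup>2) powr (-1-\<beta>)) \<le> C"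
proof -
  obtain C where C: "0 \<le> C" "\<And>n. (\<Sum>k=1..n. real k powr (-(1+\<beta>))) \<le> C"
    using sum_powr_le[of "1+\<beta>"] assms by auto
  have "(\<Sum>l=1..n. \<Sum>k=1..n. ((real k)\<^sup>2 + (real l)\<^sup>2) powr (-1-\<beta>)) \<le> C * C" for n
  proof -
    have "((real k)\<^sup>2 + (real l)\<^sup>2) powr (-1-\<beta>) \<le> real k powr (-(1+\<beta>)) * real l powr (-(1+\<beta>))"
      if "k \<in> {1..n}" "l \<in> {1..n}" for k l
    proof -
      have pos: "0 < real k * real l" using that by simp
      have "2 * (real k * real l) \<le> (real k)\<^sup>2 + (real l)\<^sup>2" using sum_squares_bound[of "real k" "real l"] by simp
      then have "real k * real l \<le> (real k)\<^sup>2 + (real l)\<^sup>2" using pos by linarith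
      then have "((real k)\<^sup>2 + (real l)\<^sup>2) powr (-(1+\<beta>)) \<le> (real k * real l) powr (-(1+\<beta>))"
        using pos assms by (intro powr_mono2') auto
      then show ?thesis by (simp add: powr_mult)
    qed
    then have "(\<Sum>l=1..n. \<Sum>k=1..n. ((real k)\<^sup>2 + (real l)\<^sup>2) powr (-1-\<beta>))
      \<le> (\<Sum>l=1..n. \<Sum>k=1..n. real k powr (-(1+\<beta>)) * real l powr (-(1+\<beta>)))"
      by (intro sum_mono) blast
    also have "\<dots> = (\<Sum>k=1..n. real k powr (-(1+\<beta>))) * (\<Sum>l=1..n. real l powr (-(1+\<beta>)))"
      by (subst sum.swap) (simp add: sum_product)
    also have "\<dots> \<le> C * C" using C by (intro mult_mono sum_nonneg) auto
    finally show ?thesis .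
  qed
  then show ?thesis using C by (intro exI[of _ "C*C"]) auto
qed

text \<open>Dropping c changes a term by O(D (k^2 + l^2)^(-1-\<alpha>)), which is summable over the
  lattice for \<alpha> > 0. The derivative of the kernel is evaluated at c0 (k^2 + l^2), a lower
  bound for both arguments; for the unshifted one this uses c0 <= a.\<close>

lemma sum_kern_shift:
  assumes a: "0 < a" "0 < 2*a+c" and al: "0 < \<alpha>"
  shows "\<exists>C\<ge>0. \<forall>D\<ge>0. \<forall>n. \<bar>(\<Sum>l=1..n. \<Sum>k=1..n. kern \<alpha> D (quad_eigenval a c k l))
     - (\<Sum>l=1..n. \<Sum>k=1..n. radial_kern \<alpha> a D (real k) (real l))\<bar> \<le> C * D"
proof -
  obtain c0 where c0: "0 < c0" "c0 \<le> a" "\<And>k l. 1 \<le> k \<Longrightarrow> 1 \<le> l \<Longrightarrow> c0 * ((real k)\<^sup>2 + (real l)\<^sup>2) \<le> quad_eigenval a c k l"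
    using quad_eigenval_ge[OF a] by blast
  obtain C where C: "0 \<le> C" "\<And>n. (\<Sum>l=1..n. \<Sum>k=1..n. ((real k)\<^sup>2 + (real l)\<^sup>2) powr (-1-\<alpha>)) \<le> C"
    using double_sum_powr_le[OF al] by blast
  define C' where "C' = (2+\<alpha>) * c0 powr (-1-\<alpha>) * \<bar>c\<bar>"
  have C': "0 \<le> C'" using al by (simp add: C'_def)
  have "\<bar>(\<Sum>l=1..n. \<Sum>k=1..n. kern \<alpha> D (quad_eigenval a c k l))
     - (\<Sum>l=1..n. \<Sum>k=1..n. radial_kern \<alpha> a D (real k) (real l))\<bar> \<le> (C' * C) * D" if D: "0 \<le> D" for D n
  proof -
    have diff: "\<bar>kern \<alpha> D (quad_eigenval a c k l) - radial_kern \<alpha> a D (real k) (real l)\<bar>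
       \<le> C' * D * ((real k)\<^sup>2 + (real l)\<^sup>2) powr (-1-\<alpha>)" if "k \<in> {1..n}" "l \<in> {1..n}" for k l
    proof -
      let ?s = "(real k)\<^sup>2 + (real l)\<^sup>2"
      have s: "0 < ?s" using that by (intro add_pos_pos) auto
      have "\<bar>kern \<alpha> D (quad_eigenval a c k l) - radial_kern \<alpha> a D (real k) (real l)\<bar>
        \<le> (2+\<alpha>) * D * (c0 * ?s) powr (-1-\<alpha>) * \<bar>quad_eigenval a c k l - a * ?s\<bar>"
        using that c0 s D al by (intro kern_diff_le mult_pos_pos mult_right_mono) auto
      also have "\<dots> = C' * D * ?s powr (-1-\<alpha>)"
        using c0 s by (simp add: C'_def quad_eigenval_def powr_mult)
      finally show ?thesis .
    qed
    have "\<bar>(\<Sum>l=1..n. \<Sum>k=1..n. kern \<alpha> D (quad_eigenval a c k l))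
     - (\<Sum>l=1..n. \<Sum>k=1..n. radial_kern \<alpha> a D (real k) (real l))\<bar>
      = \<bar>\<Sum>l=1..n. \<Sum>k=1..n. kern \<alpha> D (quad_eigenval a c k l) - radial_kern \<alpha> a D (real k) (real l)\<bar>"
      by (simp add: sum_subtractf)
    also have "\<dots> \<le> (\<Sum>l=1..n. \<Sum>k=1..n. C' * D * ((real k)\<^sup>2 + (real l)\<^sup>2) powr (-1-\<alpha>))"
      by (intro order_trans[OF sum_abs] sum_mono) (use diff in blast)+
    also have "\<dots> = C' * D * (\<Sum>l=1..n. \<Sum>k=1..n. ((real k)\<^sup>2 + (real l)\<^sup>2) powr (-1-\<alpha>))"
      by (simp add: sum_distrib_left)
    also have "\<dots> \<le> C' * D * C" using C C' D by (intro mult_left_mono) auto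
    finally show ?thesis by (simp add: mult_ac)
  qed
  then show ?thesis using C C' by (intro exI[of _ "C'*C"]) auto
qed

text \<open>Size of the full spectral sum, uniformly in the truncation. The fluctuation of the noise
  part and the contribution of the initial condition are estimated at this precision.\<close>

lemma sum_kern_le:
  assumes a: "0 < a" "0 < 2*a+c" and al: "0 < \<alpha>" "\<alpha> < 1"
  shows "\<exists>C\<ge>0. \<forall>D. 0 < D \<longrightarrow> D \<le> 1 \<longrightarrow> (\<forall>n. (\<Sum>l=1..n. \<Sum>k=1..n. kern \<alpha> D (quad_eigenval a c k l)) \<le> C * D powr \<alpha>)"
proof -
  obtain C where C: "0 \<le> C" "\<And>D n. 0 \<le> D \<Longrightarrow> \<bar>(\<Sum>l=1..n. \<Sum>k=1..n. kern \<alpha> D (quad_eigenval a c k l))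
     - (\<Sum>l=1..n. \<Sum>k=1..n. radial_kern \<alpha> a D (real k) (real l))\<bar> \<le> C * D"
    using sum_kern_shift[OF a al(1)] by blast
  let ?G = "Gamma (1 - \<alpha>) * pi / (4 * a * \<alpha>)"
  show ?thesis
  proof (intro exI[of _ "?G + C"] conjI allI impI)
    show "0 \<le> ?G + C" using a al C by (simp add: Gamma_real_nonneg)
    fix D :: real and n :: nat assume D: "0 < D" "D \<le> 1"
    have "D powr 1 \<le> D powr \<alpha>" using D al by (intro powr_mono') auto
    then have "C * D \<le> C * D powr \<alpha>" using D C by (intro mult_left_mono) auto
    then show "(\<Sum>l=1..n. \<Sum>k=1..n. kern \<alpha> D (quad_eigenval a c k l)) \<le> (?G + C) * D powr \<alpha>"
      using C(2)[of D n] sum_radial_kern_le[OF al D(1) a(1), of n] D by (simp add: algebra_simps)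
  qed
qed

text \<open>A row is a one-dimensional sum with terms of order D^b l^(-2(1+\<alpha>-b)), and it
  converges for b < \<alpha> + 1/2. Compared with the order D^\<alpha> of the full sum this gains
  almost half a power of D, which is the origin of the restriction r < 1/2.\<close>

lemma sum_kern_row_le:
  assumes a: "0 < a" "0 < 2*a+c" and b: "0 \<le> b" "b \<le> 1" "b < \<alpha> + 1/2"
  shows "\<exists>C\<ge>0. \<forall>D\<ge>0. \<forall>n. (\<Sum>l=1..n. kern \<alpha> D (quad_eigenval a c 1 l)) \<le> C * D powr b"
proof -
  obtain c0 where c0: "0 < c0" "\<And>k l. 1 \<le> k \<Longrightarrow> 1 \<le> l \<Longrightarrow> c0 * ((real k)\<^sup>2 + (real l)\<^sup>2) \<le> quad_eigenval a c k l"
    using quad_eigenval_ge[OF a] by blast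
  define q where "q = 2 * (1 + \<alpha> - b)"
  have q: "1 < q" using b by (simp add: q_def)
  obtain C where C: "0 \<le> C" "\<And>n. (\<Sum>k=1..n. real k powr (-q)) \<le> C"
    using sum_powr_le[OF q] by blast
  have "(\<Sum>l=1..n. kern \<alpha> D (quad_eigenval a c 1 l)) \<le> (c0 powr (b-1-\<alpha>) * C) * D powr b" if D: "0 \<le> D" for D n
  proof -
    have "kern \<alpha> D (quad_eigenval a c 1 l) \<le> D powr b * c0 powr (b-1-\<alpha>) * real l powr (-q)" if "l \<in> {1..n}" for l
    proof -
      have l: "0 < real l" using that by simp
      have lam: "c0 * (real l)\<^sup>2 \<le> quad_eigenval a c 1 l"
        using c0(2)[of 1 l] c0(1) that by (simp add: algebra_simps)
      have "0 < c0 * (real l)\<^sup>2" using c0 l by simp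
      then have "kern \<alpha> D (quad_eigenval a c 1 l) \<le> D powr b * quad_eigenval a c 1 l powr (b - 1 - \<alpha>)"
        using lam D b by (intro kern_le_powr) auto
      also have "\<dots> \<le> D powr b * (c0 * (real l)\<^sup>2) powr (b - 1 - \<alpha>)"
        using lam c0 l b q by (intro mult_left_mono powr_mono2') (auto simp: q_def)
      also have "\<dots> = D powr b * c0 powr (b-1-\<alpha>) * real l powr (-q)"
        using c0 l by (simp add: powr_mult powr_powr q_def algebra_simps flip: powr_numeral)
      finally show ?thesis .
    qed
    then have "(\<Sum>l=1..n. kern \<alpha> D (quad_eigenval a c 1 l)) \<le> (\<Sum>l=1..n. D powr b * c0 powr (b-1-\<alpha>) * real l powr (-q))"
      by (intro sum_mono) auto
    also have "\<dots> = D powr b * c0 powr (b-1-\<alpha>) * (\<Sum>l=1..n. real l powr (-q))"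
      by (simp add: sum_distrib_left)
    also have "\<dots> \<le> D powr b * c0 powr (b-1-\<alpha>) * C"
      using C by (intro mult_left_mono) auto
    finally show ?thesis by (simp add: mult_ac)
  qed
  then show ?thesis using C by (intro exI[of _ "c0 powr (b-1-\<alpha>) * C"]) auto
qed

section \<open>Summation by parts against the oscillating cosines\<close>

lemma abs_sum_mult_antimono_le:
  fixes A u :: "nat \<Rightarrow> real"
  assumes A: "\<And>k. 1 \<le> k \<Longrightarrow> 0 \<le> A k" "\<And>k. 1 \<le> k \<Longrightarrow> A (Suc k) \<le> A k"
    and S: "\<And>n. \<bar>\<Sum>k=1..n. u k\<bar> \<le> B"
  shows "\<bar>\<Sum>k=1..n. A k * u k\<bar> \<le> A 1 * B"
proof (cases "n = 0")
  case True
  have "0 \<le> B" using S[of 0] by simp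
  with True A(1)[of 1] show ?thesis by simp
next
  case False
  define S' where "S' n = (\<Sum>k=1..n. u k)" for n
  \<comment> \<open>Summation by parts as an induction: each step adds (A n - A (n+1)) S' n, and the
    variation of the monotone sequence A telescopes to A 1 - A n.\<close>
  have "\<bar>(\<Sum>k=1..n. A k * u k) - A n * S' n\<bar> \<le> (A 1 - A n) * B" if "1 \<le> n" for n
    using that
  proof (induction n rule: dec_induct)
    case base
    then show ?case by (simp add: S'_def)
  next
    case (step n)
    have "(\<Sum>k=1..Suc n. A k * u k) - A (Suc n) * S' (Suc n)
       = ((\<Sum>k=1..n. A k * u k) - A n * S' n) + (A n - A (Suc n)) * S' n"
      using step by (simp add: S'_def algebra_simps)
    also have "\<bar>\<dots>\<bar> \<le> \<bar>(\<Sum>k=1..n. A k * u k) - A n * S' n\<bar> + \<bar>(A n - A (Suc n)) * S' n\<bar>"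
      by (rule abs_triangle_ineq)
    also have "\<bar>(A n - A (Suc n)) * S' n\<bar> \<le> (A n - A (Suc n)) * B"
      using step A(2)[of n] S[of n] unfolding abs_mult S'_def by (intro mult_mono) auto
    finally show ?case using step by (simp add: algebra_simps)
  qed
  from this[of n] have "\<bar>(\<Sum>k=1..n. A k * u k) - A n * S' n\<bar> \<le> (A 1 - A n) * B" using False by simp
  moreover have "\<bar>A n * S' n\<bar> \<le> A n * B"
    using S[of n] A(1)[of n] False unfolding abs_mult S'_def by (intro mult_mono) auto
  ultimately show ?thesis by (simp add: algebra_simps)
qed

text \<open>Multiplication by 2 sin(pi y) telescopes the sum and leaves two sines. The bound is
  uniform because sin(pi y) >= sin(pi \<delta>) on [\<delta>, 1-\<delta>]; here the distance of the
  design from the boundary enters.\<close>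

lemma abs_sum_cos_le:
  assumes d: "0 < \<delta>" "\<delta> < 1/2" and y: "\<delta> \<le> y" "y \<le> 1 - \<delta>"
  shows "\<bar>\<Sum>k=1..n. cos (2 * (pi * real k * y))\<bar> \<le> 1 / sin (pi * \<delta>)"
proof -
  have sd: "0 < sin (pi * \<delta>)" using d by (intro sin_gt_zero) auto
  \<comment> \<open>The symmetry of the sine about y = 1/2 reduces the right half of the interval to
    the left one.\<close>
  have sy: "sin (pi * \<delta>) \<le> sin (pi * y)"
  proof (cases "y \<le> 1/2")
    case True
    have "pi * y \<le> pi * (1/2)" using True by (intro mult_left_mono) auto
    moreover have "pi * \<delta> \<le> pi * y" using y by (intro mult_left_mono) auto
    moreover have "0 \<le> pi * \<delta>" using d by simp
    ultimately show ?thesis using pi_gt_zero by (intro sin_monotone_2pi_le) linarith+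
  next
    case False
    have "pi * (1 - y) \<le> pi * (1/2)" using False by (intro mult_left_mono) auto
    moreover have "pi * \<delta> \<le> pi * (1 - y)" using y by (intro mult_left_mono) auto
    moreover have "0 \<le> pi * \<delta>" using d by simp
    ultimately have "sin (pi * \<delta>) \<le> sin (pi * (1 - y))"
      using pi_gt_zero by (intro sin_monotone_2pi_le) linarith+
    also have "\<dots> = sin (pi * y)" by (simp add: algebra_simps sin_diff)
    finally show ?thesis .
  qed
  have tel: "2 * sin (pi * y) * (\<Sum>k=1..n. cos (2 * (pi * real k * y))) = sin ((2 * real n + 1) * (pi * y)) - sin (pi * y)"
  proof (induction n)
    case (Suc n)
    have "2 * sin (pi * y) * cos (2 * (pi * real (Suc n) * y))
      = sin ((2 * real (Suc n) + 1) * (pi * y)) - sin ((2 * real n + 1) * (pi * y))"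
    proof -
      have "sin (p + q) - sin (p - q) = 2 * sin q * cos p" for p q :: real by (simp add: sin_add sin_diff)
      from this[of "2 * (pi * real (Suc n) * y)" "pi * y"] show ?thesis
        by (simp add: algebra_simps)
    qed
    with Suc show ?case by (simp add: algebra_simps)
  qed simp
  have "\<bar>2 * sin (pi * y) * (\<Sum>k=1..n. cos (2 * (pi * real k * y)))\<bar> \<le> 2"
    unfolding tel using abs_sin_le_one[of "(2 * real n + 1) * (pi * y)"] abs_sin_le_one[of "pi * y"] by linarith
  then have "sin (pi * y) * \<bar>\<Sum>k=1..n. cos (2 * (pi * real k * y))\<bar> \<le> 1"
    using sd sy by (simp add: abs_mult)
  moreover have "sin (pi * \<delta>) * \<bar>\<Sum>k=1..n. cos (2 * (pi * real k * y))\<bar> \<le> sin (pi * y) * \<bar>\<Sum>k=1..n. cos (2 * (pi * real k * y))\<bar>"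
    using sy by (intro mult_right_mono) auto
  ultimately show ?thesis using sd by (simp add: pos_le_divide_eq mult.commute)
qed

lemma quad_eigenval_pos:
  assumes "0 < a" "0 < 2*a+c" "1 \<le> k" "1 \<le> l"
  shows "0 < quad_eigenval a c k l"
proof -
  obtain c0 where "0 < c0" "c0 * ((real k)\<^sup>2 + (real l)\<^sup>2) \<le> quad_eigenval a c k l"
    using quad_eigenval_ge[OF assms(1,2)] assms by blast
  moreover from this have "0 < c0 * ((real k)\<^sup>2 + (real l)\<^sup>2)" using assms by (intro mult_pos_pos add_pos_pos) auto
  ultimately show ?thesis by linarith
qed

lemma quad_eigenval_mono:
  "0 < a \<Longrightarrow> k \<le> k' \<Longrightarrow> l \<le> l' \<Longrightarrow> quad_eigenval a c k l \<le> quad_eigenval a c k' l'"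
  unfolding quad_eigenval_def by (intro add_right_mono mult_left_mono add_mono power_mono) auto

text \<open>With cosines Y and Z of the doubled angles the trigonometric weight is 1 - Y (1 - Z) -
  Z. The 1 produces the integral, and each cosine is summed in its own direction, which leaves one
  row of the kernel. The rows carry the weights |1 - Z| <= 2 and 1, hence 3 B C2 in the constant; C1
  is the shift of the eigenvalues, C3 the loss along the axes, and the final 1 the slack \<epsilon>
  = D^b.\<close>

lemma sum_kern_sin_sq:
  assumes a: "0 < a" "0 < 2*a+c" and al: "0 < \<alpha>" "\<alpha> < 1"
    and b: "\<alpha> < b" "b \<le> 1" "b < \<alpha> + 1/2" and d: "0 < \<delta>" "\<delta> < 1/2"
  shows "\<exists>C\<ge>0. \<forall>D y z. 0 < D \<longrightarrow> D \<le> 1 \<longrightarrow> y \<in> {\<delta>..1-\<delta>} \<longrightarrow> z \<in> {\<delta>..1-\<delta>} \<longrightarrow>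
    (\<forall>\<^sub>F n in sequentially.
      \<bar>(\<Sum>l=1..n. \<Sum>k=1..n. kern \<alpha> D (quad_eigenval a c k l) * (4 * (sin (pi * real k * y))\<^sup>2 * (sin (pi * real l * z))\<^sup>2))
        - D powr \<alpha> * Gamma (1 - \<alpha>) * pi / (4 * a * \<alpha>)\<bar> \<le> C * D powr b)"
proof -
  obtain C1 where C1: "0 \<le> C1" "\<And>D n. 0 \<le> D \<Longrightarrow> \<bar>(\<Sum>l=1..n. \<Sum>k=1..n. kern \<alpha> D (quad_eigenval a c k l))
     - (\<Sum>l=1..n. \<Sum>k=1..n. radial_kern \<alpha> a D (real k) (real l))\<bar> \<le> C1 * D"
    using sum_kern_shift[OF a al(1)] by blast
  obtain C2 where C2: "0 \<le> C2" "\<And>D n. 0 \<le> D \<Longrightarrow> (\<Sum>l=1..n. kern \<alpha> D (quad_eigenval a c 1 l)) \<le> C2 * D powr b"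
    using sum_kern_row_le[OF a _ b(2,3)] al b by auto
  obtain C3 where C3: "\<And>D \<epsilon>. 0 < D \<Longrightarrow> 0 < \<epsilon> \<Longrightarrow> \<forall>\<^sub>F n in sequentially.
     D powr \<alpha> * Gamma (1 - \<alpha>) * pi / (4 * a * \<alpha>) - C3 * D powr b - \<epsilon>
       \<le> (\<Sum>l=1..n. \<Sum>k=1..n. radial_kern \<alpha> a D (real k) (real l))"
    using sum_radial_kern_ge[OF al a(1) b] by blast
  define B where "B = 1 / sin (pi * \<delta>)"
  have B: "0 \<le> B" using d unfolding B_def by (intro divide_nonneg_nonneg sin_ge_zero) auto
  define C where "C = C1 + 3 * B * C2 + \<bar>C3\<bar> + 1"
  show ?thesis
  proof (intro exI[of _ C] conjI allI impI)
    show "0 \<le> C" using C1 C2 B by (simp add: C_def)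
    fix D y z assume D: "0 < D" "D \<le> (1::real)" and y: "y \<in> {\<delta>..1-\<delta>}" and z: "z \<in> {\<delta>..1-\<delta>}"
    have Db: "D \<le> D powr b" using powr_mono'[of b 1 D] D b by simp
    define h where "h k l = kern \<alpha> D (quad_eigenval a c k l)" for k l
    have h_nn: "0 \<le> h k l" if "1 \<le> k" "1 \<le> l" for k l
      unfolding h_def using quad_eigenval_pos[OF a that] D by (intro kern_nonneg) auto
    have h_mono: "h k' l' \<le> h k l" if "1 \<le> k" "1 \<le> l" "k \<le> k'" "l \<le> l'" for k l k' l'
      unfolding h_def using quad_eigenval_pos[OF a that(1,2)] that D al a
      by (intro kern_antimono quad_eigenval_mono) auto
    have h_sym: "h k l = h l k" for k l
      by (simp add: h_def quad_eigenval_def add.commute)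
    define Y where "Y k = cos (2 * (pi * real k * y))" for k
    define Z where "Z l = cos (2 * (pi * real l * z))" for l
    have trig: "4 * (sin (pi * real k * y))\<^sup>2 * (sin (pi * real l * z))\<^sup>2 = 1 - Y k * (1 - Z l) - Z l" for k l
    proof -
      have "Y k = 1 - 2 * (sin (pi * real k * y))\<^sup>2" "Z l = 1 - 2 * (sin (pi * real l * z))\<^sup>2"
        unfolding Y_def Z_def by (rule cos_double_sin)+
      then show ?thesis by (simp only:) (simp add: algebra_simps)
    qed
    have cosY: "\<bar>\<Sum>k=1..n. h k l * Y k\<bar> \<le> h 1 l * B" if "1 \<le> l" for l n
      using that h_nn h_mono abs_sum_cos_le[OF d, of y] y
      by (intro abs_sum_mult_antimono_le[where A = "\<lambda>k. h k l"]) (auto simp: Y_def B_def)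
    have cosZ: "\<bar>\<Sum>l=1..n. h k l * Z l\<bar> \<le> h 1 k * B" if "1 \<le> k" for k n
      unfolding h_sym[of 1 k] using that h_nn h_mono abs_sum_cos_le[OF d, of z] z
      by (intro abs_sum_mult_antimono_le[where A = "\<lambda>l. h k l"]) (auto simp: Z_def B_def)
    have "\<forall>\<^sub>F n in sequentially.
     D powr \<alpha> * Gamma (1 - \<alpha>) * pi / (4 * a * \<alpha>) - C3 * D powr b - D powr b
       \<le> (\<Sum>l=1..n. \<Sum>k=1..n. radial_kern \<alpha> a D (real k) (real l))"
      using D by (intro C3) auto
    then show "\<forall>\<^sub>F n in sequentially.
      \<bar>(\<Sum>l=1..n. \<Sum>k=1..n. kern \<alpha> D (quad_eigenval a c k l) * (4 * (sin (pi * real k * y))\<^sup>2 * (sin (pi * real l * z))\<^sup>2))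
        - D powr \<alpha> * Gamma (1 - \<alpha>) * pi / (4 * a * \<alpha>)\<bar> \<le> C * D powr b"
    proof eventually_elim
      case (elim n)
      let ?H = "\<Sum>l=1..n. \<Sum>k=1..n. h k l"
      have "(\<Sum>l=1..n. \<Sum>k=1..n. h k l * (1 - Y k * (1 - Z l) - Z l))
        = ?H - (\<Sum>l=1..n. (1 - Z l) * (\<Sum>k=1..n. h k l * Y k)) - (\<Sum>l=1..n. \<Sum>k=1..n. h k l * Z l)"
        by (simp add: algebra_simps sum_subtractf sum.distrib sum_distrib_left)
      \<comment> \<open>The order is exchanged so that the sum over l, in which Z oscillates,
        becomes the inner one.\<close>
      also have "(\<Sum>l=1..n. \<Sum>k=1..n. h k l * Z l) = (\<Sum>k=1..n. \<Sum>l=1..n. h k l * Z l)"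
        by (rule sum.swap)
      finally have eq: "(\<Sum>l=1..n. \<Sum>k=1..n. h k l * (1 - Y k * (1 - Z l) - Z l))
        = ?H - (\<Sum>l=1..n. (1 - Z l) * (\<Sum>k=1..n. h k l * Y k)) - (\<Sum>k=1..n. \<Sum>l=1..n. h k l * Z l)" .
      have row: "(\<Sum>l=1..n. h 1 l) \<le> C2 * D powr b" unfolding h_def using C2 D by auto
      have e1: "\<bar>\<Sum>l=1..n. (1 - Z l) * (\<Sum>k=1..n. h k l * Y k)\<bar> \<le> 2 * B * (C2 * D powr b)"
      proof -
        have "\<bar>\<Sum>l=1..n. (1 - Z l) * (\<Sum>k=1..n. h k l * Y k)\<bar> \<le> (\<Sum>l=1..n. 2 * (h 1 l * B))"
        proof (intro order_trans[OF sum_abs] sum_mono)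
          fix l assume "l \<in> {1..n}"
          then show "\<bar>(1 - Z l) * (\<Sum>k=1..n. h k l * Y k)\<bar> \<le> 2 * (h 1 l * B)"
            unfolding abs_mult using abs_cos_le_one[of "2 * (pi * real l * z)"] cosY[of l n]
            by (intro mult_mono) (auto simp: Z_def)
        qed
        also have "\<dots> = 2 * B * (\<Sum>l=1..n. h 1 l)" by (simp add: sum_distrib_left mult_ac)
        also have "\<dots> \<le> 2 * B * (C2 * D powr b)" using row B by (intro mult_left_mono) auto
        finally show ?thesis .
      qed
      have e2: "\<bar>\<Sum>k=1..n. \<Sum>l=1..n. h k l * Z l\<bar> \<le> B * (C2 * D powr b)"
      proof -
        have "\<bar>\<Sum>k=1..n. \<Sum>l=1..n. h k l * Z l\<bar> \<le> (\<Sum>k=1..n. h 1 k * B)"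
          by (rule order_trans[OF sum_abs], rule sum_mono) (use cosZ in auto)
        also have "\<dots> = B * (\<Sum>l=1..n. h 1 l)" by (simp add: sum_distrib_left mult_ac)
        also have "\<dots> \<le> B * (C2 * D powr b)" using row B by (intro mult_left_mono) auto
        finally show ?thesis .
      qed
      have e3: "\<bar>?H - (\<Sum>l=1..n. \<Sum>k=1..n. radial_kern \<alpha> a D (real k) (real l))\<bar> \<le> C1 * D powr b"
        using C1(2)[of D n] D Db C1(1) mult_left_mono[OF Db C1(1)] unfolding h_def by linarith
      have e4: "C3 * D powr b \<le> \<bar>C3\<bar> * D powr b" by (intro mult_right_mono) auto
      have e5: "C * D powr b = C1 * D powr b + 2 * B * (C2 * D powr b) + B * (C2 * D powr b) + \<bar>C3\<bar> * D powr b + D powr b"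
        by (simp add: C_def algebra_simps)
      have e6: "0 \<le> D powr b" "0 \<le> \<bar>C3\<bar> * D powr b" by auto
      show ?case
        unfolding trig h_def[symmetric] eq
        using e1 e2 e3 e4 e5 e6 elim sum_radial_kern_le[OF al D(1) a(1), of n] by linarith
    qed
  qed
qed

section \<open>Gaussian random variables\<close>

definition sq_integrable :: "'a measure \<Rightarrow> ('a \<Rightarrow> real) \<Rightarrow> bool" where
  "sq_integrable M f \<longleftrightarrow> f \<in> borel_measurable M \<and> integrable M (\<lambda>x. (f x)\<^sup>2)"

lemma sq_integrable_measurable [measurable_dest]: "sq_integrable M f \<Longrightarrow> f \<in> borel_measurable M"
  by (simp add: sq_integrable_def)

lemma sq_integrableD: "sq_integrable M f \<Longrightarrow> integrable M (\<lambda>x. (f x)\<^sup>2)"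
  by (simp add: sq_integrable_def)

lemma sq_integrable_zero: "sq_integrable M (\<lambda>_. 0)"
  by (simp add: sq_integrable_def)

lemma sq_integrable_mult:
  assumes "sq_integrable M f" "sq_integrable M g"
  shows "integrable M (\<lambda>x. f x * g x)"
proof (rule Bochner_Integration.integrable_bound)
  show "integrable M (\<lambda>x. (f x)\<^sup>2 + (g x)\<^sup>2)" using assms by (auto simp: sq_integrable_def)
  show "(\<lambda>x. f x * g x) \<in> borel_measurable M" using assms by (auto simp: sq_integrable_def)
  have "\<bar>a * b\<bar> \<le> a\<^sup>2 + b\<^sup>2" for a b :: real
    using sum_squares_bound[of a b] sum_squares_bound[of a "-b"] zero_le_power2[of a] zero_le_power2[of b]
    by (auto simp: abs_if)
  then show "AE x in M. norm (f x * g x) \<le> norm ((f x)\<^sup>2 + (g x)\<^sup>2)" by simp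
qed

lemma sq_integrable_add:
  assumes "sq_integrable M f" "sq_integrable M g"
  shows "sq_integrable M (\<lambda>x. f x + g x)"
  using assms sq_integrable_mult[OF assms]
  by (auto simp: sq_integrable_def power2_sum mult.assoc)

lemma sq_integrable_cmult:
  "sq_integrable M f \<Longrightarrow> sq_integrable M (\<lambda>x. c * f x)"
  by (auto simp: sq_integrable_def power_mult_distrib)

lemma sq_integrable_diff:
  assumes "sq_integrable M f" "sq_integrable M g"
  shows "sq_integrable M (\<lambda>x. f x - g x)"
  using sq_integrable_add[OF assms(1) sq_integrable_cmult[OF assms(2), of "-1"]] by simp

lemma sq_integrable_sum:
  "(\<And>i. i \<in> I \<Longrightarrow> sq_integrable M (f i)) \<Longrightarrow> sq_integrable M (\<lambda>x. \<Sum>i\<in>I. f i x)"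
  by (induction I rule: infinite_finite_induct) (auto simp: sq_integrable_zero sq_integrable_add)

lemma integral_mult_sums:
  fixes f :: "'i \<Rightarrow> 'a \<Rightarrow> real" and g :: "'j \<Rightarrow> 'a \<Rightarrow> real"
  assumes f: "\<And>i. i \<in> A \<Longrightarrow> sq_integrable M (f i)" and g: "\<And>j. j \<in> B \<Longrightarrow> sq_integrable M (g j)"
  shows "(LINT x|M. (\<Sum>i\<in>A. a i * f i x) * (\<Sum>j\<in>B. b j * g j x))
    = (\<Sum>i\<in>A. \<Sum>j\<in>B. a i * b j * (LINT x|M. f i x * g j x))"
proof -
  have int: "integrable M (\<lambda>x. a i * b j * (f i x * g j x))" if "i \<in> A" "j \<in> B" for i j
    using sq_integrable_mult[OF f g] that by (intro integrable_mult_right)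
  have "(LINT x|M. (\<Sum>i\<in>A. a i * f i x) * (\<Sum>j\<in>B. b j * g j x))
    = (LINT x|M. (\<Sum>i\<in>A. \<Sum>j\<in>B. a i * b j * (f i x * g j x)))"
    unfolding sum_product by (simp only: mult.assoc mult.left_commute)
  also have "\<dots> = (\<Sum>i\<in>A. (LINT x|M. (\<Sum>j\<in>B. a i * b j * (f i x * g j x))))"
    by (intro Bochner_Integration.integral_sum Bochner_Integration.integrable_sum int)
  also have "\<dots> = (\<Sum>i\<in>A. \<Sum>j\<in>B. (LINT x|M. a i * b j * (f i x * g j x)))"
    by (intro sum.cong refl Bochner_Integration.integral_sum int)
  finally show ?thesis by simp
qed

lemma Cauchy_Schwarz_integral:
  assumes f: "sq_integrable M f" and g: "sq_integrable M g"
  shows "(LINT x|M. f x * g x)\<^sup>2 \<le> (LINT x|M. (f x)\<^sup>2) * (LINT x|M. (g x)\<^sup>2)"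
proof -
  let ?A = "LINT x|M. (f x)\<^sup>2" and ?B = "LINT x|M. (g x)\<^sup>2" and ?C = "LINT x|M. f x * g x"
  have q: "0 \<le> ?A + 2 * t * ?C + t\<^sup>2 * ?B" for t
  proof -
    have "0 \<le> (LINT x|M. (f x + t * g x)\<^sup>2)" by simp
    also have "(LINT x|M. (f x + t * g x)\<^sup>2) = (LINT x|M. (f x)\<^sup>2 + 2 * t * (f x * g x) + t\<^sup>2 * (g x)\<^sup>2)"
      by (intro Bochner_Integration.integral_cong) (auto simp: power2_eq_square algebra_simps)
    also have "\<dots> = ?A + 2 * t * ?C + t\<^sup>2 * ?B"
      using sq_integrableD[OF f] sq_integrableD[OF g] sq_integrable_mult[OF f g] by simp
    finally show ?thesis .
  qed
  show ?thesis
  proof (cases "?B = 0")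
    case True
    have "?C = 0"
    proof (rule ccontr)
      assume C: "?C \<noteq> 0"
      \<comment> \<open>Without its quadratic term the nonnegative polynomial in t is affine with
        slope 2 C; this t would give it the value -1.\<close>
      have "0 \<le> ?A + 2 * (-(?A + 1) / (2 * ?C)) * ?C" using q[of "-(?A + 1) / (2 * ?C)"] True by simp
      also have "\<dots> = -1" using C by (simp add: field_simps)
      finally show False by simp
    qed
    then show ?thesis by simp
  next
    case False
    then have B: "0 < ?B" by (simp add: order.not_eq_order_implies_strict)
    have "0 \<le> ?A + 2 * (-?C / ?B) * ?C + (-?C / ?B)\<^sup>2 * ?B" by (rule q)
    also have "\<dots> = ?A - ?C\<^sup>2 / ?B" using B by (simp add: field_simps power2_eq_square)
    finally show ?thesis using B by (simp add: field_simps)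
  qed
qed

lemma abs_integral_mult_le:
  assumes f: "sq_integrable M f" and g: "sq_integrable M g"
  shows "\<bar>LINT x|M. f x * g x\<bar> \<le> sqrt (LINT x|M. (f x)\<^sup>2) * sqrt (LINT x|M. (g x)\<^sup>2)"
  using real_sqrt_le_mono[OF Cauchy_Schwarz_integral[OF assms]] by (simp add: real_sqrt_mult)

lemma nn_integral_sq_diff_less_top:
  assumes [measurable]: "f \<in> borel_measurable M" and g: "sq_integrable M g"
    and fin: "(\<integral>\<^sup>+x. ennreal ((f x - g x)\<^sup>2) \<partial>M) < \<infinity>"
  shows "sq_integrable M f" "sq_integrable M (\<lambda>x. f x - g x)"
    "(\<integral>\<^sup>+x. ennreal ((f x - g x)\<^sup>2) \<partial>M) = ennreal (LINT x|M. (f x - g x)\<^sup>2)"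
proof -
  have [measurable]: "g \<in> borel_measurable M" using g by measurable
  have "integrable M (\<lambda>x. (f x - g x)\<^sup>2)"
    using fin by (intro integrableI_nonneg) auto
  then show d: "sq_integrable M (\<lambda>x. f x - g x)" by (simp add: sq_integrable_def)
  show "sq_integrable M f" using sq_integrable_add[OF d g] by simp
  show "(\<integral>\<^sup>+x. ennreal ((f x - g x)\<^sup>2) \<partial>M) = ennreal (LINT x|M. (f x - g x)\<^sup>2)"
    using sq_integrableD[OF d] by (intro nn_integral_eq_integral) auto
qed

text \<open>The model is formulated with nonnegative integrals of squared differences. As these tend
  to 0 they are eventually finite, so f inherits square integrability from one approximant, and
  real-valued integrals may be used from there on.\<close>

lemma L2_limit:
  assumes f: "f \<in> borel_measurable M" and fn: "\<And>n. sq_integrable M (fn n)"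
    and lim: "(\<lambda>n. \<integral>\<^sup>+x. ennreal ((f x - fn n x)\<^sup>2) \<partial>M) \<longlonglongrightarrow> 0"
  shows "sq_integrable M f" "(\<lambda>n. LINT x|M. (f x - fn n x)\<^sup>2) \<longlonglongrightarrow> 0"
proof -
  have ev: "\<forall>\<^sub>F n in sequentially. (\<integral>\<^sup>+x. ennreal ((f x - fn n x)\<^sup>2) \<partial>M) < \<infinity>"
    using lim by (rule order_tendstoD) simp
  then obtain n where "(\<integral>\<^sup>+x. ennreal ((f x - fn n x)\<^sup>2) \<partial>M) < \<infinity>"
    by (auto simp: eventually_sequentially)
  then show "sq_integrable M f" by (rule nn_integral_sq_diff_less_top(1)[OF f fn])
  have "\<forall>\<^sub>F n in sequentially. (\<integral>\<^sup>+x. ennreal ((f x - fn n x)\<^sup>2) \<partial>M) = ennreal (LINT x|M. (f x - fn n x)\<^sup>2)"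
    using ev by eventually_elim (rule nn_integral_sq_diff_less_top(3)[OF f fn])
  with lim have "(\<lambda>n. ennreal (LINT x|M. (f x - fn n x)\<^sup>2)) \<longlonglongrightarrow> ennreal 0"
    by (simp add: tendsto_cong)
  then show "(\<lambda>n. LINT x|M. (f x - fn n x)\<^sup>2) \<longlonglongrightarrow> 0"
    by (subst (asm) tendsto_ennreal_iff) auto
qed

text \<open>The difference <fn, gn> - <f, g> is expanded as <f - fn, g - gn> - <f - fn, g> - <f, g -
  gn>, and Cauchy-Schwarz is applied to each term.\<close>

lemma L2_inner_limit:
  assumes f: "f \<in> borel_measurable M" and fn: "\<And>n. sq_integrable M (fn n)"
    and limf: "(\<lambda>n. \<integral>\<^sup>+x. ennreal ((f x - fn n x)\<^sup>2) \<partial>M) \<longlonglongrightarrow> 0"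
    and g: "g \<in> borel_measurable M" and gn: "\<And>n. sq_integrable M (gn n)"
    and limg: "(\<lambda>n. \<integral>\<^sup>+x. ennreal ((g x - gn n x)\<^sup>2) \<partial>M) \<longlonglongrightarrow> 0"
  shows "(\<lambda>n. LINT x|M. fn n x * gn n x) \<longlonglongrightarrow> (LINT x|M. f x * g x)"
proof -
  note F = L2_limit[OF f fn limf] and G = L2_limit[OF g gn limg]
  let ?a = "\<lambda>n. sqrt (LINT x|M. (f x - fn n x)\<^sup>2)" and ?b = "\<lambda>n. sqrt (LINT x|M. (g x - gn n x)\<^sup>2)"
  let ?f = "sqrt (LINT x|M. (f x)\<^sup>2)" and ?g = "sqrt (LINT x|M. (g x)\<^sup>2)"
  have bound: "norm ((LINT x|M. fn n x * gn n x) - (LINT x|M. f x * g x)) \<le> ?a n * ?b n + ?a n * ?g + ?f * ?b n" for n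
  proof -
    note df = sq_integrable_diff[OF F(1) fn[of n]] and dg = sq_integrable_diff[OF G(1) gn[of n]]
    have "(LINT x|M. fn n x * gn n x) - (LINT x|M. f x * g x) = (LINT x|M. fn n x * gn n x - f x * g x)"
      using sq_integrable_mult[OF fn gn] sq_integrable_mult[OF F(1) G(1)] by simp
    also have "\<dots> = (LINT x|M. (f x - fn n x) * (g x - gn n x) - (f x - fn n x) * g x - f x * (g x - gn n x))"
      by (intro Bochner_Integration.integral_cong) (auto simp: algebra_simps)
    also have "\<dots> = (LINT x|M. (f x - fn n x) * (g x - gn n x)) - (LINT x|M. (f x - fn n x) * g x) - (LINT x|M. f x * (g x - gn n x))"
      using sq_integrable_mult[OF df dg] sq_integrable_mult[OF df G(1)] sq_integrable_mult[OF F(1) dg] by simp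
    finally show ?thesis
      using abs_integral_mult_le[OF df dg] abs_integral_mult_le[OF df G(1)] abs_integral_mult_le[OF F(1) dg]
      by simp
  qed
  have "(\<lambda>n. ?a n * ?b n + ?a n * ?g + ?f * ?b n) \<longlonglongrightarrow> sqrt 0 * sqrt 0 + sqrt 0 * ?g + ?f * sqrt 0"
    by (intro tendsto_intros F(2) G(2))
  then have "(\<lambda>n. (LINT x|M. fn n x * gn n x) - (LINT x|M. f x * g x)) \<longlonglongrightarrow> 0"
    by (intro Lim_null_comparison[OF always_eventually[OF allI[OF bound]]]) simp
  then show ?thesis by (simp add: LIM_zero_iff)
qed

section \<open>Centred Gaussian laws\<close>

context prob_space
begin

text \<open>Characteristic functions pass to mean-square limits and to sums of independent
  variables, and they include the degenerate law v = 0, which has no density. The mean is 0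
  throughout.\<close>

definition gaussian :: "('a \<Rightarrow> real) \<Rightarrow> real \<Rightarrow> bool" where
  "gaussian Y v \<longleftrightarrow> Y \<in> borel_measurable M \<and> 0 \<le> v \<and>
     (\<forall>u. char (distr M borel Y) u = complex_of_real (exp (-(v * u\<^sup>2) / 2)))"

lemma gaussian_measurable [measurable_dest]: "gaussian Y v \<Longrightarrow> Y \<in> borel_measurable M"
  by (simp add: gaussian_def)

lemma char_distr_eq: "Y \<in> borel_measurable M \<Longrightarrow> char (distr M borel Y) u = (CLINT \<omega>|M. iexp (u * Y \<omega>))"
  by (simp add: char_def integral_distr)

text \<open>Levy's uniqueness theorem identifies the law with that of sqrt v times a standard normal
  variable, from which all moments are then read off.\<close>

lemma gaussian_distr:
  assumes "gaussian Y v"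
  shows "distr M borel Y = distr std_normal_distribution borel (\<lambda>x. sqrt v * x)"
proof (rule Levy_uniqueness)
  interpret N: real_distribution std_normal_distribution by (rule real_dist_normal_dist)
  have [measurable]: "Y \<in> borel_measurable M" using assms by measurable
  show "real_distribution (distr M borel Y)" by (rule real_distribution_distr) measurable
  show "real_distribution (distr std_normal_distribution borel (\<lambda>x. sqrt v * x))"
    by (rule N.real_distribution_distr) simp
  show "char (distr M borel Y) = char (distr std_normal_distribution borel (\<lambda>x. sqrt v * x))"
  proof
    fix u
    have "char (distr std_normal_distribution borel (\<lambda>x. sqrt v * x)) u = char std_normal_distribution (u * sqrt v)"
      by (subst N.char_distr_eq) (simp_all add: char_def mult.assoc)
    also have "\<dots> = complex_of_real (exp (-(v * u\<^sup>2) / 2))"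
      using assms by (simp add: char_std_normal_distribution power_mult_distrib gaussian_def mult.commute)
    finally show "char (distr M borel Y) u = char (distr std_normal_distribution borel (\<lambda>x. sqrt v * x)) u"
      using assms by (simp add: gaussian_def)
  qed
qed

lemma gaussian_even_moment:
  assumes "gaussian Y v"
  shows "integrable M (\<lambda>\<omega>. Y \<omega> ^ (2*k))"
    "expectation (\<lambda>\<omega>. Y \<omega> ^ (2*k)) = v ^ k * (fact (2 * k) / (2^k * fact k))"
proof -
  have [measurable]: "Y \<in> borel_measurable M" using assms by measurable
  have v: "sqrt v ^ (2*k) = v ^ k" using assms by (simp add: power_mult gaussian_def)
  have "integrable (distr M borel Y) (\<lambda>x. x ^ (2*k))"
    unfolding gaussian_distr[OF assms] using std_normal_distribution_even_moments(2)[of k]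
    by (subst integrable_distr_eq) (auto simp: power_mult_distrib)
  then show "integrable M (\<lambda>\<omega>. Y \<omega> ^ (2*k))" by (simp add: integrable_distr_eq)
  have "expectation (\<lambda>\<omega>. Y \<omega> ^ (2*k)) = (LINT x|distr M borel Y. x ^ (2*k))"
    by (simp add: integral_distr)
  also have "\<dots> = (LINT x|std_normal_distribution. v ^ k * x ^ (2*k))"
    unfolding gaussian_distr[OF assms] by (subst integral_distr) (auto simp: power_mult_distrib v)
  also have "\<dots> = v ^ k * (fact (2 * k) / (2^k * fact k))"
    using std_normal_distribution_even_moments[of k] by simp
  finally show "expectation (\<lambda>\<omega>. Y \<omega> ^ (2*k)) = v ^ k * (fact (2 * k) / (2^k * fact k))" .
qed

lemma gaussian_moments:
  assumes "gaussian Y v"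
  shows "sq_integrable M Y" "expectation (\<lambda>\<omega>. (Y \<omega>)\<^sup>2) = v"
    "integrable M (\<lambda>\<omega>. Y \<omega> ^ 4)" "expectation (\<lambda>\<omega>. Y \<omega> ^ 4) = 3 * v\<^sup>2"
  using gaussian_even_moment[OF assms, of 1] gaussian_even_moment[OF assms, of 2] assms
  by (simp_all add: sq_integrable_def gaussian_def fact_numeral)

lemma gaussian_cmult:
  assumes "gaussian Y v"
  shows "gaussian (\<lambda>\<omega>. c * Y \<omega>) (c\<^sup>2 * v)"
proof -
  have [measurable]: "Y \<in> borel_measurable M" using assms by measurable
  have "char (distr M borel (\<lambda>\<omega>. c * Y \<omega>)) u = char (distr M borel Y) (u * c)" for u
    by (simp add: char_distr_eq mult.assoc)
  then show ?thesis using assms by (simp add: gaussian_def power_mult_distrib mult_ac)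
qed

lemma gaussian_cong_AE:
  assumes "gaussian Y v" "Y' \<in> borel_measurable M" "AE \<omega> in M. Y' \<omega> = Y \<omega>"
  shows "gaussian Y' v"
proof -
  have [measurable]: "Y \<in> borel_measurable M" "Y' \<in> borel_measurable M" using assms by measurable
  have "distr M borel Y' = distr M borel Y"
    using assms by (intro distr_cong_AE) auto
  then show ?thesis using assms by (simp add: gaussian_def)
qed

lemma gaussian_zero: "gaussian (\<lambda>_. 0) 0"
  using prob_space by (simp add: gaussian_def char_distr_eq del: distr_const)

lemma gaussian_sum:
  assumes "finite I" "indep_vars (\<lambda>_. borel) Y I" "\<And>i. i \<in> I \<Longrightarrow> gaussian (Y i) (v i)"
  shows "gaussian (\<lambda>\<omega>. \<Sum>i\<in>I. Y i \<omega>) (\<Sum>i\<in>I. v i)"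
  unfolding gaussian_def
proof (intro conjI allI)
  show "(\<lambda>\<omega>. \<Sum>i\<in>I. Y i \<omega>) \<in> borel_measurable M"
    using assms by (intro borel_measurable_sum) (auto simp: gaussian_def)
  show "0 \<le> (\<Sum>i\<in>I. v i)" using assms by (intro sum_nonneg) (auto simp: gaussian_def)
  fix u
  have "char (distr M borel (\<lambda>\<omega>. \<Sum>i\<in>I. Y i \<omega>)) u = (\<Prod>i\<in>I. char (distr M borel (Y i)) u)"
    by (rule char_distr_sum) fact
  also have "\<dots> = (\<Prod>i\<in>I. complex_of_real (exp (-(v i * u\<^sup>2) / 2)))"
    using assms by (intro prod.cong refl) (simp add: gaussian_def)
  also have "\<dots> = complex_of_real (exp (\<Sum>i\<in>I. -(v i * u\<^sup>2) / 2))"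
    using assms(1) by (simp add: exp_sum)
  also have "(\<Sum>i\<in>I. -(v i * u\<^sup>2) / 2) = -((\<Sum>i\<in>I. v i) * u\<^sup>2) / 2"
    by (simp add: sum_negf sum_divide_distrib sum_distrib_right)
  finally show "char (distr M borel (\<lambda>\<omega>. \<Sum>i\<in>I. Y i \<omega>)) u = complex_of_real (exp (-((\<Sum>i\<in>I. v i) * u\<^sup>2) / 2))" .
qed

lemma gaussian_normal:
  assumes Y: "distributed M lborel Y (normal_density 0 s)" and s: "0 < s"
  shows "gaussian Y (s\<^sup>2)"
proof -
  have [measurable]: "Y \<in> borel_measurable M"
    using distributed_measurable[OF Y] by simp
  have "distributed M lborel (\<lambda>x. (Y x - 0) / s) std_normal_density"
    using Y normal_standard_normal_convert[OF s, of Y 0] by simp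
  then have "distr M lborel (\<lambda>x. Y x / s) = density lborel std_normal_density"
    by (simp add: distributed_def)
  moreover have "distr M lborel (\<lambda>x. Y x / s) = distr M borel (\<lambda>x. Y x / s)"
    by (intro distr_cong) auto
  ultimately have d: "distr M borel (\<lambda>x. Y x / s) = std_normal_distribution" by simp
  have "gaussian (\<lambda>x. Y x / s) 1"
    using d by (simp add: gaussian_def char_std_normal_distribution)
  from gaussian_cmult[OF this, of s] s show ?thesis by simp
qed

lemma abs_expectation_le_sqrt:
  assumes "sq_integrable M Y"
  shows "expectation (\<lambda>\<omega>. \<bar>Y \<omega>\<bar>) \<le> sqrt (expectation (\<lambda>\<omega>. (Y \<omega>)\<^sup>2))"
proof -
  have "sq_integrable M (\<lambda>\<omega>. \<bar>Y \<omega>\<bar>)" "sq_integrable M (\<lambda>\<omega>. 1)"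
    using assms by (auto simp: sq_integrable_def)
  from abs_integral_mult_le[OF this] show ?thesis using prob_space by simp
qed

text \<open>The characteristic function at u is Lipschitz in mean square with constant |u|, so those
  of the approximants converge. Their variances converge to E Y^2 by continuity of the inner
  product, which identifies the limit.\<close>

lemma gaussian_limit:
  assumes Y[measurable]: "Y \<in> borel_measurable M"
    and approx: "\<And>\<epsilon>. 0 < \<epsilon> \<Longrightarrow> \<exists>Y' v'. gaussian Y' v' \<and> (\<integral>\<^sup>+\<omega>. ennreal ((Y \<omega> - Y' \<omega>)\<^sup>2) \<partial>M) < ennreal \<epsilon>"
  shows "gaussian Y (expectation (\<lambda>\<omega>. (Y \<omega>)\<^sup>2))"
proof -
  have "\<exists>p. gaussian (fst p) (snd p) \<and> (\<integral>\<^sup>+\<omega>. ennreal ((Y \<omega> - fst p \<omega>)\<^sup>2) \<partial>M) < ennreal (1 / real (Suc n))" for n :: nat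
  proof -
    have "0 < 1 / real (Suc n)" by simp
    from approx[OF this] show ?thesis by (elim exE) (rule exI[of _ "(_, _)"], simp only: fst_conv snd_conv)
  qed
  then have "\<exists>p. \<forall>n. gaussian (fst (p n)) (snd (p n)) \<and> (\<integral>\<^sup>+\<omega>. ennreal ((Y \<omega> - fst (p n) \<omega>)\<^sup>2) \<partial>M) < ennreal (1 / real (Suc n))"
    by (intro choice allI)
  then obtain p where p: "\<forall>n. gaussian (fst (p n)) (snd (p n)) \<and> (\<integral>\<^sup>+\<omega>. ennreal ((Y \<omega> - fst (p n) \<omega>)\<^sup>2) \<partial>M) < ennreal (1 / real (Suc n))"
    by (elim exE)
  define Yn where "Yn n = fst (p n)" for n
  define vn where "vn n = snd (p n)" for n
  have Yn: "gaussian (Yn n) (vn n)"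
    and le: "(\<integral>\<^sup>+\<omega>. ennreal ((Y \<omega> - Yn n \<omega>)\<^sup>2) \<partial>M) < ennreal (1 / real (Suc n))" for n
    using p[rule_format, of n] by (simp_all only: Yn_def vn_def)
  have [measurable]: "Yn n \<in> borel_measurable M" for n using Yn by measurable
  have lim: "(\<lambda>n. \<integral>\<^sup>+\<omega>. ennreal ((Y \<omega> - Yn n \<omega>)\<^sup>2) \<partial>M) \<longlonglongrightarrow> 0"
  proof (rule tendsto_sandwich[where f = "\<lambda>_. 0" and h = "\<lambda>n. ennreal (1 / real (Suc n))"])
    have "(\<lambda>n. ennreal (1 / real (Suc n))) \<longlonglongrightarrow> ennreal 0"
      by (intro tendsto_ennrealI) (rule LIMSEQ_Suc[OF lim_1_over_n])
    then show "(\<lambda>n. ennreal (1 / real (Suc n))) \<longlonglongrightarrow> 0" by simp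
    show "\<forall>\<^sub>F n in sequentially. (\<integral>\<^sup>+\<omega>. ennreal ((Y \<omega> - Yn n \<omega>)\<^sup>2) \<partial>M) \<le> ennreal (1 / real (Suc n))"
      by (intro always_eventually allI less_imp_le le)
  qed simp_all
  have sq: "sq_integrable M (Yn n)" for n using Yn gaussian_moments by blast
  note L = L2_limit[where fn = Yn, OF Y sq lim]
  have "(\<lambda>n. expectation (\<lambda>\<omega>. Yn n \<omega> * Yn n \<omega>)) \<longlonglongrightarrow> expectation (\<lambda>\<omega>. Y \<omega> * Y \<omega>)"
    by (rule L2_inner_limit[where fn = Yn and gn = Yn, OF Y sq lim Y sq lim])
  then have v: "vn \<longlonglongrightarrow> expectation (\<lambda>\<omega>. (Y \<omega>)\<^sup>2)"
    using gaussian_moments(2)[OF Yn] by (simp add: power2_eq_square)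
  have "char (distr M borel Y) u = complex_of_real (exp (-(expectation (\<lambda>\<omega>. (Y \<omega>)\<^sup>2) * u\<^sup>2) / 2))" for u
  proof -
    have b: "norm (char (distr M borel (Yn n)) u - char (distr M borel Y) u) \<le> \<bar>u\<bar> * sqrt (expectation (\<lambda>\<omega>. (Y \<omega> - Yn n \<omega>)\<^sup>2))" for n
    proof -
      have pt: "cmod (iexp x - iexp y) \<le> \<bar>x - y\<bar>" for x y :: real
      proof -
        have "iexp x - iexp y = iexp y * (iexp (x - y) - 1)"
          unfolding right_diff_distrib exp_add[symmetric] by (simp add: right_diff_distrib)
        then have "cmod (iexp x - iexp y) = cmod (iexp (x - y) - 1)" by (simp add: norm_mult)
        also have "\<dots> \<le> \<bar>x - y\<bar>" using iexp_approx1[of "x - y" 0] by simp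
        finally show ?thesis .
      qed
      have sd: "sq_integrable M (\<lambda>\<omega>. Y \<omega> - Yn n \<omega>)" by (rule sq_integrable_diff[OF L(1) sq])
      have "norm (char (distr M borel (Yn n)) u - char (distr M borel Y) u)
         = norm (CLINT \<omega>|M. iexp (u * Yn n \<omega>) - iexp (u * Y \<omega>))"
        by (simp add: char_distr_eq integrable_iexp)
      also have "\<dots> \<le> expectation (\<lambda>\<omega>. norm (iexp (u * Yn n \<omega>) - iexp (u * Y \<omega>)))"
        by (rule integral_norm_bound)
      also have "\<dots> \<le> expectation (\<lambda>\<omega>. \<bar>u\<bar> * \<bar>Y \<omega> - Yn n \<omega>\<bar>)"
      proof (rule integral_mono)
        have "sq_integrable M (\<lambda>_. 1)" by (simp add: sq_integrable_def)
        from sq_integrable_mult[OF sd this] have "integrable M (\<lambda>\<omega>. Y \<omega> - Yn n \<omega>)" by simp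
        then show "integrable M (\<lambda>\<omega>. \<bar>u\<bar> * \<bar>Y \<omega> - Yn n \<omega>\<bar>)" by simp
        show "integrable M (\<lambda>\<omega>. norm (iexp (u * Yn n \<omega>) - iexp (u * Y \<omega>)))"
          by (intro integrable_norm Bochner_Integration.integrable_diff) (auto intro!: integrable_iexp)
        show "norm (iexp (u * Yn n \<omega>) - iexp (u * Y \<omega>)) \<le> \<bar>u\<bar> * \<bar>Y \<omega> - Yn n \<omega>\<bar>" for \<omega>
        proof -
          have "\<bar>u * Yn n \<omega> - u * Y \<omega>\<bar> = \<bar>u\<bar> * \<bar>Y \<omega> - Yn n \<omega>\<bar>"
            by (metis abs_minus_commute abs_mult right_diff_distrib)
          with pt[of "u * Yn n \<omega>" "u * Y \<omega>"] show ?thesis by (simp only:)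
        qed
      qed
      also have "\<dots> \<le> \<bar>u\<bar> * sqrt (expectation (\<lambda>\<omega>. (Y \<omega> - Yn n \<omega>)\<^sup>2))"
        using abs_expectation_le_sqrt[OF sd] by (simp add: mult_left_mono)
      finally show ?thesis .
    qed
    have "(\<lambda>n. \<bar>u\<bar> * sqrt (expectation (\<lambda>\<omega>. (Y \<omega> - Yn n \<omega>)\<^sup>2))) \<longlonglongrightarrow> \<bar>u\<bar> * sqrt 0"
      by (intro tendsto_intros L(2))
    then have "(\<lambda>n. char (distr M borel (Yn n)) u - char (distr M borel Y) u) \<longlonglongrightarrow> 0"
      by (intro Lim_null_comparison[OF always_eventually[OF allI[OF b]]]) simp
    then have A: "(\<lambda>n. char (distr M borel (Yn n)) u) \<longlonglongrightarrow> char (distr M borel Y) u"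
      by (rule LIM_zero_cancel)
    have B: "(\<lambda>n. char (distr M borel (Yn n)) u) \<longlonglongrightarrow> complex_of_real (exp (-(expectation (\<lambda>\<omega>. (Y \<omega>)\<^sup>2) * u\<^sup>2) / 2))"
    proof -
      have "(\<lambda>n. complex_of_real (exp (-(vn n * u\<^sup>2) / 2))) \<longlonglongrightarrow> complex_of_real (exp (-(expectation (\<lambda>\<omega>. (Y \<omega>)\<^sup>2) * u\<^sup>2) / 2))"
        by (intro tendsto_intros v) simp
      moreover have "char (distr M borel (Yn n)) u = complex_of_real (exp (-(vn n * u\<^sup>2) / 2))" for n
        using Yn by (simp add: gaussian_def)
      ultimately show ?thesis by (simp only:)
    qed
    show ?thesis by (rule LIMSEQ_unique[OF A B])
  qed
  then show ?thesis using Y by (simp add: gaussian_def)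
qed

text \<open>Isserlis' formula, by polarization of the fourth moment.\<close>

lemma gaussian_sq_mult:
  assumes X: "gaussian X vx" and Y: "gaussian Y vy"
    and plus: "gaussian (\<lambda>\<omega>. X \<omega> + Y \<omega>) vp" and minus: "gaussian (\<lambda>\<omega>. X \<omega> - Y \<omega>) vm"
  shows "integrable M (\<lambda>\<omega>. (X \<omega>)\<^sup>2 * (Y \<omega>)\<^sup>2)"
    "expectation (\<lambda>\<omega>. (X \<omega>)\<^sup>2 * (Y \<omega>)\<^sup>2) = vx * vy + 2 * (expectation (\<lambda>\<omega>. X \<omega> * Y \<omega>))\<^sup>2"
proof -
  note mX = gaussian_moments[OF X] and mY = gaussian_moments[OF Y]
    and mp = gaussian_moments[OF plus] and mm = gaussian_moments[OF minus]
  let ?c = "expectation (\<lambda>\<omega>. X \<omega> * Y \<omega>)"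
  note XY = sq_integrable_mult[OF mX(1) mY(1)]
  have vp: "vp = vx + 2 * ?c + vy"
  proof -
    have "vp = expectation (\<lambda>\<omega>. (X \<omega>)\<^sup>2 + 2 * (X \<omega> * Y \<omega>) + (Y \<omega>)\<^sup>2)"
      unfolding mp(2)[symmetric] by (intro Bochner_Integration.integral_cong) (auto simp: power2_eq_square algebra_simps)
    then show ?thesis using XY sq_integrableD[OF mX(1)] sq_integrableD[OF mY(1)] mX(2) mY(2) by simp
  qed
  have vm: "vm = vx - 2 * ?c + vy"
  proof -
    have "vm = expectation (\<lambda>\<omega>. (X \<omega>)\<^sup>2 - 2 * (X \<omega> * Y \<omega>) + (Y \<omega>)\<^sup>2)"
      unfolding mm(2)[symmetric] by (intro Bochner_Integration.integral_cong) (auto simp: power2_eq_square algebra_simps)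
    then show ?thesis using XY sq_integrableD[OF mX(1)] sq_integrableD[OF mY(1)] mX(2) mY(2) by simp
  qed
  \<comment> \<open>Only fourth powers of X, Y, X + Y and X - Y occur here, so joint Gaussianity
    enters through these four variables.\<close>
  have pol: "(\<lambda>\<omega>. (X \<omega>)\<^sup>2 * (Y \<omega>)\<^sup>2) = (\<lambda>\<omega>. ((X \<omega> + Y \<omega>)^4 + (X \<omega> - Y \<omega>)^4 - 2 * X \<omega> ^ 4 - 2 * Y \<omega> ^ 4) / 12)"
  proof
    fix \<omega>
    have "12 * (x\<^sup>2 * y\<^sup>2) = (x + y)^4 + (x - y)^4 - 2 * x^4 - 2 * y^4" for x y :: real
      by algebra
    from this[of "X \<omega>" "Y \<omega>"] show "(X \<omega>)\<^sup>2 * (Y \<omega>)\<^sup>2 = ((X \<omega> + Y \<omega>)^4 + (X \<omega> - Y \<omega>)^4 - 2 * X \<omega> ^ 4 - 2 * Y \<omega> ^ 4) / 12"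
      by simp
  qed
  show "integrable M (\<lambda>\<omega>. (X \<omega>)\<^sup>2 * (Y \<omega>)\<^sup>2)"
    unfolding pol using mX mY mp mm by simp
  have "expectation (\<lambda>\<omega>. (X \<omega>)\<^sup>2 * (Y \<omega>)\<^sup>2) = (3 * vp\<^sup>2 + 3 * vm\<^sup>2 - 2 * (3 * vx\<^sup>2) - 2 * (3 * vy\<^sup>2)) / 12"
    unfolding pol using mX mY mp mm by simp
  also have "\<dots> = vx * vy + 2 * ?c\<^sup>2"
    unfolding vp vm by (simp add: power2_eq_square algebra_simps)
  finally show "expectation (\<lambda>\<omega>. (X \<omega>)\<^sup>2 * (Y \<omega>)\<^sup>2) = vx * vy + 2 * ?c\<^sup>2" .
qed

end

section \<open>Wiener integrals\<close>

text \<open>Passes from values to increments, the independent quantities of a Brownian motion: the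
  coefficient of an increment is the sum of all later coefficients.\<close>

lemma sum_by_parts_increments:
  fixes a u :: "nat \<Rightarrow> real"
  shows "(\<Sum>i\<le>n. a i * u i) = (\<Sum>i<n. (\<Sum>j\<in>{i<..n}. a j) * (u (Suc i) - u i)) + (\<Sum>j\<le>n. a j) * u 0"
proof (induction n)
  case (Suc n)
  have "(\<Sum>i<n. (\<Sum>j\<in>{i<..Suc n}. a j) * (u (Suc i) - u i))
     = (\<Sum>i<n. (\<Sum>j\<in>{i<..n}. a j) * (u (Suc i) - u i) + a (Suc n) * (u (Suc i) - u i))"
  proof (intro sum.cong refl)
    fix i assume "i \<in> {..<n}"
    then have "{i<..Suc n} = insert (Suc n) {i<..n}" by auto
    then show "(\<Sum>j\<in>{i<..Suc n}. a j) * (u (Suc i) - u i) = (\<Sum>j\<in>{i<..n}. a j) * (u (Suc i) - u i) + a (Suc n) * (u (Suc i) - u i)"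
      by (simp add: algebra_simps)
  qed
  also have "\<dots> = (\<Sum>i<n. (\<Sum>j\<in>{i<..n}. a j) * (u (Suc i) - u i)) + a (Suc n) * (u n - u 0)"
    by (simp add: sum.distrib sum_distrib_left[symmetric] sum_lessThan_telescope)
  finally have "(\<Sum>i<n. (\<Sum>j\<in>{i<..Suc n}. a j) * (u (Suc i) - u i))
     = (\<Sum>i<n. (\<Sum>j\<in>{i<..n}. a j) * (u (Suc i) - u i)) + a (Suc n) * (u n - u 0)" .
  moreover have "{n<..Suc n} = {Suc n}" by auto
  ultimately show ?case using Suc by (simp add: algebra_simps)
qed simp

lemma (in prob_space) gaussian_mean:
  assumes "gaussian Y v"
  shows "expectation Y = 0"
proof -
  have [measurable]: "Y \<in> borel_measurable M" using assms by measurable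
  have "expectation Y = (LINT x|distr M borel Y. x)" by (simp add: integral_distr)
  also have "\<dots> = (LINT x|std_normal_distribution. sqrt v * x)"
    unfolding gaussian_distr[OF assms] by (subst integral_distr) auto
  also have "\<dots> = 0" using integral_std_normal_distribution_moment_odd[of 1] by simp
  finally show ?thesis .
qed

section \<open>A single Brownian motion and the isometry of its Wiener integral\<close>

context prob_space
begin

lemma brownian_measurable: "brownian_motion M w \<Longrightarrow> 0 \<le> t \<Longrightarrow> w t \<in> borel_measurable M"
  by (simp add: brownian_motion_def)

lemma brownian_increment_gaussian:
  assumes "brownian_motion M w" "0 \<le> s" "s < t"
  shows "gaussian (\<lambda>\<omega>. w t \<omega> - w s \<omega>) (t - s)"
proof -
  have "distributed M lborel (\<lambda>\<omega>. w t \<omega> - w s \<omega>) (normal_density 0 (sqrt (t - s)))"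
    using assms by (simp add: brownian_motion_def)
  from gaussian_normal[OF this] assms show ?thesis by simp
qed

lemma brownian_gaussian:
  assumes w: "brownian_motion M w" and t: "0 \<le> t"
  shows "gaussian (w t) t"
proof -
  have w0: "AE \<omega> in M. w 0 \<omega> = 0" using w by (simp add: brownian_motion_def)
  show ?thesis
  proof (cases "t = 0")
    case True
    show ?thesis
      unfolding True by (rule gaussian_cong_AE[OF gaussian_zero brownian_measurable[OF w] w0]) simp
  next
    case False
    with t have g: "gaussian (\<lambda>\<omega>. w t \<omega> - w 0 \<omega>) (t - 0)"
      by (intro brownian_increment_gaussian[OF w]) auto
    have "AE \<omega> in M. w t \<omega> = w t \<omega> - w 0 \<omega>" using w0 by eventually_elim simp
    from gaussian_cong_AE[OF g brownian_measurable[OF w t] this] show ?thesis by simp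
  qed
qed

text \<open>Polarization of the increment variance t - s = E (w t - w s)^2.\<close>

lemma brownian_cov:
  assumes w: "brownian_motion M w" and st: "0 \<le> s" "0 \<le> t"
  shows "expectation (\<lambda>\<omega>. w s \<omega> * w t \<omega>) = min s t"
proof -
  have *: "expectation (\<lambda>\<omega>. w s \<omega> * w t \<omega>) = s" if st: "0 \<le> s" "s < t" for s t
  proof -
    note s = gaussian_moments[OF brownian_gaussian[OF w st(1)]]
    have "0 \<le> t" using st by simp
    note t = gaussian_moments[OF brownian_gaussian[OF w this]]
    note d = gaussian_moments[OF brownian_increment_gaussian[OF w st]]
    have "t - s = expectation (\<lambda>\<omega>. (w t \<omega>)\<^sup>2 - 2 * (w s \<omega> * w t \<omega>) + (w s \<omega>)\<^sup>2)"
      unfolding d(2)[symmetric] by (intro Bochner_Integration.integral_cong) (auto simp: power2_eq_square algebra_simps)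
    also have "\<dots> = t - 2 * expectation (\<lambda>\<omega>. w s \<omega> * w t \<omega>) + s"
      using sq_integrable_mult[OF s(1) t(1)] sq_integrableD[OF s(1)] sq_integrableD[OF t(1)] s(2) t(2) by simp
    finally show ?thesis by simp
  qed
  consider "s < t" | "s = t" | "t < s" by linarith
  then show ?thesis
  proof cases
    case 2
    then show ?thesis using gaussian_moments(2)[OF brownian_gaussian[OF w st(1)]] by (simp add: power2_eq_square)
  next
    case 3
    then show ?thesis using *[of t s] st by (simp add: mult.commute)
  qed (use *[of s t] st in simp)
qed

text \<open>Rewritten through increments, the combination is a sum of independent Gaussian variables
  plus a multiple of \<open>w 0\<close>, which vanishes almost surely.\<close>

lemma brownian_lincomb_gaussian:
  assumes w: "brownian_motion M w" and T: "finite T" "T \<subseteq> {0..}"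
  shows "\<exists>v. gaussian (\<lambda>\<omega>. \<Sum>t\<in>T. c t * w t \<omega>) v"
proof -
  \<comment> \<open>Time 0 is added as the left end of the partition, so that the boundary term of
    the summation by parts is a multiple of \<open>w 0\<close>. The coefficients \<open>c'\<close>
    below vanish at 0 unless 0 already belongs to T.\<close>
  define xs where "xs = sorted_list_of_set (insert 0 T)"
  define \<tau> where "\<tau> i = xs ! i" for i
  define n where "n = length xs - 1"
  have set: "set xs = insert 0 T" and dist: "distinct xs" and sorted: "sorted_wrt (<) xs"
  proof -
    have "finite (insert 0 T)" using T by simp
    then show "set xs = insert 0 T" "distinct xs" "sorted_wrt (<) xs"
      unfolding xs_def by (simp_all only: set_sorted_list_of_set distinct_sorted_list_of_set strict_sorted_list_of_set)
  qed
  have len: "length xs = Suc n" using set unfolding n_def by (cases xs) auto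
  have lessT: "\<tau> i < \<tau> j" if "i < j" "j \<le> n" for i j
    unfolding \<tau>_def using that len by (intro sorted_wrt_nth_less[OF sorted]) auto
  have bij: "bij_betw \<tau> {..n} (insert 0 T)"
    unfolding \<tau>_def[abs_def] using dist set len by (intro bij_betw_nth) auto
  have nonneg: "0 \<le> \<tau> i" if "i \<le> n" for i
  proof -
    have "\<tau> i \<in> insert 0 T" using bij_betwE[OF bij] that by blast
    then show ?thesis using T by auto
  qed
  have mono: "mono_on {..n} \<tau>"
  proof (rule mono_onI)
    fix r s assume "r \<in> {..n}" "s \<in> {..n}" "r \<le> s"
    then show "\<tau> r \<le> \<tau> s" using lessT[of r s] by (cases "r = s") auto
  qed
  have zero: "\<tau> 0 = 0"
  proof -
    obtain i where i: "i \<le> n" "\<tau> i = 0" using bij unfolding bij_betw_def by (metis atMost_iff image_iff insertI1)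
    show ?thesis
    proof (cases "i = 0")
      case False
      with lessT[of 0 i] i nonneg[of 0] show ?thesis by simp
    qed (use i in simp)
  qed
  define c' where "c' t = (if t \<in> T then c t else 0)" for t
  define A where "A i = (\<Sum>j\<in>{i<..n}. c' (\<tau> j))" for i
  define D where "D i \<omega> = A i * (w (\<tau> (Suc i)) \<omega> - w (\<tau> i) \<omega>)" for i \<omega>
  have eq: "(\<Sum>t\<in>T. c t * w t \<omega>) = (\<Sum>i<n. D i \<omega>) + (\<Sum>j\<le>n. c' (\<tau> j)) * w 0 \<omega>" for \<omega>
  proof -
    have "(\<Sum>t\<in>T. c t * w t \<omega>) = (\<Sum>t\<in>insert 0 T. c' t * w t \<omega>)"
      using T by (intro sum.mono_neutral_cong_left) (auto simp: c'_def)
    also have "\<dots> = (\<Sum>i\<le>n. c' (\<tau> i) * w (\<tau> i) \<omega>)"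
      by (rule sum.reindex_bij_betw[OF bij, symmetric])
    also have "\<dots> = (\<Sum>i<n. D i \<omega>) + (\<Sum>j\<le>n. c' (\<tau> j)) * w (\<tau> 0) \<omega>"
      unfolding D_def A_def by (rule sum_by_parts_increments)
    finally show ?thesis by (simp only: zero)
  qed
  have ind: "indep_vars (\<lambda>_. borel) (\<lambda>i \<omega>. w (\<tau> (Suc i)) \<omega> - w (\<tau> i) \<omega>) {..<n}"
    using w mono zero by (simp add: brownian_motion_def)
  have "indep_vars (\<lambda>_. borel) D {..<n}"
    unfolding D_def[abs_def] by (rule indep_vars_compose2[OF ind, where Y = "\<lambda>i x. A i * x"]) simp
  then have g: "gaussian (\<lambda>\<omega>. \<Sum>i<n. D i \<omega>) (\<Sum>i<n. (A i)\<^sup>2 * (\<tau> (Suc i) - \<tau> i))"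
    unfolding D_def[abs_def] using lessT nonneg
    by (intro gaussian_sum gaussian_cmult brownian_increment_gaussian[OF w]) auto
  have "AE \<omega> in M. w 0 \<omega> = 0" using w by (simp add: brownian_motion_def)
  then have "AE \<omega> in M. (\<Sum>t\<in>T. c t * w t \<omega>) = (\<Sum>i<n. D i \<omega>)"
    by eventually_elim (simp add: eq)
  moreover have "(\<lambda>\<omega>. \<Sum>t\<in>T. c t * w t \<omega>) \<in> borel_measurable M"
    using T brownian_measurable[OF w] by (intro borel_measurable_sum borel_measurable_times borel_measurable_const) auto
  ultimately show ?thesis using gaussian_cong_AE[OF g] by blast
qed

text \<open>Both sides are the length of the overlap of the two intervals; this is the isometry on
  indicators.\<close>

lemma brownian_increments_inner:
  assumes w: "brownian_motion M w" and p: "0 \<le> p" "p \<le> q" and p': "0 \<le> p'" "p' \<le> q'"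
  shows "expectation (\<lambda>\<omega>. (w q \<omega> - w p \<omega>) * (w q' \<omega> - w p' \<omega>))
    = (LINT x|lborel. indicator {p<..q} x * indicator {p'<..q'} x)"
proof -
  have sq: "sq_integrable M (w t)" if "0 \<le> t" for t
    using gaussian_moments(1)[OF brownian_gaussian[OF w that]] .
  have q: "0 \<le> q" "0 \<le> q'" using p p' by auto
  note int = sq_integrable_mult[OF sq sq]
  have "expectation (\<lambda>\<omega>. (w q \<omega> - w p \<omega>) * (w q' \<omega> - w p' \<omega>))
    = expectation (\<lambda>\<omega>. w q \<omega> * w q' \<omega> - w q \<omega> * w p' \<omega> - w p \<omega> * w q' \<omega> + w p \<omega> * w p' \<omega>)"
    by (intro Bochner_Integration.integral_cong) (auto simp: algebra_simps)
  also have "\<dots> = min q q' - min q p' - min p q' + min p p'"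
    using int p p' q by (simp add: brownian_cov[OF w])
  also have "\<dots> = (LINT x|lborel. indicator {p<..q} x * indicator {p'<..q'} x)"
  proof -
    have "(LINT x|lborel. indicator {p<..q} x * indicator {p'<..q'} x) = measure lborel {max p p'<..min q q'}"
      by (simp add: indicator_inter_arith[symmetric] Int_greaterThanAtMost)
    also have "\<dots> = (if max p p' \<le> min q q' then min q q' - max p p' else 0)"
      by auto
    also have "\<dots> = min q q' - min q p' - min p q' + min p p'"
      using p p' by (simp add: min_def max_def)
    finally show ?thesis by simp
  qed
  finally show ?thesis .
qed

lemma step_integral_sq_integrable:
  assumes w: "brownian_motion M w" and \<tau>: "0 \<le> \<tau> 0" "mono_on {..n} \<tau>"
  shows "sq_integrable M (step_integral w n \<tau> a)"
proof -
  have nn: "0 \<le> \<tau> i" if "i \<le> n" for i using \<tau> mono_onD[OF \<tau>(2), of 0 i] that by simp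
  show ?thesis unfolding step_integral_def[abs_def]
    using nn gaussian_moments(1)[OF brownian_gaussian[OF w]]
    by (intro sq_integrable_sum sq_integrable_cmult sq_integrable_diff) auto
qed

lemma step_fun_sq_integrable: "sq_integrable lborel (step_fun n \<tau> a)"
proof -
  have "sq_integrable lborel (indicator {s<..t} :: real \<Rightarrow> real)" for s t :: real
    unfolding sq_integrable_def
    by (cases "s \<le> t") (simp_all add: power2_eq_square integrable_indicator_iff flip: indicator_inter_arith)
  then show ?thesis unfolding step_fun_def[abs_def] by (intro sq_integrable_sum sq_integrable_cmult)
qed

text \<open>Bilinear extension of the indicator case. Each pair of intervals is treated by its
  overlap, so the two partitions can stay different.\<close>

lemma step_integral_inner:
  assumes w: "brownian_motion M w" and \<tau>: "0 \<le> \<tau> 0" "mono_on {..n} \<tau>" and \<tau>': "0 \<le> \<tau>' 0" "mono_on {..n'} \<tau>'"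
  shows "expectation (\<lambda>\<omega>. step_integral w n \<tau> a \<omega> * step_integral w n' \<tau>' a' \<omega>)
    = (LINT x|lborel. step_fun n \<tau> a x * step_fun n' \<tau>' a' x)"
proof -
  have nn: "0 \<le> \<tau> i" if "i \<le> n" for i using \<tau> mono_onD[OF \<tau>(2), of 0 i] that by simp
  have nn': "0 \<le> \<tau>' i" if "i \<le> n'" for i using \<tau>' mono_onD[OF \<tau>'(2), of 0 i] that by simp
  have sq: "sq_integrable M (\<lambda>\<omega>. w t \<omega> - w s \<omega>)" if "0 \<le> s" "0 \<le> t" for s t
    using that gaussian_moments(1)[OF brownian_gaussian[OF w]] by (intro sq_integrable_diff)
  have sqi: "sq_integrable lborel (indicator {s<..t} :: real \<Rightarrow> real)" for s t :: real
    unfolding sq_integrable_def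
    by (cases "s \<le> t") (simp_all add: power2_eq_square integrable_indicator_iff flip: indicator_inter_arith)
  let ?I = "\<lambda>i j. expectation (\<lambda>\<omega>. (w (\<tau> (Suc i)) \<omega> - w (\<tau> i) \<omega>) * (w (\<tau>' (Suc j)) \<omega> - w (\<tau>' j) \<omega>))"
  let ?J = "\<lambda>i j. LINT x|lborel. indicator {\<tau> i<..\<tau> (Suc i)} x * indicator {\<tau>' j<..\<tau>' (Suc j)} x"
  have "?I i j = ?J i j" if "i < n" "j < n'" for i j
    using that nn nn' mono_onD[OF \<tau>(2), of i "Suc i"] mono_onD[OF \<tau>'(2), of j "Suc j"]
    by (intro brownian_increments_inner[OF w]) auto
  moreover have "expectation (\<lambda>\<omega>. step_integral w n \<tau> a \<omega> * step_integral w n' \<tau>' a' \<omega>) = (\<Sum>i<n. \<Sum>j<n'. a i * a' j * ?I i j)"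
    unfolding step_integral_def by (intro integral_mult_sums sq) (use nn nn' in auto)
  moreover have "(LINT x|lborel. step_fun n \<tau> a x * step_fun n' \<tau>' a' x) = (\<Sum>i<n. \<Sum>j<n'. a i * a' j * ?J i j)"
    unfolding step_fun_def by (intro integral_mult_sums sqi)
  ultimately show ?thesis by simp
qed

text \<open>Integrals up to different times have to be compared, so the integrand is cut off outside
  [0, t] and regarded as a function on the line. The partitions lie in [0, t]; hence the step
  functions vanish outside and the approximation error is unchanged.\<close>

lemma wiener_integral_approx:
  assumes J: "has_wiener_integral M w f t J" and f [measurable]: "f \<in> borel_measurable borel"
  obtains n \<tau> a where "\<And>j::nat. 0 \<le> \<tau> j 0" "\<And>j. mono_on {..n j} (\<tau> j)"
    "(\<lambda>j. \<integral>\<^sup>+x. ennreal ((f x * indicator {0..t} x - step_fun (n j) (\<tau> j) (a j) x)\<^sup>2) \<partial>lborel) \<longlonglongrightarrow> 0"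
    "(\<lambda>j. \<integral>\<^sup>+\<omega>. ennreal ((J \<omega> - step_integral w (n j) (\<tau> j) (a j) \<omega>)\<^sup>2) \<partial>M) \<longlonglongrightarrow> 0"
proof -
  obtain n \<tau> a where *: "\<forall>j::nat. 0 \<le> \<tau> j 0 \<and> mono_on {..n j} (\<tau> j) \<and> \<tau> j (n j) \<le> t"
    and lim: "(\<lambda>j. \<integral>\<^sup>+s\<in>{0..t}. ennreal ((f s - step_fun (n j) (\<tau> j) (a j) s)\<^sup>2) \<partial>lborel) \<longlonglongrightarrow> 0"
      "(\<lambda>j. \<integral>\<^sup>+\<omega>. ennreal ((J \<omega> - step_integral w (n j) (\<tau> j) (a j) \<omega>)\<^sup>2) \<partial>M) \<longlonglongrightarrow> 0"
    using J unfolding has_wiener_integral_def by blast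
  have "(f x * indicator {0..t} x - step_fun (n j) (\<tau> j) (a j) x)\<^sup>2 = (f x - step_fun (n j) (\<tau> j) (a j) x)\<^sup>2 * indicator {0..t} x" for j x
  proof (cases "x \<in> {0..t}")
    case False
    have "step_fun (n j) (\<tau> j) (a j) x = 0"
      unfolding step_fun_def
    proof (intro sum.neutral ballI)
      fix i assume i: "i \<in> {..<n j}"
      have "0 \<le> \<tau> j i" "\<tau> j (Suc i) \<le> t"
        using i *[rule_format, of j] mono_onD[of "{..n j}" "\<tau> j" 0 i] mono_onD[of "{..n j}" "\<tau> j" "Suc i" "n j"] by auto
      with False show "a j i * indicator {\<tau> j i<..\<tau> j (Suc i)} x = 0" by (auto simp: indicator_def)
    qed
    with False show ?thesis by simp
  qed simp
  then have "(\<lambda>j. \<integral>\<^sup>+x. ennreal ((f x * indicator {0..t} x - step_fun (n j) (\<tau> j) (a j) x)\<^sup>2) \<partial>lborel) \<longlonglongrightarrow> 0"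
    using lim(1) by (simp add: ennreal_mult'' ennreal_indicator)
  with * lim(2) show ?thesis using that by blast
qed

text \<open>Both sides are limits of one sequence, by continuity of the inner product over the
  probability space and over the line.\<close>

lemma wiener_isometry:
  assumes w: "brownian_motion M w"
    and J: "has_wiener_integral M w f s J" and J': "has_wiener_integral M w g t J'"
    and [measurable]: "f \<in> borel_measurable borel" "g \<in> borel_measurable borel"
  shows "expectation (\<lambda>\<omega>. J \<omega> * J' \<omega>)
    = (LINT x|lborel. (f x * indicator {0..s} x) * (g x * indicator {0..t} x))"
proof -
  obtain n \<tau> a where a: "\<And>j::nat. 0 \<le> \<tau> j 0" "\<And>j. mono_on {..n j} (\<tau> j)"
    "(\<lambda>j. \<integral>\<^sup>+x. ennreal ((f x * indicator {0..s} x - step_fun (n j) (\<tau> j) (a j) x)\<^sup>2) \<partial>lborel) \<longlonglongrightarrow> 0"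
    "(\<lambda>j. \<integral>\<^sup>+\<omega>. ennreal ((J \<omega> - step_integral w (n j) (\<tau> j) (a j) \<omega>)\<^sup>2) \<partial>M) \<longlonglongrightarrow> 0"
    by (rule wiener_integral_approx[OF J assms(4)], rule that)
  obtain n' \<tau>' a' where a': "\<And>j::nat. 0 \<le> \<tau>' j 0" "\<And>j. mono_on {..n' j} (\<tau>' j)"
    "(\<lambda>j. \<integral>\<^sup>+x. ennreal ((g x * indicator {0..t} x - step_fun (n' j) (\<tau>' j) (a' j) x)\<^sup>2) \<partial>lborel) \<longlonglongrightarrow> 0"
    "(\<lambda>j. \<integral>\<^sup>+\<omega>. ennreal ((J' \<omega> - step_integral w (n' j) (\<tau>' j) (a' j) \<omega>)\<^sup>2) \<partial>M) \<longlonglongrightarrow> 0"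
    by (rule wiener_integral_approx[OF J' assms(5)], rule that)
  have JM: "J \<in> borel_measurable M" "J' \<in> borel_measurable M"
    using J J' by (auto simp: has_wiener_integral_def)
  have L: "(\<lambda>j. expectation (\<lambda>\<omega>. step_integral w (n j) (\<tau> j) (a j) \<omega> * step_integral w (n' j) (\<tau>' j) (a' j) \<omega>))
     \<longlonglongrightarrow> expectation (\<lambda>\<omega>. J \<omega> * J' \<omega>)"
    by (rule L2_inner_limit[where fn = "\<lambda>j. step_integral w (n j) (\<tau> j) (a j)" and gn = "\<lambda>j. step_integral w (n' j) (\<tau>' j) (a' j)",
          OF JM(1) step_integral_sq_integrable[OF w a(1,2)] a(4) JM(2) step_integral_sq_integrable[OF w a'(1,2)] a'(4)])
  have R: "(\<lambda>j. LINT x|lborel. step_fun (n j) (\<tau> j) (a j) x * step_fun (n' j) (\<tau>' j) (a' j) x)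
     \<longlonglongrightarrow> (LINT x|lborel. (f x * indicator {0..s} x) * (g x * indicator {0..t} x))"
    by (rule L2_inner_limit[where fn = "\<lambda>j. step_fun (n j) (\<tau> j) (a j)" and gn = "\<lambda>j. step_fun (n' j) (\<tau>' j) (a' j)",
          OF _ step_fun_sq_integrable a(3) _ step_fun_sq_integrable a'(3)]) measurable
  show ?thesis
    using L R unfolding step_integral_inner[OF w a(1,2) a'(1,2)] by (rule LIMSEQ_unique)
qed

end

section \<open>The Gaussian space of a family of independent Brownian motions\<close>

locale brownian_family = prob_space M for M :: "'w measure" +
  fixes W :: "'i \<Rightarrow> real \<Rightarrow> 'w \<Rightarrow> real" and I :: "'i set"
  assumes brownian: "\<And>i. i \<in> I \<Longrightarrow> brownian_motion M (W i)"
    and indep: "indep_vars (\<lambda>_. PiM {0..} (\<lambda>_. borel)) (\<lambda>i \<omega>. \<lambda>t\<in>{0..}. W i t \<omega>) I"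
begin

text \<open>The linear span of the Brownian values. Indices and times may repeat, which makes
  closure under sums immediate; \<open>elementary_normal_form\<close> collects the
  repetitions.\<close>

inductive elementary :: "('w \<Rightarrow> real) \<Rightarrow> bool" where
  zero: "elementary (\<lambda>_. 0)"
| plus: "i \<in> I \<Longrightarrow> 0 \<le> t \<Longrightarrow> elementary Y \<Longrightarrow> elementary (\<lambda>\<omega>. c * W i t \<omega> + Y \<omega>)"

lemma elementary_add: "elementary X \<Longrightarrow> elementary Y \<Longrightarrow> elementary (\<lambda>\<omega>. X \<omega> + Y \<omega>)"
  by (induction rule: elementary.induct) (auto simp: add.assoc intro: elementary.intros)

lemma elementary_cmult: "elementary X \<Longrightarrow> elementary (\<lambda>\<omega>. a * X \<omega>)"
  by (induction rule: elementary.induct) (auto simp: distrib_left mult.assoc[symmetric] intro: elementary.intros)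

lemma elementary_sum: "(\<And>j. j \<in> J \<Longrightarrow> elementary (X j)) \<Longrightarrow> elementary (\<lambda>\<omega>. \<Sum>j\<in>J. X j \<omega>)"
  by (induction J rule: infinite_finite_induct) (auto intro: elementary_add elementary.zero)

lemma elementary_W: "i \<in> I \<Longrightarrow> 0 \<le> t \<Longrightarrow> elementary (W i t)"
  using elementary.plus[OF _ _ elementary.zero, of i t 1] by simp

text \<open>With the terms grouped by index over one common finite set of times, the independence
  across indices and the dependence in time can be handled separately.\<close>

lemma elementary_normal_form:
  "elementary Y \<Longrightarrow> \<exists>K T c. finite K \<and> K \<subseteq> I \<and> finite T \<and> T \<subseteq> {0..} \<and> Y = (\<lambda>\<omega>. \<Sum>i\<in>K. \<Sum>t\<in>T. c i t * W i t \<omega>)"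
proof (induction rule: elementary.induct)
  case zero
  show ?case by (intro exI[of _ "{}"] exI[of _ "\<lambda>_ _. 0"]) auto
next
  case (plus i t Y a)
  then obtain K T c where K: "finite K" "K \<subseteq> I" and T: "finite T" "T \<subseteq> {0..}"
    and Y: "Y = (\<lambda>\<omega>. \<Sum>i\<in>K. \<Sum>t\<in>T. c i t * W i t \<omega>)" by blast
  define K' where "K' = insert i K"
  define T' where "T' = insert t T"
  define c1 where "c1 j s = (if j \<in> K \<and> s \<in> T then c j s else 0)" for j s
  define c2 where "c2 j s = (if j = i then if s = t then a else 0 else 0)" for j s
  have fin: "finite K'" "finite T'" using K T by (auto simp: K'_def T'_def)
  have "(\<Sum>j\<in>K'. \<Sum>s\<in>T'. (c1 j s + c2 j s) * W j s \<omega>) = a * W i t \<omega> + Y \<omega>" for \<omega>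
  proof -
    have "(\<Sum>j\<in>K'. \<Sum>s\<in>T'. c1 j s * W j s \<omega>) = (\<Sum>j\<in>K. \<Sum>s\<in>T'. c1 j s * W j s \<omega>)"
      using K by (intro sum.mono_neutral_right) (auto simp: K'_def c1_def)
    also have "\<dots> = (\<Sum>j\<in>K. \<Sum>s\<in>T. c1 j s * W j s \<omega>)"
      using T by (intro sum.cong refl sum.mono_neutral_right) (auto simp: T'_def c1_def)
    also have "\<dots> = Y \<omega>" unfolding Y by (intro sum.cong refl) (auto simp: c1_def)
    finally have 1: "(\<Sum>j\<in>K'. \<Sum>s\<in>T'. c1 j s * W j s \<omega>) = Y \<omega>" .
    have "(\<Sum>j\<in>K'. \<Sum>s\<in>T'. c2 j s * W j s \<omega>) = (\<Sum>j\<in>K'. if j = i then \<Sum>s\<in>T'. if s = t then a * W i t \<omega> else 0 else 0)"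
      by (intro sum.cong refl) (auto simp: c2_def intro!: sum.cong sum.neutral)
    also have "\<dots> = a * W i t \<omega>" using fin by (simp add: sum.delta) (auto simp: K'_def T'_def)
    finally have 2: "(\<Sum>j\<in>K'. \<Sum>s\<in>T'. c2 j s * W j s \<omega>) = a * W i t \<omega>" .
    show ?thesis using 1 2 by (simp add: distrib_right sum.distrib)
  qed
  then show ?case using fin K T plus.hyps
    by (intro exI[of _ K'] exI[of _ T'] exI[of _ "\<lambda>j s. c1 j s + c2 j s"]) (auto simp: K'_def T'_def)
qed

text \<open>Each index contributes a Gaussian variable by \<open>brownian_lincomb_gaussian\<close>,
  and these contributions are measurable functions of independent paths.\<close>

lemma elementary_gaussian:
  assumes "elementary Y"
  shows "\<exists>v. gaussian Y v"
proof -
  obtain K T c where K: "finite K" "K \<subseteq> I" and T: "finite T" "T \<subseteq> {0..}"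
    and Y: "Y = (\<lambda>\<omega>. \<Sum>i\<in>K. \<Sum>t\<in>T. c i t * W i t \<omega>)"
    using elementary_normal_form[OF assms] by blast
  have "\<forall>i\<in>K. \<exists>v. gaussian (\<lambda>\<omega>. \<Sum>t\<in>T. c i t * W i t \<omega>) v"
    using K T brownian by (intro ballI brownian_lincomb_gaussian) auto
  then obtain v where v: "\<And>i. i \<in> K \<Longrightarrow> gaussian (\<lambda>\<omega>. \<Sum>t\<in>T. c i t * W i t \<omega>) (v i)"
    by metis
  have "indep_vars (\<lambda>_. borel) (\<lambda>i \<omega>. \<Sum>t\<in>T. c i t * (\<lambda>t\<in>{0..}. W i t \<omega>) t) K"
  proof (rule indep_vars_compose2[OF indep_vars_subset[OF indep K(2)], where Y = "\<lambda>i f. \<Sum>t\<in>T. c i t * f t"])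
    fix i
    show "(\<lambda>f. \<Sum>t\<in>T. c i t * f t) \<in> borel_measurable (PiM {0..} (\<lambda>_. borel))"
      using T by (intro borel_measurable_sum borel_measurable_times borel_measurable_const measurable_component_singleton) auto
  qed
  also have "(\<lambda>i \<omega>. \<Sum>t\<in>T. c i t * (\<lambda>t\<in>{0..}. W i t \<omega>) t) = (\<lambda>i \<omega>. \<Sum>t\<in>T. c i t * W i t \<omega>)"
    using T by (intro ext sum.cong refl) auto
  finally have "gaussian Y (\<Sum>i\<in>K. v i)"
    unfolding Y using K v by (intro gaussian_sum) auto
  then show ?thesis ..
qed

text \<open>The mean-square closure of the span, that is, the Gaussian Hilbert space of the family.
  All its elements are Gaussian, and closure under sums and differences supplies the joint
  Gaussianity for Isserlis' formula.\<close>

definition wiener_space :: "('w \<Rightarrow> real) \<Rightarrow> bool" where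
  "wiener_space Y \<longleftrightarrow> Y \<in> borel_measurable M \<and>
     (\<forall>\<epsilon>>0. \<exists>E. elementary E \<and> (\<integral>\<^sup>+\<omega>. ennreal ((Y \<omega> - E \<omega>)\<^sup>2) \<partial>M) < ennreal \<epsilon>)"

lemma wiener_space_gaussian:
  assumes "wiener_space Y"
  shows "gaussian Y (expectation (\<lambda>\<omega>. (Y \<omega>)\<^sup>2))"
proof (rule gaussian_limit)
  show "Y \<in> borel_measurable M" using assms by (simp add: wiener_space_def)
  fix \<epsilon> :: real assume "0 < \<epsilon>"
  then show "\<exists>Y' v'. gaussian Y' v' \<and> (\<integral>\<^sup>+\<omega>. ennreal ((Y \<omega> - Y' \<omega>)\<^sup>2) \<partial>M) < ennreal \<epsilon>"
    using assms elementary_gaussian unfolding wiener_space_def by metis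
qed

lemma elementary_measurable: "elementary E \<Longrightarrow> E \<in> borel_measurable M"
  using elementary_gaussian[of E] by (auto simp: gaussian_def)

lemma wiener_space_add:
  assumes X: "wiener_space X" and Y: "wiener_space Y"
  shows "wiener_space (\<lambda>\<omega>. X \<omega> + Y \<omega>)"
  unfolding wiener_space_def
proof (intro conjI allI impI)
  have [measurable]: "X \<in> borel_measurable M" "Y \<in> borel_measurable M" using X Y by (auto simp: wiener_space_def)
  show "(\<lambda>\<omega>. X \<omega> + Y \<omega>) \<in> borel_measurable M" by measurable
  fix \<epsilon> :: real assume e: "0 < \<epsilon>"
  \<comment> \<open>The bound (a + b)^2 <= 2 a^2 + 2 b^2 doubles each of the two errors, hence
    \<epsilon>/4.\<close>
  then have e4: "0 < \<epsilon>/4" by simp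
  obtain E where E: "elementary E" "(\<integral>\<^sup>+\<omega>. ennreal ((X \<omega> - E \<omega>)\<^sup>2) \<partial>M) < ennreal (\<epsilon>/4)"
    using X e4 unfolding wiener_space_def by blast
  obtain F where F: "elementary F" "(\<integral>\<^sup>+\<omega>. ennreal ((Y \<omega> - F \<omega>)\<^sup>2) \<partial>M) < ennreal (\<epsilon>/4)"
    using Y e4 unfolding wiener_space_def by blast
  have [measurable]: "E \<in> borel_measurable M" "F \<in> borel_measurable M" using E F elementary_measurable by auto
  have "(\<integral>\<^sup>+\<omega>. ennreal (((X \<omega> + Y \<omega>) - (E \<omega> + F \<omega>))\<^sup>2) \<partial>M)
     \<le> (\<integral>\<^sup>+\<omega>. ennreal 2 * ennreal ((X \<omega> - E \<omega>)\<^sup>2) + ennreal 2 * ennreal ((Y \<omega> - F \<omega>)\<^sup>2) \<partial>M)"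
  proof (rule nn_integral_mono)
    fix \<omega>
    have "((X \<omega> + Y \<omega>) - (E \<omega> + F \<omega>))\<^sup>2 \<le> 2 * (X \<omega> - E \<omega>)\<^sup>2 + 2 * (Y \<omega> - F \<omega>)\<^sup>2"
      using zero_le_power2[of "(X \<omega> - E \<omega>) - (Y \<omega> - F \<omega>)"] by (simp add: power2_eq_square algebra_simps)
    then have "ennreal (((X \<omega> + Y \<omega>) - (E \<omega> + F \<omega>))\<^sup>2) \<le> ennreal (2 * (X \<omega> - E \<omega>)\<^sup>2 + 2 * (Y \<omega> - F \<omega>)\<^sup>2)"
      by (rule ennreal_leI)
    then show "ennreal (((X \<omega> + Y \<omega>) - (E \<omega> + F \<omega>))\<^sup>2) \<le> ennreal 2 * ennreal ((X \<omega> - E \<omega>)\<^sup>2) + ennreal 2 * ennreal ((Y \<omega> - F \<omega>)\<^sup>2)"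
      by (simp add: ennreal_plus ennreal_mult)
  qed
  also have "\<dots> = ennreal 2 * (\<integral>\<^sup>+\<omega>. ennreal ((X \<omega> - E \<omega>)\<^sup>2) \<partial>M) + ennreal 2 * (\<integral>\<^sup>+\<omega>. ennreal ((Y \<omega> - F \<omega>)\<^sup>2) \<partial>M)"
    by (simp add: nn_integral_add nn_integral_cmult)
  also have "\<dots> < ennreal 2 * ennreal (\<epsilon>/4) + ennreal 2 * ennreal (\<epsilon>/4)"
    using E F by (intro add_strict_mono ennreal_mult_strict_left_mono) auto
  also have "\<dots> = ennreal \<epsilon>"
  proof -
    have "ennreal 2 * ennreal (\<epsilon>/4) = ennreal (\<epsilon>/2)" using e by (subst ennreal_mult[symmetric]) auto
    moreover have "ennreal (\<epsilon>/2) + ennreal (\<epsilon>/2) = ennreal \<epsilon>" using e by (subst ennreal_plus[symmetric]) auto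
    ultimately show ?thesis by simp
  qed
  finally show "\<exists>G. elementary G \<and> (\<integral>\<^sup>+\<omega>. ennreal (((X \<omega> + Y \<omega>) - G \<omega>)\<^sup>2) \<partial>M) < ennreal \<epsilon>"
    using elementary_add[OF E(1) F(1)] by (intro exI[of _ "\<lambda>\<omega>. E \<omega> + F \<omega>"]) simp
qed

lemma wiener_space_cmult:
  assumes X: "wiener_space X"
  shows "wiener_space (\<lambda>\<omega>. c * X \<omega>)"
  unfolding wiener_space_def
proof (intro conjI allI impI)
  have [measurable]: "X \<in> borel_measurable M" using X by (auto simp: wiener_space_def)
  show "(\<lambda>\<omega>. c * X \<omega>) \<in> borel_measurable M" by measurable
  fix \<epsilon> :: real assume e: "0 < \<epsilon>"
  \<comment> \<open>The 1 added to c^2 covers c = 0 and makes the final inequality strict.\<close>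
  have c: "0 < c\<^sup>2 + 1" by (intro add_nonneg_pos) auto
  then have e': "0 < \<epsilon> / (c\<^sup>2 + 1)" using e by simp
  obtain E where E: "elementary E" "(\<integral>\<^sup>+\<omega>. ennreal ((X \<omega> - E \<omega>)\<^sup>2) \<partial>M) < ennreal (\<epsilon> / (c\<^sup>2 + 1))"
    using X e' unfolding wiener_space_def by blast
  have [measurable]: "E \<in> borel_measurable M" using E elementary_measurable by auto
  have "(\<integral>\<^sup>+\<omega>. ennreal ((c * X \<omega> - c * E \<omega>)\<^sup>2) \<partial>M) = (\<integral>\<^sup>+\<omega>. ennreal (c\<^sup>2) * ennreal ((X \<omega> - E \<omega>)\<^sup>2) \<partial>M)"
    by (intro nn_integral_cong) (simp add: ennreal_mult[symmetric] power_mult_distrib flip: right_diff_distrib)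
  also have "\<dots> = ennreal (c\<^sup>2) * (\<integral>\<^sup>+\<omega>. ennreal ((X \<omega> - E \<omega>)\<^sup>2) \<partial>M)"
    by (rule nn_integral_cmult) measurable
  also have "\<dots> \<le> ennreal (c\<^sup>2) * ennreal (\<epsilon> / (c\<^sup>2 + 1))"
    using E by (intro mult_left_mono) auto
  also have "\<dots> = ennreal (c\<^sup>2 * (\<epsilon> / (c\<^sup>2 + 1)))" using e' by (intro ennreal_mult[symmetric]) auto
  also have "\<dots> < ennreal \<epsilon>"
    using e c by (intro ennreal_lessI) (auto simp: field_simps)
  finally show "\<exists>G. elementary G \<and> (\<integral>\<^sup>+\<omega>. ennreal ((c * X \<omega> - G \<omega>)\<^sup>2) \<partial>M) < ennreal \<epsilon>"
    using elementary_cmult[OF E(1)] by (intro exI[of _ "\<lambda>\<omega>. c * E \<omega>"]) simp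
qed

lemma wiener_space_diff:
  "wiener_space X \<Longrightarrow> wiener_space Y \<Longrightarrow> wiener_space (\<lambda>\<omega>. X \<omega> - Y \<omega>)"
  using wiener_space_add[OF _ wiener_space_cmult[of Y "-1"], of X] by simp

lemma elementary_wiener_space: "elementary E \<Longrightarrow> wiener_space E"
  unfolding wiener_space_def using elementary_measurable by (auto intro!: exI[of _ E])

lemma wiener_space_sum:
  "(\<And>j. j \<in> J \<Longrightarrow> wiener_space (X j)) \<Longrightarrow> wiener_space (\<lambda>\<omega>. \<Sum>j\<in>J. X j \<omega>)"
  by (induction J rule: infinite_finite_induct)
     (auto intro: wiener_space_add elementary_wiener_space elementary.zero)

lemma wiener_space_sq_integrable: "wiener_space X \<Longrightarrow> sq_integrable M X"
  using gaussian_moments(1)[OF wiener_space_gaussian] .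

lemma elementary_step_integral:
  assumes "i \<in> I" "0 \<le> \<tau> 0" "mono_on {..n} \<tau>"
  shows "elementary (step_integral (W i) n \<tau> a)"
proof -
  have nn: "0 \<le> \<tau> j" if "j \<le> n" for j using assms(2) mono_onD[OF assms(3), of 0 j] that by simp
  have "elementary (\<lambda>\<omega>. W i (\<tau> (Suc j)) \<omega> + (-1) * W i (\<tau> j) \<omega>)" if "j < n" for j
    using nn that assms(1) by (intro elementary_add elementary_cmult elementary_W) auto
  then show ?thesis
    unfolding step_integral_def[abs_def] by (intro elementary_sum elementary_cmult) auto
qed

lemma wiener_integral_wiener_space:
  assumes "i \<in> I" and J: "has_wiener_integral M (W i) f t J"
  shows "wiener_space J"
proof -
  obtain n \<tau> a where a: "\<And>j::nat. 0 \<le> \<tau> j 0 \<and> mono_on {..n j} (\<tau> j)"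
    and lim: "(\<lambda>j. \<integral>\<^sup>+\<omega>. ennreal ((J \<omega> - step_integral (W i) (n j) (\<tau> j) (a j) \<omega>)\<^sup>2) \<partial>M) \<longlonglongrightarrow> 0"
    using J unfolding has_wiener_integral_def by blast
  show ?thesis unfolding wiener_space_def
  proof (intro conjI allI impI)
    show "J \<in> borel_measurable M" using J by (simp add: has_wiener_integral_def)
    fix \<epsilon> :: real assume "0 < \<epsilon>"
    then have "\<forall>\<^sub>F j in sequentially. (\<integral>\<^sup>+\<omega>. ennreal ((J \<omega> - step_integral (W i) (n j) (\<tau> j) (a j) \<omega>)\<^sup>2) \<partial>M) < ennreal \<epsilon>"
      by (intro order_tendstoD(2)[OF lim]) simp
    then obtain j where "(\<integral>\<^sup>+\<omega>. ennreal ((J \<omega> - step_integral (W i) (n j) (\<tau> j) (a j) \<omega>)\<^sup>2) \<partial>M) < ennreal \<epsilon>"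
      by (auto simp: eventually_sequentially)
    then show "\<exists>E. elementary E \<and> (\<integral>\<^sup>+\<omega>. ennreal ((J \<omega> - E \<omega>)\<^sup>2) \<partial>M) < ennreal \<epsilon>"
      using elementary_step_integral[OF assms(1), of "\<tau> j" "n j" "a j"] a by blast
  qed
qed

lemma expectation_W_mult:
  assumes "i \<in> I" "j \<in> I" "i \<noteq> j" "0 \<le> s" "0 \<le> t"
  shows "expectation (\<lambda>\<omega>. W i s \<omega> * W j t \<omega>) = 0"
proof -
  \<comment> \<open>One time per index turns the two variables into coordinates of a single family,
    to which the independence of the paths applies.\<close>
  define u where "u m = (if m = i then s else t)" for m
  have u: "0 \<le> u m" for m using assms by (simp add: u_def)
  have "indep_vars (\<lambda>_. borel) (\<lambda>m \<omega>. (\<lambda>t\<in>{0..}. W m t \<omega>) (u m)) {i, j}"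
    by (rule indep_vars_compose2[OF indep_vars_subset[OF indep], where Y = "\<lambda>m f. f (u m)"])
       (use assms u in \<open>auto intro!: measurable_component_singleton\<close>)
  then have ind: "indep_vars (\<lambda>_. borel) (\<lambda>m. W m (u m)) {i, j}" using u by simp
  have g: "gaussian (W m (u m)) (u m)" if "m \<in> {i, j}" for m
    using that assms u by (intro brownian_gaussian brownian) auto
  have int: "integrable M (W m (u m))" if "m \<in> {i, j}" for m
  proof -
    have "sq_integrable M (\<lambda>_. 1)" by (simp add: sq_integrable_def)
    from sq_integrable_mult[OF gaussian_moments(1)[OF g[OF that]] this] show ?thesis by simp
  qed
  have "expectation (\<lambda>\<omega>. \<Prod>m\<in>{i, j}. W m (u m) \<omega>) = (\<Prod>m\<in>{i, j}. expectation (W m (u m)))"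
    by (rule indep_vars_lebesgue_integral) (use ind int in auto)
  also have "\<dots> = 0" using gaussian_mean[OF g] assms(3) by simp
  finally show ?thesis using assms(3) by (simp add: u_def)
qed

lemma step_integrals_uncorrelated:
  assumes i: "i \<in> I" "j \<in> I" "i \<noteq> j" and \<tau>: "0 \<le> \<tau> 0" "mono_on {..n} \<tau>" and \<tau>': "0 \<le> \<tau>' 0" "mono_on {..n'} \<tau>'"
  shows "expectation (\<lambda>\<omega>. step_integral (W i) n \<tau> a \<omega> * step_integral (W j) n' \<tau>' a' \<omega>) = 0"
proof -
  have nn: "0 \<le> \<tau> i" if "i \<le> n" for i using \<tau> mono_onD[OF \<tau>(2), of 0 i] that by simp
  have nn': "0 \<le> \<tau>' i" if "i \<le> n'" for i using \<tau>' mono_onD[OF \<tau>'(2), of 0 i] that by simp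
  have sqW: "sq_integrable M (W m t)" if "m \<in> {i, j}" "0 \<le> t" for m t
    using that i brownian gaussian_moments(1)[OF brownian_gaussian] by blast
  have sq: "sq_integrable M (\<lambda>\<omega>. W m t \<omega> - W m s \<omega>)" if "m \<in> {i, j}" "0 \<le> s" "0 \<le> t" for m s t
    using that by (intro sq_integrable_diff sqW)
  have inc: "expectation (\<lambda>\<omega>. (W i q \<omega> - W i p \<omega>) * (W j q' \<omega> - W j p' \<omega>)) = 0"
    if "0 \<le> p" "0 \<le> q" "0 \<le> p'" "0 \<le> q'" for p q p' q'
  proof -
    have "expectation (\<lambda>\<omega>. (W i q \<omega> - W i p \<omega>) * (W j q' \<omega> - W j p' \<omega>))
      = expectation (\<lambda>\<omega>. W i q \<omega> * W j q' \<omega> - W i q \<omega> * W j p' \<omega> - W i p \<omega> * W j q' \<omega> + W i p \<omega> * W j p' \<omega>)"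
      by (intro Bochner_Integration.integral_cong) (auto simp: algebra_simps)
    also have "\<dots> = 0"
      using that i sq_integrable_mult[OF sqW[of i] sqW[of j]] by (simp add: expectation_W_mult)
    finally show ?thesis .
  qed
  have "expectation (\<lambda>\<omega>. step_integral (W i) n \<tau> a \<omega> * step_integral (W j) n' \<tau>' a' \<omega>)
    = (\<Sum>k<n. \<Sum>l<n'. a k * a' l * expectation (\<lambda>\<omega>. (W i (\<tau> (Suc k)) \<omega> - W i (\<tau> k) \<omega>) * (W j (\<tau>' (Suc l)) \<omega> - W j (\<tau>' l) \<omega>)))"
    unfolding step_integral_def by (intro integral_mult_sums sq) (use nn nn' in auto)
  also have "\<dots> = 0" using nn nn' by (intro sum.neutral ballI) (simp add: inc)
  finally show ?thesis .
qed

text \<open>The correlation of the approximating step integrals vanishes by independence and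
  centring, and the inner product is continuous in mean square.\<close>

lemma wiener_integrals_uncorrelated:
  assumes i: "i \<in> I" "j \<in> I" "i \<noteq> j"
    and J: "has_wiener_integral M (W i) f s J" and J': "has_wiener_integral M (W j) g t J'"
  shows "expectation (\<lambda>\<omega>. J \<omega> * J' \<omega>) = 0"
proof -
  obtain n \<tau> a where a: "\<And>j::nat. 0 \<le> \<tau> j 0 \<and> mono_on {..n j} (\<tau> j)"
    and lim: "(\<lambda>k. \<integral>\<^sup>+\<omega>. ennreal ((J \<omega> - step_integral (W i) (n k) (\<tau> k) (a k) \<omega>)\<^sup>2) \<partial>M) \<longlonglongrightarrow> 0"
    using J unfolding has_wiener_integral_def by blast
  obtain n' \<tau>' a' where a': "\<And>j::nat. 0 \<le> \<tau>' j 0 \<and> mono_on {..n' j} (\<tau>' j)"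
    and lim': "(\<lambda>k. \<integral>\<^sup>+\<omega>. ennreal ((J' \<omega> - step_integral (W j) (n' k) (\<tau>' k) (a' k) \<omega>)\<^sup>2) \<partial>M) \<longlonglongrightarrow> 0"
    using J' unfolding has_wiener_integral_def by blast
  have JM: "J \<in> borel_measurable M" "J' \<in> borel_measurable M"
    using J J' by (auto simp: has_wiener_integral_def)
  have L: "(\<lambda>k. expectation (\<lambda>\<omega>. step_integral (W i) (n k) (\<tau> k) (a k) \<omega> * step_integral (W j) (n' k) (\<tau>' k) (a' k) \<omega>))
     \<longlonglongrightarrow> expectation (\<lambda>\<omega>. J \<omega> * J' \<omega>)"
    by (rule L2_inner_limit[where fn = "\<lambda>k. step_integral (W i) (n k) (\<tau> k) (a k)" and gn = "\<lambda>k. step_integral (W j) (n' k) (\<tau>' k) (a' k)",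
          OF JM(1) _ lim JM(2) _ lim']) (use step_integral_sq_integrable[OF brownian] i a a' in auto)
  have "(\<lambda>k. expectation (\<lambda>\<omega>. step_integral (W i) (n k) (\<tau> k) (a k) \<omega> * step_integral (W j) (n' k) (\<tau>' k) (a' k) \<omega>)) = (\<lambda>k. 0)"
    using a a' by (intro ext step_integrals_uncorrelated[OF i]) auto
  with L show ?thesis by (simp add: LIMSEQ_const_iff)
qed

end

section \<open>Quadratic variation of Ornstein--Uhlenbeck sums\<close>

text \<open>Covariance of the Ornstein-Uhlenbeck integral started from 0: the first exponential is
  the stationary part, the second the correction due to the start.\<close>

definition ou_cov :: "real \<Rightarrow> real \<Rightarrow> real \<Rightarrow> real" where
  "ou_cov \<mu> s t = (exp (- (\<mu> * \<bar>t - s\<bar>)) - exp (- (\<mu> * (s + t)))) / (2 * \<mu>)"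

lemma ou_kernel_integral:
  assumes l: "0 < \<mu>" and st: "0 \<le> s" "0 \<le> t"
  shows "(LINT x|lborel. (exp (- \<mu> * (s - x)) * indicator {0..s} x) * (exp (- \<mu> * (t - x)) * indicator {0..t} x))
    = ou_cov \<mu> s t"
proof -
  define m where "m = min s t"
  have m: "0 \<le> m" using st by (simp add: m_def)
  have "(LINT x|lborel. (exp (- \<mu> * (s - x)) * indicator {0..s} x) * (exp (- \<mu> * (t - x)) * indicator {0..t} x))
    = (LINT x|lborel. exp (2 * \<mu> * x - \<mu> * (s + t)) * indicator {0..m} x)"
    by (intro Bochner_Integration.integral_cong refl)
       (auto simp: m_def indicator_def exp_add[symmetric] algebra_simps)
  also have "\<dots> = exp (2 * \<mu> * m - \<mu> * (s + t)) / (2 * \<mu>) - exp (2 * \<mu> * 0 - \<mu> * (s + t)) / (2 * \<mu>)"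
  proof (rule integral_FTC_Icc_real[OF m])
    show "DERIV (\<lambda>x. exp (2 * \<mu> * x - \<mu> * (s + t)) / (2 * \<mu>)) x :> exp (2 * \<mu> * x - \<mu> * (s + t))" for x
      using l by (auto intro!: derivative_eq_intros)
  qed (auto intro!: continuous_intros)
  also have "2 * \<mu> * m - \<mu> * (s + t) = - (\<mu> * \<bar>t - s\<bar>)"
    by (simp add: m_def min_def abs_if algebra_simps)
  finally show ?thesis by (simp add: ou_cov_def diff_divide_distrib)
qed

text \<open>Covariance of the increments over the i-th and j-th time steps. Steps are counted from
  1, so i - 1 is a genuine predecessor.\<close>

definition ou_inc_cov :: "real \<Rightarrow> real \<Rightarrow> nat \<Rightarrow> nat \<Rightarrow> real" where
  "ou_inc_cov \<mu> D i j = ou_cov \<mu> (real i * D) (real j * D) - ou_cov \<mu> (real i * D) (real (j - 1) * D)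
     - ou_cov \<mu> (real (i - 1) * D) (real j * D) + ou_cov \<mu> (real (i - 1) * D) (real (j - 1) * D)"

text \<open>On the grid everything is a power of q = e^(-\<mu> D), which reduces the increment
  covariances to polynomial identities in q.\<close>

lemma ou_cov_grid:
  assumes "0 \<le> D"
  shows "ou_cov \<mu> (real i * D) (real (i + d) * D) = (exp (-(\<mu>*D)) ^ d - exp (-(\<mu>*D)) ^ (2*i+d)) / (2*\<mu>)"
proof -
  have e: "exp (-(\<mu>*D)) ^ n = exp (-(\<mu> * (real n * D)))" for n :: nat
    by (simp add: exp_of_nat_mult[symmetric] algebra_simps)
  have "\<bar>real (i + d) * D - real i * D\<bar> = real d * D" using assms by (simp add: algebra_simps)
  moreover have "real i * D + real (i + d) * D = real (2*i+d) * D" by (simp add: algebra_simps)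
  ultimately show ?thesis unfolding ou_cov_def e by (simp only:)
qed

lemma ou_cov_commute: "ou_cov \<mu> s t = ou_cov \<mu> t s"
  by (simp add: ou_cov_def add.commute abs_minus_commute)

lemma ou_inc_cov_commute: "ou_inc_cov \<mu> D i j = ou_inc_cov \<mu> D j i"
  by (simp add: ou_inc_cov_def ou_cov_commute)

text \<open>The first term is the stationary increment variance. The second, due to the start at 0,
  decays geometrically in i, so that summed over all steps it is no larger than one stationary
  increment variance.\<close>

lemma ou_inc_cov_diag:
  assumes "0 \<le> D" "\<mu> \<noteq> 0"
  shows "ou_inc_cov \<mu> D (Suc i) (Suc i)
    = (1 - exp (-(\<mu>*D))) / \<mu> - (1 - exp (-(\<mu>*D)))\<^sup>2 * exp (-(\<mu>*D)) ^ (2*i) / (2*\<mu>)"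
proof -
  let ?q = "exp (-(\<mu>*D))"
  have 1: "ou_cov \<mu> (real (Suc i) * D) (real (Suc i) * D) = (1 - ?q ^ (2*i+2)) / (2*\<mu>)"
    using ou_cov_grid[OF assms(1), of \<mu> "Suc i" 0] by simp
  have 2: "ou_cov \<mu> (real i * D) (real (Suc i) * D) = (?q - ?q ^ (2*i+1)) / (2*\<mu>)"
    using ou_cov_grid[OF assms(1), of \<mu> i 1] by simp
  have 3: "ou_cov \<mu> (real i * D) (real i * D) = (1 - ?q ^ (2*i)) / (2*\<mu>)"
    using ou_cov_grid[OF assms(1), of \<mu> i 0] by simp
  have "ou_inc_cov \<mu> D (Suc i) (Suc i) = (1 - ?q ^ (2*i+2)) / (2*\<mu>) - 2 * ((?q - ?q ^ (2*i+1)) / (2*\<mu>)) + (1 - ?q ^ (2*i)) / (2*\<mu>)"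
  proof -
    have "x - y - y + z = x - 2 * y + z" for x y z :: real by simp
    then show ?thesis
      unfolding ou_inc_cov_def diff_Suc_1 ou_cov_commute[of \<mu> "real (Suc i) * D" "real i * D"] 1 2 3 .
  qed
  also have "\<dots> = (1 - ?q) / \<mu> - (1 - ?q)\<^sup>2 * ?q ^ (2*i) / (2*\<mu>)"
    using assms(2) by (simp add: field_simps power2_eq_square power_add)
  finally show ?thesis .
qed

text \<open>Distinct increments are negatively correlated, with geometric decay in the lag. The
  factor (1 - q)^2 keeps the sum over all lags of order 1 - q.\<close>

lemma ou_inc_cov_off_diag:
  assumes "0 \<le> D" "\<mu> \<noteq> 0"
  shows "ou_inc_cov \<mu> D (Suc i) (Suc i + Suc d)
    = - ((1 - exp (-(\<mu>*D)))\<^sup>2 * (exp (-(\<mu>*D)) ^ d + exp (-(\<mu>*D)) ^ (2*i+d+1))) / (2*\<mu>)"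
proof -
  let ?q = "exp (-(\<mu>*D))"
  have 1: "ou_cov \<mu> (real (Suc i) * D) (real (Suc i + Suc d) * D) = (?q^(d+1) - ?q ^ (2*i+d+3)) / (2*\<mu>)"
    using ou_cov_grid[OF assms(1), of \<mu> "Suc i" "Suc d"] by (simp add: numeral_3_eq_3)
  have 2: "ou_cov \<mu> (real (Suc i) * D) (real (i + Suc d) * D) = (?q^d - ?q ^ (2*i+d+2)) / (2*\<mu>)"
    using ou_cov_grid[OF assms(1), of \<mu> "Suc i" d] by simp
  have 3: "ou_cov \<mu> (real i * D) (real (Suc i + Suc d) * D) = (?q^(d+2) - ?q ^ (2*i+d+2)) / (2*\<mu>)"
    using ou_cov_grid[OF assms(1), of \<mu> i "d+2"] by simp
  have 4: "ou_cov \<mu> (real i * D) (real (i + Suc d) * D) = (?q^(d+1) - ?q ^ (2*i+d+1)) / (2*\<mu>)"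
    using ou_cov_grid[OF assms(1), of \<mu> i "d+1"] by simp
  have s: "Suc i + Suc d - 1 = i + Suc d" by simp
  show ?thesis
    unfolding ou_inc_cov_def diff_Suc_1 s 1 2 3 4 using assms(2)
    by (simp add: field_simps power2_eq_square power_add power3_eq_cube)
qed

text \<open>Bound for \<mu> times the covariance at lag d. The values at positive lags sum to at
  most 1 - q, which is the value at lag 0.\<close>

definition ou_decay :: "real \<Rightarrow> nat \<Rightarrow> real" where
  "ou_decay q d = (if d = 0 then 1 - q else (1 - q)\<^sup>2 * q ^ (d - 1))"

lemma ou_decay_nonneg: "0 \<le> q \<Longrightarrow> q \<le> 1 \<Longrightarrow> 0 \<le> ou_decay q d"
  by (simp add: ou_decay_def)

lemma ou_decay_le: "0 \<le> q \<Longrightarrow> q \<le> 1 \<Longrightarrow> ou_decay q d \<le> 1 - q"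
  by (auto simp: ou_decay_def power2_eq_square mult.assoc intro!: mult_left_le mult_le_one power_le_one)

lemma geometric_sum_le:
  assumes "0 \<le> q" "q \<le> (1::real)"
  shows "(1 - q) * (\<Sum>i<n. q ^ i) \<le> 1"
proof -
  have "(1 - q) * (\<Sum>i<n. q ^ i) = 1 - q ^ n" by (simp add: one_diff_power_eq)
  then show ?thesis using assms by simp
qed

lemma sum_ou_decay_le:
  assumes q: "0 \<le> q" "q \<le> 1"
  shows "(\<Sum>d<n. ou_decay q d) \<le> 2 * (1 - q)"
proof (cases n)
  case (Suc m)
  have "(\<Sum>d<n. ou_decay q d) = (1 - q) + (\<Sum>d<m. (1 - q)\<^sup>2 * q ^ d)"
    unfolding Suc by (subst sum.lessThan_Suc_shift) (simp add: ou_decay_def)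
  also have "(\<Sum>d<m. (1 - q)\<^sup>2 * q ^ d) = (1 - q) * ((1 - q) * (\<Sum>d<m. q ^ d))"
    by (simp add: sum_distrib_left power2_eq_square mult.assoc)
  also have "\<dots> \<le> (1 - q) * 1" using geometric_sum_le[OF q] q by (intro mult_left_mono) auto
  finally show ?thesis by simp
qed (use q in simp)

lemma sum_sq_geometric_le:
  assumes q: "0 \<le> q" "q \<le> (1::real)"
  shows "(\<Sum>i<n. (1 - q)\<^sup>2 * q ^ (2*i)) \<le> 1 - q"
proof -
  have "(\<Sum>i<n. (1 - q)\<^sup>2 * q ^ (2*i)) \<le> (\<Sum>i<n. (1 - q)\<^sup>2 * q ^ i)"
    using q by (intro sum_mono mult_left_mono power_decreasing) auto
  also have "\<dots> = (1 - q) * ((1 - q) * (\<Sum>i<n. q ^ i))"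
    by (simp add: sum_distrib_left power2_eq_square mult.assoc)
  also have "\<dots> \<le> (1 - q) * 1" using geometric_sum_le[OF q] q by (intro mult_left_mono) auto
  finally show ?thesis by simp
qed

text \<open>In truncated subtraction (i - j) + (j - i) is the distance of i and j. Off the diagonal
  the start-up term is at most the stationary one, so the denominator 2 \<mu> absorbs both.\<close>

lemma abs_ou_inc_cov_le:
  assumes D: "0 \<le> D" and l: "0 < \<mu>" and ij: "1 \<le> i" "1 \<le> j"
  shows "\<bar>ou_inc_cov \<mu> D i j\<bar> \<le> ou_decay (exp (-(\<mu>*D))) ((i - j) + (j - i)) / \<mu>"
proof -
  let ?q = "exp (-(\<mu>*D))"
  have q: "0 \<le> ?q" "?q \<le> 1" using D l by auto
  have lt: "\<bar>ou_inc_cov \<mu> D i j\<bar> \<le> ou_decay ?q ((i - j) + (j - i)) / \<mu>" if "1 \<le> i" "i < j" for i j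
  proof -
    obtain i' where i: "i = Suc i'" using \<open>1 \<le> i\<close> by (cases i) auto
    obtain d where d: "j = i + Suc d" using less_imp_Suc_add[OF \<open>i < j\<close>] by auto
    have "?q ^ (2*i'+d+1) \<le> ?q ^ d" using q by (intro power_decreasing) auto
    then have "(1 - ?q)\<^sup>2 * (?q ^ d + ?q ^ (2*i'+d+1)) \<le> (1 - ?q)\<^sup>2 * (2 * ?q ^ d)"
      by (intro mult_left_mono) auto
    then have "(1 - ?q)\<^sup>2 * (?q ^ d + ?q ^ (2*i'+d+1)) / (2*\<mu>) \<le> (1 - ?q)\<^sup>2 * (2 * ?q ^ d) / (2*\<mu>)"
      using l by (intro divide_right_mono) auto
    moreover have "\<bar>ou_inc_cov \<mu> D i j\<bar> = (1 - ?q)\<^sup>2 * (?q ^ d + ?q ^ (2*i'+d+1)) / (2*\<mu>)"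
      unfolding d i ou_inc_cov_off_diag[OF D less_imp_neq[OF l, symmetric]]
      using l by (simp add: abs_mult)
    ultimately show ?thesis using l by (simp add: d ou_decay_def)
  qed
  consider "i < j" | "i = j" | "j < i" by linarith
  then show ?thesis
  proof cases
    case 1
    then show ?thesis using lt ij by simp
  next
    case 3
    then show ?thesis using lt[of j i] ij by (simp add: ou_inc_cov_commute[of \<mu> D i j])
  next
    case 2
    obtain i' where i: "i = Suc i'" using \<open>1 \<le> i\<close> by (cases i) auto
    have e: "\<bar>ou_inc_cov \<mu> D i j\<bar> = \<bar>(1 - ?q) / \<mu> - (1 - ?q)\<^sup>2 * ?q ^ (2*i') / (2*\<mu>)\<bar>"
      using ou_inc_cov_diag[OF D less_imp_neq[OF l, symmetric], of i'] 2 i by simp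
    have "(1 - ?q)\<^sup>2 * ?q ^ (2*i') \<le> 1 - ?q"
      using q by (auto simp: power2_eq_square mult.assoc intro!: mult_left_le mult_le_one power_le_one)
    then have "(1 - ?q)\<^sup>2 * ?q ^ (2*i') \<le> 2 * (1 - ?q)" by (rule order_trans) (use q in simp)
    then have "(1 - ?q)\<^sup>2 * ?q ^ (2*i') / (2*\<mu>) \<le> 2 * (1 - ?q) / (2*\<mu>)"
      using l by (intro divide_right_mono) auto
    moreover have "2 * (1 - ?q) / (2*\<mu>) = (1 - ?q) / \<mu>" by (rule mult_divide_mult_cancel_left) simp
    moreover have "0 \<le> (1 - ?q)\<^sup>2 * ?q ^ (2*i') / (2*\<mu>)" using l by simp
    ultimately show ?thesis unfolding e using 2 by (simp add: ou_decay_def)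
  qed
qed

text \<open>Each distance below n is attained at most once on either side of i.\<close>

lemma sum_dist_le:
  fixes r :: "nat \<Rightarrow> real"
  assumes r: "\<And>d. 0 \<le> r d" and i: "i \<in> {1..n}"
  shows "(\<Sum>j=1..n. r ((i - j) + (j - i))) \<le> 2 * (\<Sum>d<n. r d)"
proof -
  have "(\<Sum>j=1..n. r ((i - j) + (j - i))) \<le> (\<Sum>j\<in>{1..i}. r (i - j)) + (\<Sum>j\<in>{i..n}. r (j - i))"
  proof -
    have "{1..n} = {1..i} \<union> {Suc i..n}" "{1..i} \<inter> {Suc i..n} = {}" using i by auto
    then have "(\<Sum>j=1..n. r ((i - j) + (j - i))) = (\<Sum>j\<in>{1..i}. r ((i - j) + (j - i))) + (\<Sum>j\<in>{Suc i..n}. r ((i - j) + (j - i)))"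
      by (simp add: sum.union_disjoint)
    also have "(\<Sum>j\<in>{1..i}. r ((i - j) + (j - i))) = (\<Sum>j\<in>{1..i}. r (i - j))" by (intro sum.cong) auto
    also have "(\<Sum>j\<in>{Suc i..n}. r ((i - j) + (j - i))) = (\<Sum>j\<in>{Suc i..n}. r (j - i))" by (intro sum.cong) auto
    also have "\<dots> \<le> (\<Sum>j\<in>{i..n}. r (j - i))" using r by (intro sum_mono2) auto
    finally show ?thesis by simp
  qed
  also have "(\<Sum>j\<in>{1..i}. r (i - j)) = (\<Sum>d\<in>(\<lambda>j. i - j) ` {1..i}. r d)"
    by (subst sum.reindex) (auto simp: inj_on_def)
  also have "\<dots> \<le> (\<Sum>d<n. r d)" using r i by (intro sum_mono2) auto
  also have "(\<Sum>j\<in>{i..n}. r (j - i)) = (\<Sum>d\<in>(\<lambda>j. j - i) ` {i..n}. r d)"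
    by (subst sum.reindex) (auto simp: inj_on_def)
  also have "\<dots> \<le> (\<Sum>d<n. r d)" using r i by (intro sum_mono2) auto
  finally show ?thesis by simp
qed

section \<open>Variance of quadratic forms in the Gaussian space\<close>

context brownian_family
begin

text \<open>By Isserlis' formula two squares have covariance twice the square of the covariance. Its
  assumptions on sums and differences hold because these remain in
  \<open>wiener_space\<close>.\<close>

lemma quadratic_form_variance:
  assumes S: "finite S" and B: "\<And>i. i \<in> S \<Longrightarrow> wiener_space (B i)"
  defines "C \<equiv> \<lambda>i j. expectation (\<lambda>\<omega>. B i \<omega> * B j \<omega>)"
  shows "integrable M (\<lambda>\<omega>. ((\<Sum>i\<in>S. (B i \<omega>)\<^sup>2) - (\<Sum>i\<in>S. C i i))\<^sup>2)"
    "expectation (\<lambda>\<omega>. ((\<Sum>i\<in>S. (B i \<omega>)\<^sup>2) - (\<Sum>i\<in>S. C i i))\<^sup>2) = 2 * (\<Sum>i\<in>S. \<Sum>j\<in>S. (C i j)\<^sup>2)"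
proof -
  have g: "gaussian (B i) (C i i)" if "i \<in> S" for i
    using wiener_space_gaussian[OF B[OF that]] by (simp add: C_def power2_eq_square)
  have sq: "integrable M (\<lambda>\<omega>. (B i \<omega>)\<^sup>2)" "expectation (\<lambda>\<omega>. (B i \<omega>)\<^sup>2) = C i i" if "i \<in> S" for i
    using gaussian_moments(1,2)[OF g[OF that]] by (auto simp: sq_integrable_def)
  have prod: "integrable M (\<lambda>\<omega>. (B i \<omega>)\<^sup>2 * (B j \<omega>)\<^sup>2)"
    "expectation (\<lambda>\<omega>. (B i \<omega>)\<^sup>2 * (B j \<omega>)\<^sup>2) = C i i * C j j + 2 * (C i j)\<^sup>2" if "i \<in> S" "j \<in> S" for i j
    using gaussian_sq_mult[OF g[OF that(1)] g[OF that(2)] wiener_space_gaussian[OF wiener_space_add[OF B[OF that(1)] B[OF that(2)]]]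
        wiener_space_gaussian[OF wiener_space_diff[OF B[OF that(1)] B[OF that(2)]]]]
    by (auto simp: C_def)
  let ?c = "\<Sum>i\<in>S. C i i"
  have eq: "((\<Sum>i\<in>S. (B i \<omega>)\<^sup>2) - ?c)\<^sup>2 = (\<Sum>i\<in>S. \<Sum>j\<in>S. (B i \<omega>)\<^sup>2 * (B j \<omega>)\<^sup>2) - 2 * ?c * (\<Sum>i\<in>S. (B i \<omega>)\<^sup>2) + ?c\<^sup>2" for \<omega>
    by (simp only: sum_product[symmetric]) (simp add: power2_eq_square algebra_simps)
  show "integrable M (\<lambda>\<omega>. ((\<Sum>i\<in>S. (B i \<omega>)\<^sup>2) - ?c)\<^sup>2)"
    unfolding eq using sq prod by (intro Bochner_Integration.integrable_add Bochner_Integration.integrable_diff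
        Bochner_Integration.integrable_sum integrable_mult_right integrable_const) auto
  have "expectation (\<lambda>\<omega>. ((\<Sum>i\<in>S. (B i \<omega>)\<^sup>2) - ?c)\<^sup>2)
    = (\<Sum>i\<in>S. \<Sum>j\<in>S. C i i * C j j + 2 * (C i j)\<^sup>2) - 2 * ?c * ?c + ?c\<^sup>2"
  proof -
    have i1: "integrable M (\<lambda>\<omega>. \<Sum>i\<in>S. \<Sum>j\<in>S. (B i \<omega>)\<^sup>2 * (B j \<omega>)\<^sup>2)"
      using prod by (intro Bochner_Integration.integrable_sum) auto
    have i2: "integrable M (\<lambda>\<omega>. \<Sum>i\<in>S. (B i \<omega>)\<^sup>2)" using sq by (intro Bochner_Integration.integrable_sum) auto
    have e1: "expectation (\<lambda>\<omega>. \<Sum>i\<in>S. \<Sum>j\<in>S. (B i \<omega>)\<^sup>2 * (B j \<omega>)\<^sup>2) = (\<Sum>i\<in>S. \<Sum>j\<in>S. C i i * C j j + 2 * (C i j)\<^sup>2)"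
      using prod by (subst Bochner_Integration.integral_sum, intro Bochner_Integration.integrable_sum, simp, intro sum.cong refl)
        (subst Bochner_Integration.integral_sum, auto)
    have e2: "expectation (\<lambda>\<omega>. \<Sum>i\<in>S. (B i \<omega>)\<^sup>2) = ?c"
      using sq by (subst Bochner_Integration.integral_sum) auto
    show ?thesis unfolding eq using i1 i2 e1 e2 prob_space by simp
  qed
  also have "\<dots> = 2 * (\<Sum>i\<in>S. \<Sum>j\<in>S. (C i j)\<^sup>2)"
    by (simp add: sum.distrib sum_product sum_distrib_left[symmetric] power2_eq_square)
  finally show "expectation (\<lambda>\<omega>. ((\<Sum>i\<in>S. (B i \<omega>)\<^sup>2) - ?c)\<^sup>2) = 2 * (\<Sum>i\<in>S. \<Sum>j\<in>S. (C i j)\<^sup>2)" .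
qed

lemma ou_wiener_cov:
  assumes "m \<in> I" "0 < \<mu>" "0 \<le> s" "0 \<le> t"
    and "has_wiener_integral M (W m) (\<lambda>u. exp (- \<mu> * (s - u))) s J"
    and "has_wiener_integral M (W m) (\<lambda>u. exp (- \<mu> * (t - u))) t J'"
  shows "expectation (\<lambda>\<omega>. J \<omega> * J' \<omega>) = ou_cov \<mu> s t"
  using wiener_isometry[OF brownian[OF assms(1)] assms(5,6)] ou_kernel_integral[OF assms(2-4)] by simp

text \<open>S is the stationary variance of one increment. Covariances at lag d are at most
  \<open>R d\<close>, where R is bounded by S and sums to at most 2 S; a row of squared covariances
  is then at most S times 4 S, and the variance at most 8 N S^2. The exact mean differs from N S by
  at most S, so the second moment is at most 16 N S^2 + 2 S^2, hence 18.\<close>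

lemma noise_quadratic_variation:
  fixes F :: "'i set" and N :: nat and b lam :: "'i \<Rightarrow> real" and J :: "'i \<Rightarrow> real \<Rightarrow> 'w \<Rightarrow> real"
  assumes F: "finite F" "F \<subseteq> I" and lam: "\<And>m. m \<in> F \<Longrightarrow> 0 < lam m" and N: "1 \<le> N"
    and J: "\<And>m t. m \<in> F \<Longrightarrow> t \<in> {0..1} \<Longrightarrow> has_wiener_integral M (W m) (\<lambda>u. exp (- lam m * (t - u))) t (J m t)"
  defines "B \<equiv> \<lambda>i \<omega>. \<Sum>m\<in>F. b m * (J m (real i / real N) \<omega> - J m (real (i - 1) / real N) \<omega>)"
    and "S \<equiv> \<Sum>m\<in>F. (b m)\<^sup>2 * ((1 - exp (-(lam m / real N))) / lam m)"
  shows "i \<in> {1..N} \<Longrightarrow> sq_integrable M (B i)"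
    and "integrable M (\<lambda>\<omega>. ((\<Sum>i=1..N. (B i \<omega>)\<^sup>2) - real N * S)\<^sup>2)"
    and "expectation (\<lambda>\<omega>. ((\<Sum>i=1..N. (B i \<omega>)\<^sup>2) - real N * S)\<^sup>2) \<le> 18 * real N * S\<^sup>2"
proof -
  define D where "D = 1 / real N"
  have D: "0 \<le> D" by (simp add: D_def)
  define q where "q m = exp (-(lam m * D))" for m
  have q: "0 \<le> q m" "q m \<le> 1" if "m \<in> F" for m using lam[OF that] D by (auto simp: q_def)
  have S_eq: "S = (\<Sum>m\<in>F. (b m)\<^sup>2 * ((1 - q m) / lam m))" unfolding S_def q_def D_def by simp
  have S0: "0 \<le> S" unfolding S_eq using q lam by (intro sum_nonneg mult_nonneg_nonneg divide_nonneg_pos) auto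
  have grid: "real i * D \<in> {0..1}" if "i \<le> N" for i using that N by (simp add: D_def)
  define X where "X m i \<omega> = J m (real i * D) \<omega> - J m (real (i - 1) * D) \<omega>" for m i \<omega>
  have B_eq: "B = (\<lambda>i \<omega>. \<Sum>m\<in>F. b m * X m i \<omega>)" unfolding B_def X_def D_def by simp
  have Jws: "wiener_space (J m (real i * D))" if "m \<in> F" "i \<le> N" for m i
    using J[OF that(1) grid[OF that(2)]] F that by (intro wiener_integral_wiener_space) auto
  have Xws: "wiener_space (X m i)" if "m \<in> F" "i \<le> N" for m i
    unfolding X_def[abs_def] using that by (intro wiener_space_diff Jws) auto
  have Bws: "wiener_space (B i)" if "i \<in> {1..N}" for i
    unfolding B_eq using that by (intro wiener_space_sum wiener_space_cmult Xws) auto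
  show "i \<in> {1..N} \<Longrightarrow> sq_integrable M (B i)" using Bws wiener_space_sq_integrable by blast
  \<comment> \<open>Different modes are uncorrelated, so the double sums over modes collapse to
    their diagonals.\<close>
  have JJ: "expectation (\<lambda>\<omega>. J m (real i * D) \<omega> * J m' (real j * D) \<omega>)
     = (if m = m' then ou_cov (lam m) (real i * D) (real j * D) else 0)"
    if m: "m \<in> F" "m' \<in> F" and ij: "i \<le> N" "j \<le> N" for m m' i j
  proof (cases "m = m'")
    case True
    have mI: "m \<in> I" using F m by auto
    show ?thesis using True ou_wiener_cov[OF mI lam[OF m(1)] _ _ J[OF m(1) grid[OF ij(1)]] J[OF m(1) grid[OF ij(2)]]] D by simp
  next
    case False
    have "m \<in> I" "m' \<in> I" using F m by auto
    with False show ?thesis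
      using wiener_integrals_uncorrelated[OF _ _ False J[OF m(1) grid[OF ij(1)]] J[OF m(2) grid[OF ij(2)]]] by simp
  qed
  have XX: "expectation (\<lambda>\<omega>. X m i \<omega> * X m' j \<omega>) = (if m = m' then ou_inc_cov (lam m) D i j else 0)"
    if m: "m \<in> F" "m' \<in> F" and ij: "i \<in> {1..N}" "j \<in> {1..N}" for m m' i j
  proof -
    let ?J = "\<lambda>m i. J m (real i * D)"
    have ij': "i \<le> N" "j \<le> N" "i - 1 \<le> N" "j - 1 \<le> N" using ij by auto
    have int: "integrable M (\<lambda>\<omega>. ?J m i \<omega> * ?J m' j \<omega>)" if "i \<le> N" "j \<le> N" for i j
      using that m by (intro sq_integrable_mult wiener_space_sq_integrable Jws)
    have "expectation (\<lambda>\<omega>. X m i \<omega> * X m' j \<omega>) = expectation (\<lambda>\<omega>. ?J m i \<omega> * ?J m' j \<omega> - ?J m i \<omega> * ?J m' (j - 1) \<omega>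
        - ?J m (i - 1) \<omega> * ?J m' j \<omega> + ?J m (i - 1) \<omega> * ?J m' (j - 1) \<omega>)"
      unfolding X_def by (intro Bochner_Integration.integral_cong refl) (simp add: algebra_simps)
    also have "\<dots> = (if m = m' then ou_inc_cov (lam m) D i j else 0)"
      using ij' by (simp add: int JJ[OF m] ou_inc_cov_def)
    finally show ?thesis .
  qed
  define C where "C i j = expectation (\<lambda>\<omega>. B i \<omega> * B j \<omega>)" for i j
  have C: "C i j = (\<Sum>m\<in>F. (b m)\<^sup>2 * ou_inc_cov (lam m) D i j)" if ij: "i \<in> {1..N}" "j \<in> {1..N}" for i j
  proof -
    have "C i j = (\<Sum>m\<in>F. \<Sum>m'\<in>F. b m * b m' * expectation (\<lambda>\<omega>. X m i \<omega> * X m' j \<omega>))"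
      unfolding C_def B_eq
      by (intro integral_mult_sums wiener_space_sq_integrable Xws) (use ij in auto)
    also have "\<dots> = (\<Sum>m\<in>F. \<Sum>m'\<in>F. if m = m' then (b m)\<^sup>2 * ou_inc_cov (lam m) D i j else 0)"
      using ij by (intro sum.cong refl) (auto simp: XX power2_eq_square)
    also have "\<dots> = (\<Sum>m\<in>F. (b m)\<^sup>2 * ou_inc_cov (lam m) D i j)" using F by simp
    finally show ?thesis .
  qed
  define R where "R d = (\<Sum>m\<in>F. (b m)\<^sup>2 * (ou_decay (q m) d / lam m))" for d
  have R0: "0 \<le> R d" for d
    unfolding R_def using ou_decay_nonneg[OF q] lam by (intro sum_nonneg mult_nonneg_nonneg divide_nonneg_pos) auto
  have RS: "R d \<le> S" for d
    unfolding R_def S_eq using ou_decay_le[OF q] lam by (intro sum_mono mult_left_mono divide_right_mono) (auto simp: less_imp_le)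
  have Rsum: "(\<Sum>d<N. R d) \<le> 2 * S"
  proof -
    have "(\<Sum>d<N. R d) = (\<Sum>m\<in>F. (b m)\<^sup>2 * ((\<Sum>d<N. ou_decay (q m) d) / lam m))"
      unfolding R_def by (subst sum.swap) (simp add: sum_distrib_left sum_divide_distrib)
    also have "\<dots> \<le> (\<Sum>m\<in>F. (b m)\<^sup>2 * (2 * (1 - q m) / lam m))"
      using sum_ou_decay_le[OF q] lam by (intro sum_mono mult_left_mono divide_right_mono) (auto simp: less_imp_le)
    also have "\<dots> = 2 * S" unfolding S_eq sum_distrib_left by (intro sum.cong refl) (simp add: field_simps)
    finally show ?thesis .
  qed
  have CR: "\<bar>C i j\<bar> \<le> R ((i - j) + (j - i))" if ij: "i \<in> {1..N}" "j \<in> {1..N}" for i j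
  proof -
    have "\<bar>C i j\<bar> \<le> (\<Sum>m\<in>F. \<bar>(b m)\<^sup>2 * ou_inc_cov (lam m) D i j\<bar>)" unfolding C[OF ij] by (rule sum_abs)
    also have "\<dots> \<le> R ((i - j) + (j - i))" unfolding R_def
    proof (rule sum_mono)
      fix m assume m: "m \<in> F"
      have "\<bar>ou_inc_cov (lam m) D i j\<bar> \<le> ou_decay (q m) ((i - j) + (j - i)) / lam m"
        unfolding q_def using ij lam[OF m] D by (intro abs_ou_inc_cov_le) auto
      then show "\<bar>(b m)\<^sup>2 * ou_inc_cov (lam m) D i j\<bar> \<le> (b m)\<^sup>2 * (ou_decay (q m) ((i - j) + (j - i)) / lam m)"
        by (simp add: abs_mult mult_left_mono del: times_divide_eq_right)
    qed
    finally show ?thesis .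
  qed
  have var: "2 * (\<Sum>i=1..N. \<Sum>j=1..N. (C i j)\<^sup>2) \<le> 8 * real N * S\<^sup>2"
  proof -
    have "(\<Sum>j=1..N. (C i j)\<^sup>2) \<le> 4 * S\<^sup>2" if i: "i \<in> {1..N}" for i
    proof -
      have "(\<Sum>j=1..N. (C i j)\<^sup>2) \<le> (\<Sum>j=1..N. S * R ((i - j) + (j - i)))"
      proof (rule sum_mono)
        fix j assume "j \<in> {1..N}"
        from CR[OF i this] have *: "\<bar>C i j\<bar> \<le> R ((i - j) + (j - i))" .
        have "\<bar>C i j\<bar> * \<bar>C i j\<bar> \<le> S * R ((i - j) + (j - i))"
          using * RS[of "(i - j) + (j - i)"] S0 by (intro mult_mono) auto
        then show "(C i j)\<^sup>2 \<le> S * R ((i - j) + (j - i))" by (simp add: power2_eq_square)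
      qed
      also have "\<dots> = S * (\<Sum>j=1..N. R ((i - j) + (j - i)))" by (simp add: sum_distrib_left)
      also have "\<dots> \<le> S * (2 * (2 * S))"
        using sum_dist_le[of R i N, OF R0 i] Rsum S0 by (intro mult_left_mono) auto
      finally show ?thesis by (simp add: power2_eq_square)
    qed
    then have "(\<Sum>i=1..N. \<Sum>j=1..N. (C i j)\<^sup>2) \<le> (\<Sum>i=1..N. 4 * S\<^sup>2)" by (intro sum_mono) auto
    then show ?thesis by simp
  qed
  define c where "c = (\<Sum>i=1..N. C i i)"
  \<comment> \<open>The start-up corrections are summed over the steps mode by mode; each mode
    contributes at most (1 - q) / (2 lam), independently of N.\<close>
  have mean: "\<bar>c - real N * S\<bar> \<le> S"
  proof -
    have "c = (\<Sum>i<N. C (Suc i) (Suc i))"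
      unfolding c_def by (simp add: sum.atLeast1_atMost_eq)
    also have "\<dots> = (\<Sum>i<N. S - (\<Sum>m\<in>F. (b m)\<^sup>2 * ((1 - q m)\<^sup>2 * q m ^ (2*i) / (2 * lam m))))"
    proof (intro sum.cong refl)
      fix i assume "i \<in> {..<N}"
      then have "C (Suc i) (Suc i) = (\<Sum>m\<in>F. (b m)\<^sup>2 * ou_inc_cov (lam m) D (Suc i) (Suc i))" by (intro C) auto
      also have "\<dots> = (\<Sum>m\<in>F. (b m)\<^sup>2 * ((1 - q m) / lam m) - (b m)\<^sup>2 * ((1 - q m)\<^sup>2 * q m ^ (2*i) / (2 * lam m)))"
      proof (intro sum.cong refl)
        fix m assume "m \<in> F"
        then have "lam m \<noteq> 0" using lam by fastforce
        then show "(b m)\<^sup>2 * ou_inc_cov (lam m) D (Suc i) (Suc i)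
          = (b m)\<^sup>2 * ((1 - q m) / lam m) - (b m)\<^sup>2 * ((1 - q m)\<^sup>2 * q m ^ (2*i) / (2 * lam m))"
          unfolding ou_inc_cov_diag[OF D \<open>lam m \<noteq> 0\<close>] q_def by (simp only: right_diff_distrib)
      qed
      finally show "C (Suc i) (Suc i) = S - (\<Sum>m\<in>F. (b m)\<^sup>2 * ((1 - q m)\<^sup>2 * q m ^ (2*i) / (2 * lam m)))"
        by (simp add: sum_subtractf S_eq)
    qed
    also have "\<dots> = real N * S - (\<Sum>m\<in>F. (b m)\<^sup>2 * ((\<Sum>i<N. (1 - q m)\<^sup>2 * q m ^ (2*i)) / (2 * lam m)))"
    proof -
      have "(\<Sum>i<N. \<Sum>m\<in>F. (b m)\<^sup>2 * ((1 - q m)\<^sup>2 * q m ^ (2*i) / (2 * lam m)))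
        = (\<Sum>m\<in>F. \<Sum>i<N. (b m)\<^sup>2 * ((1 - q m)\<^sup>2 * q m ^ (2*i) / (2 * lam m)))" by (rule sum.swap)
      then show ?thesis by (simp add: sum_subtractf sum_distrib_left sum_divide_distrib)
    qed
    finally have eq: "c - real N * S = - (\<Sum>m\<in>F. (b m)\<^sup>2 * ((\<Sum>i<N. (1 - q m)\<^sup>2 * q m ^ (2*i)) / (2 * lam m)))" by simp
    have "0 \<le> (\<Sum>m\<in>F. (b m)\<^sup>2 * ((\<Sum>i<N. (1 - q m)\<^sup>2 * q m ^ (2*i)) / (2 * lam m)))"
      using lam by (intro sum_nonneg mult_nonneg_nonneg divide_nonneg_nonneg) (auto simp: less_imp_le q_def)
    moreover have "(\<Sum>m\<in>F. (b m)\<^sup>2 * ((\<Sum>i<N. (1 - q m)\<^sup>2 * q m ^ (2*i)) / (2 * lam m))) \<le> S"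
      unfolding S_eq
    proof (intro sum_mono mult_left_mono)
      fix m assume m: "m \<in> F"
      have "(\<Sum>i<N. (1 - q m)\<^sup>2 * q m ^ (2*i)) / (2 * lam m) \<le> (1 - q m) / (2 * lam m)"
        using sum_sq_geometric_le[OF q[OF m]] lam[OF m] by (intro divide_right_mono) auto
      also have "\<dots> \<le> (1 - q m) / lam m" using q[OF m] lam[OF m] by (intro divide_left_mono) auto
      finally show "(\<Sum>i<N. (1 - q m)\<^sup>2 * q m ^ (2*i)) / (2 * lam m) \<le> (1 - q m) / lam m" .
    qed auto
    ultimately show ?thesis unfolding eq by simp
  qed
  have fin: "finite {1..N}" by simp
  note QV = quadratic_form_variance[where B = B, OF fin Bws, folded C_def, folded c_def]
  have pt: "((\<Sum>i=1..N. (B i \<omega>)\<^sup>2) - real N * S)\<^sup>2 \<le> 2 * ((\<Sum>i=1..N. (B i \<omega>)\<^sup>2) - c)\<^sup>2 + 2 * (c - real N * S)\<^sup>2" for \<omega>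
    using zero_le_power2[of "((\<Sum>i=1..N. (B i \<omega>)\<^sup>2) - c) - (c - real N * S)"] by (simp add: power2_eq_square algebra_simps)
  have [measurable]: "B i \<in> borel_measurable M" if "i \<in> {1..N}" for i
    using Bws[OF that] by (simp add: wiener_space_def)
  have int: "integrable M (\<lambda>\<omega>. 2 * ((\<Sum>i=1..N. (B i \<omega>)\<^sup>2) - c)\<^sup>2 + 2 * (c - real N * S)\<^sup>2)" using QV(1) by simp
  show int2: "integrable M (\<lambda>\<omega>. ((\<Sum>i=1..N. (B i \<omega>)\<^sup>2) - real N * S)\<^sup>2)"
    by (rule Bochner_Integration.integrable_bound[OF int]) (use pt in \<open>auto intro!: order_trans[OF pt]\<close>)
  have "expectation (\<lambda>\<omega>. ((\<Sum>i=1..N. (B i \<omega>)\<^sup>2) - real N * S)\<^sup>2)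
    \<le> expectation (\<lambda>\<omega>. 2 * ((\<Sum>i=1..N. (B i \<omega>)\<^sup>2) - c)\<^sup>2 + 2 * (c - real N * S)\<^sup>2)"
    using int2 int pt by (rule integral_mono)
  also have "\<dots> = 2 * (2 * (\<Sum>i=1..N. \<Sum>j=1..N. (C i j)\<^sup>2)) + 2 * (c - real N * S)\<^sup>2"
    using QV prob_space by simp
  also have "\<dots> \<le> 2 * (8 * real N * S\<^sup>2) + 2 * S\<^sup>2"
    using var power_mono[OF mean, of 2] by (intro add_mono mult_left_mono) auto
  also have "\<dots> \<le> 18 * real N * S\<^sup>2"
  proof -
    have "1 * S\<^sup>2 \<le> real N * S\<^sup>2" using N by (intro mult_right_mono) auto
    then show ?thesis by simp
  qed
  finally show "expectation (\<lambda>\<omega>. ((\<Sum>i=1..N. (B i \<omega>)\<^sup>2) - real N * S)\<^sup>2) \<le> 18 * real N * S\<^sup>2" .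
qed

end

section \<open>Initial conditions, boxes and eigenfunctions\<close>

text \<open>Common form of the two alternative assumptions on the initial coefficients: linear
  combinations have second moments as if the coefficients were uncorrelated with variances P / L.
  With L = lam^(1+\<alpha>) the weight matches the power in \<open>kern\<close>.\<close>

definition weighted_l2_bound :: "'a measure \<Rightarrow> 'i set \<Rightarrow> ('i \<Rightarrow> real) \<Rightarrow> ('i \<Rightarrow> 'a \<Rightarrow> real) \<Rightarrow> real \<Rightarrow> bool" where
  "weighted_l2_bound M I L Y P \<longleftrightarrow> 0 \<le> P \<and> (\<forall>F h. finite F \<longrightarrow> F \<subseteq> I \<longrightarrow>
     sq_integrable M (\<lambda>\<omega>. \<Sum>m\<in>F. h m * Y m \<omega>) \<and>
     (LINT \<omega>|M. (\<Sum>m\<in>F. h m * Y m \<omega>)\<^sup>2) \<le> P * (\<Sum>m\<in>F. (h m)\<^sup>2 / L m))"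

text \<open>Independence and zero mean make the coefficients orthogonal, so that their variances, at
  most P / L, remain.\<close>

lemma (in prob_space) weighted_l2_bound_indep:
  assumes ind: "indep_vars (\<lambda>_. borel) Y I" and L: "\<And>m. m \<in> I \<Longrightarrow> 0 < L m"
    and int: "\<And>m. m \<in> I \<Longrightarrow> integrable M (Y m)" and mean: "\<And>m. m \<in> I \<Longrightarrow> expectation (Y m) = 0"
    and sup: "(SUP m\<in>I. ennreal (L m) * (\<integral>\<^sup>+\<omega>. ennreal ((Y m \<omega>)\<^sup>2) \<partial>M)) < \<infinity>"
  shows "\<exists>P. weighted_l2_bound M I L Y P"
proof -
  define S where "S = (SUP m\<in>I. ennreal (L m) * (\<integral>\<^sup>+\<omega>. ennreal ((Y m \<omega>)\<^sup>2) \<partial>M))"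
  define P where "P = enn2real S"
  have SP: "S = ennreal P" using sup unfolding P_def S_def by simp
  have P: "0 \<le> P" by (simp add: P_def)
  have sq: "sq_integrable M (Y m)" and le: "expectation (\<lambda>\<omega>. (Y m \<omega>)\<^sup>2) \<le> P / L m" if m: "m \<in> I" for m
  proof -
    have [measurable]: "Y m \<in> borel_measurable M" using int[OF m] by simp
    have *: "ennreal (L m) * (\<integral>\<^sup>+\<omega>. ennreal ((Y m \<omega>)\<^sup>2) \<partial>M) \<le> ennreal P"
      unfolding SP[symmetric] S_def using m by (rule SUP_upper)
    have "(\<integral>\<^sup>+\<omega>. ennreal ((Y m \<omega>)\<^sup>2) \<partial>M) < \<infinity>"
    \<comment> \<open>An infinite second moment would stay infinite after multiplication by L m > 0
      and contradict the finite supremum.\<close>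
    proof (rule ccontr)
      assume "\<not> ?thesis"
      then have "(\<integral>\<^sup>+\<omega>. ennreal ((Y m \<omega>)\<^sup>2) \<partial>M) = \<infinity>" by (simp add: less_top[symmetric])
      with * L[OF m] show False by (simp add: ennreal_mult_top top_unique)
    qed
    then have i2: "integrable M (\<lambda>\<omega>. (Y m \<omega>)\<^sup>2)" by (intro integrableI_nonneg) auto
    then show "sq_integrable M (Y m)" by (simp add: sq_integrable_def)
    have "(\<integral>\<^sup>+\<omega>. ennreal ((Y m \<omega>)\<^sup>2) \<partial>M) = ennreal (expectation (\<lambda>\<omega>. (Y m \<omega>)\<^sup>2))"
      using i2 by (intro nn_integral_eq_integral) auto
    with * have "ennreal (L m * expectation (\<lambda>\<omega>. (Y m \<omega>)\<^sup>2)) \<le> ennreal P"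
      using L[OF m] by (simp add: ennreal_mult)
    then have "L m * expectation (\<lambda>\<omega>. (Y m \<omega>)\<^sup>2) \<le> P" using P by (simp add: ennreal_le_iff)
    then show "expectation (\<lambda>\<omega>. (Y m \<omega>)\<^sup>2) \<le> P / L m" using L[OF m] by (simp add: field_simps)
  qed
  have ortho: "expectation (\<lambda>\<omega>. Y m \<omega> * Y m' \<omega>) = 0" if m: "m \<in> I" "m' \<in> I" "m \<noteq> m'" for m m'
  proof -
    have "expectation (\<lambda>\<omega>. \<Prod>i\<in>{m, m'}. Y i \<omega>) = (\<Prod>i\<in>{m, m'}. expectation (Y i))"
      by (rule indep_vars_lebesgue_integral) (use m int indep_vars_subset[OF ind, of "{m, m'}"] in auto)
    then show ?thesis using m mean by simp
  qed
  have "sq_integrable M (\<lambda>\<omega>. \<Sum>m\<in>F. h m * Y m \<omega>) \<and>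
     expectation (\<lambda>\<omega>. (\<Sum>m\<in>F. h m * Y m \<omega>)\<^sup>2) \<le> P * (\<Sum>m\<in>F. (h m)\<^sup>2 / L m)" if F: "finite F" "F \<subseteq> I" for F h
  proof
    show "sq_integrable M (\<lambda>\<omega>. \<Sum>m\<in>F. h m * Y m \<omega>)"
      using F sq by (intro sq_integrable_sum sq_integrable_cmult) auto
    have "expectation (\<lambda>\<omega>. (\<Sum>m\<in>F. h m * Y m \<omega>)\<^sup>2) = (\<Sum>m\<in>F. \<Sum>m'\<in>F. h m * h m' * expectation (\<lambda>\<omega>. Y m \<omega> * Y m' \<omega>))"
      unfolding power2_eq_square by (intro integral_mult_sums sq) (use F in auto)
    also have "\<dots> = (\<Sum>m\<in>F. \<Sum>m'\<in>F. if m = m' then (h m)\<^sup>2 * expectation (\<lambda>\<omega>. (Y m \<omega>)\<^sup>2) else 0)"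
    proof (intro sum.cong refl)
      fix m m' assume "m \<in> F" "m' \<in> F"
      then show "h m * h m' * expectation (\<lambda>\<omega>. Y m \<omega> * Y m' \<omega>) = (if m = m' then (h m)\<^sup>2 * expectation (\<lambda>\<omega>. (Y m \<omega>)\<^sup>2) else 0)"
        using F ortho[of m m'] by (auto simp: power2_eq_square)
    qed
    also have "\<dots> = (\<Sum>m\<in>F. (h m)\<^sup>2 * expectation (\<lambda>\<omega>. (Y m \<omega>)\<^sup>2))" using F by simp
    also have "\<dots> \<le> (\<Sum>m\<in>F. (h m)\<^sup>2 * (P / L m))"
      using F le by (intro sum_mono mult_left_mono) auto
    also have "\<dots> = P * (\<Sum>m\<in>F. (h m)\<^sup>2 / L m)" by (simp add: sum_distrib_left mult_ac)
    finally show "expectation (\<lambda>\<omega>. (\<Sum>m\<in>F. h m * Y m \<omega>)\<^sup>2) \<le> P * (\<Sum>m\<in>F. (h m)\<^sup>2 / L m)" .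
  qed
  with P show ?thesis unfolding weighted_l2_bound_def by blast
qed

text \<open>Cauchy-Schwarz at each sample point, pairing h / sqrt L with sqrt L Y; P is the expected
  weighted norm.\<close>

lemma weighted_l2_bound_norm:
  assumes Y: "\<And>m. m \<in> I \<Longrightarrow> Y m \<in> borel_measurable M" and L: "\<And>m. m \<in> I \<Longrightarrow> 0 < L m"
    and fin: "(\<integral>\<^sup>+\<omega>. (\<Sum>\<^sub>\<infinity>m\<in>I. ennreal (L m * (Y m \<omega>)\<^sup>2)) \<partial>M) < \<infinity>"
  shows "\<exists>P. weighted_l2_bound M I L Y P"
proof -
  define P where "P = enn2real (\<integral>\<^sup>+\<omega>. (\<Sum>\<^sub>\<infinity>m\<in>I. ennreal (L m * (Y m \<omega>)\<^sup>2)) \<partial>M)"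
  have P: "0 \<le> P" by (simp add: P_def)
  have "sq_integrable M (\<lambda>\<omega>. \<Sum>m\<in>F. h m * Y m \<omega>) \<and>
     (LINT \<omega>|M. (\<Sum>m\<in>F. h m * Y m \<omega>)\<^sup>2) \<le> P * (\<Sum>m\<in>F. (h m)\<^sup>2 / L m)" if F: "finite F" "F \<subseteq> I" for F h
  proof -
    have Ym [measurable]: "Y m \<in> borel_measurable M" if "m \<in> F" for m using that F Y by auto
    have LF: "0 < L m" if "m \<in> F" for m using that F L by auto
    define S where "S \<omega> = (\<Sum>m\<in>F. L m * (Y m \<omega>)\<^sup>2)" for \<omega>
    have S0: "0 \<le> S \<omega>" for \<omega> unfolding S_def using LF by (intro sum_nonneg mult_nonneg_nonneg) (auto intro: less_imp_le)
    have SM [measurable]: "S \<in> borel_measurable M" unfolding S_def[abs_def] by measurable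
    have "(\<integral>\<^sup>+\<omega>. ennreal (S \<omega>) \<partial>M) \<le> (\<integral>\<^sup>+\<omega>. (\<Sum>\<^sub>\<infinity>m\<in>I. ennreal (L m * (Y m \<omega>)\<^sup>2)) \<partial>M)"
    proof (rule nn_integral_mono)
      fix \<omega>
      have "ennreal (S \<omega>) = (\<Sum>m\<in>F. ennreal (L m * (Y m \<omega>)\<^sup>2))"
        unfolding S_def using LF by (intro sum_ennreal[symmetric] mult_nonneg_nonneg) (auto intro: less_imp_le)
      also have "\<dots> \<le> (\<Sum>\<^sub>\<infinity>m\<in>I. ennreal (L m * (Y m \<omega>)\<^sup>2))"
        by (subst nonneg_infsum_complete) (use F in \<open>auto intro!: SUP_upper\<close>)
      finally show "ennreal (S \<omega>) \<le> (\<Sum>\<^sub>\<infinity>m\<in>I. ennreal (L m * (Y m \<omega>)\<^sup>2))" .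
    qed
    also have "\<dots> = ennreal P" using fin by (simp add: P_def)
    finally have SP: "(\<integral>\<^sup>+\<omega>. ennreal (S \<omega>) \<partial>M) \<le> ennreal P" .
    then have Si: "integrable M S"
      using S0 by (intro integrableI_nonneg) (auto simp: le_less_trans[OF _ ennreal_less_top])
    have SE: "(LINT \<omega>|M. S \<omega>) \<le> P"
      using SP P S0 nn_integral_eq_integral[OF Si] by (simp add: ennreal_le_iff)
    define K where "K = (\<Sum>m\<in>F. (h m)\<^sup>2 / L m)"
    have K: "0 \<le> K" unfolding K_def using LF by (intro sum_nonneg divide_nonneg_pos) auto
    have CS: "(\<Sum>m\<in>F. h m * Y m \<omega>)\<^sup>2 \<le> K * S \<omega>" for \<omega>
    proof -
      have "(\<Sum>m\<in>F. h m * Y m \<omega>)\<^sup>2 = (\<Sum>m\<in>F. (h m / sqrt (L m)) * (sqrt (L m) * Y m \<omega>))\<^sup>2"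
        using LF by (intro arg_cong[where f = "\<lambda>x. x\<^sup>2"] sum.cong refl) (auto simp: less_imp_neq[symmetric])
      also have "\<dots> \<le> (\<Sum>m\<in>F. (h m / sqrt (L m))\<^sup>2) * (\<Sum>m\<in>F. (sqrt (L m) * Y m \<omega>)\<^sup>2)"
        by (rule Cauchy_Schwarz_ineq_sum)
      also have "\<dots> = K * S \<omega>"
        unfolding K_def S_def using LF
        by (intro arg_cong2[where f = "(*)"] sum.cong refl) (auto simp: power_divide power_mult_distrib less_imp_le)
      finally show ?thesis .
    qed
    have M: "(\<lambda>\<omega>. \<Sum>m\<in>F. h m * Y m \<omega>) \<in> borel_measurable M" by measurable
    have KS: "integrable M (\<lambda>\<omega>. K * S \<omega>)" using Si by simp
    have i2: "integrable M (\<lambda>\<omega>. (\<Sum>m\<in>F. h m * Y m \<omega>)\<^sup>2)"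
      by (rule Bochner_Integration.integrable_bound[OF KS]) (use M CS K S0 in \<open>auto simp: abs_mult\<close>)
    have "(LINT \<omega>|M. (\<Sum>m\<in>F. h m * Y m \<omega>)\<^sup>2) \<le> (LINT \<omega>|M. K * S \<omega>)"
      using i2 KS CS by (rule integral_mono)
    also have "\<dots> \<le> P * K" using mult_left_mono[OF SE K] by (simp add: mult.commute)
    finally show ?thesis using i2 M by (simp add: sq_integrable_def K_def)
  qed
  with P show ?thesis unfolding weighted_l2_bound_def by blast
qed

section \<open>Square truncations of the spectrum and perturbation of quadratic sums\<close>

definition box :: "nat \<Rightarrow> (nat \<times> nat) set" where
  "box n = {1..n} \<times> {1..n}"

lemma finite_box: "finite (box n)" and box_subset: "box n \<subseteq> modes"
  by (auto simp: box_def modes_def)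

lemma sum_box: "(\<Sum>m\<in>box n. f m) = (\<Sum>l=1..n. \<Sum>k=1..n. f (k, l))"
  unfolding box_def by (subst sum.swap) (simp add: sum.cartesian_product)

text \<open>Squares eventually contain any finite set of modes, so the unordered series of the field
  may be followed along the squares for which the spectral sums are estimated.\<close>

lemma filterlim_box: "filterlim box (finite_subsets_at_top modes) sequentially"
  unfolding filterlim_finite_subsets_at_top
proof (intro allI impI)
  fix F :: "(nat \<times> nat) set" assume F: "finite F \<and> F \<subseteq> modes"
  define n0 where "n0 = Max (insert 0 (fst ` F \<union> snd ` F))"
  have le: "k \<le> n0" "l \<le> n0" if "(k, l) \<in> F" for k l
    unfolding n0_def using F that by (auto intro!: Max_ge rev_image_eqI)
  have "F \<subseteq> box n" if "n0 \<le> n" for n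
    using F le that by (fastforce simp: box_def modes_def)
  then show "\<forall>\<^sub>F n in sequentially. finite (box n) \<and> F \<subseteq> box n \<and> box n \<subseteq> modes"
    using finite_box box_subset by (intro eventually_sequentiallyI[of n0]) auto
qed

text \<open>Cauchy-Schwarz over the increments gives w^2 <= (A + f) b for the mixed term w, with u
  and v arbitrary. The coefficients 9, 12, 9 result from (A + 2w + b)^2 <= 3 A^2 + 12 w^2 + 3 b^2
  and 2 A b <= A^2 + b^2.\<close>

lemma perturbed_quadratic_form:
  fixes u v :: "'i \<Rightarrow> real" and S :: "'i set"
  assumes c: "0 \<le> c" and f: "0 \<le> f"
  defines "A \<equiv> c * (\<Sum>i\<in>S. (u i)\<^sup>2) - f" and "b \<equiv> c * (\<Sum>i\<in>S. (v i)\<^sup>2)"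
  shows "(c * (\<Sum>i\<in>S. (u i + v i)\<^sup>2) - f)\<^sup>2 \<le> 9 * A\<^sup>2 + 12 * f * b + 9 * b\<^sup>2"
proof -
  define w where "w = c * (\<Sum>i\<in>S. u i * v i)"
  have eq: "c * (\<Sum>i\<in>S. (u i + v i)\<^sup>2) - f = A + 2 * w + b"
    unfolding A_def b_def w_def
    by (simp add: power2_sum sum.distrib sum_distrib_left distrib_left mult_ac)
  have "w\<^sup>2 = c\<^sup>2 * (\<Sum>i\<in>S. u i * v i)\<^sup>2" by (simp add: w_def power_mult_distrib)
  also have "\<dots> \<le> c\<^sup>2 * ((\<Sum>i\<in>S. (u i)\<^sup>2) * (\<Sum>i\<in>S. (v i)\<^sup>2))"
    by (intro mult_left_mono Cauchy_Schwarz_ineq_sum) auto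
  also have "\<dots> = (A + f) * b" by (simp add: A_def b_def power2_eq_square)
  finally have w: "w\<^sup>2 \<le> A * b + f * b" by (simp add: distrib_right)
  have "2 * (A * b) \<le> A\<^sup>2 + b\<^sup>2" using sum_squares_bound[of A b] by simp
  moreover have "(A + 2 * w + b)\<^sup>2 \<le> 3 * A\<^sup>2 + 12 * w\<^sup>2 + 3 * b\<^sup>2"
  proof -
    have "0 \<le> (A - 2*w)\<^sup>2 + (2*w - b)\<^sup>2 + (b - A)\<^sup>2" by simp
    then show ?thesis by (simp add: power2_eq_square algebra_simps)
  qed
  ultimately show ?thesis unfolding eq using w by linarith
qed

lemma eigenval_eq:
  "eigenval (\<theta>0, \<theta>1, \<eta>1, \<theta>2) k l = quad_eigenval (pi\<^sup>2 * \<theta>2) (- \<theta>0 + (\<theta>1\<^sup>2 + \<eta>1\<^sup>2) / (4 * \<theta>2)) k l"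
  by (simp add: eigenval_def quad_eigenval_def)

lemma eigenfun_sq:
  "(eigenfun (\<theta>0, \<theta>1, \<eta>1, \<theta>2) k l (y, z))\<^sup>2
    = exp (- (\<theta>1 / \<theta>2 * y + \<eta>1 / \<theta>2 * z)) * (4 * (sin (pi * real k * y))\<^sup>2 * (sin (pi * real l * z))\<^sup>2)"
proof -
  have 1: "(exp (- (\<theta>1 / (2 * \<theta>2)) * y))\<^sup>2 = exp (- (\<theta>1 / \<theta>2 * y))" for \<theta>1 y :: real
    by (simp add: exp_double[symmetric])
  have 2: "exp (- (\<theta>1 / \<theta>2 * y + \<eta>1 / \<theta>2 * z)) = exp (- (\<theta>1 / \<theta>2 * y)) * exp (- (\<eta>1 / \<theta>2 * z))"
    by (simp add: exp_add[symmetric])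
  show ?thesis unfolding eigenfun_def prod.case power_mult_distrib 1 2 by (simp add: mult_ac)
qed

section \<open>Error of the rescaled quadratic variation\<close>

lemma inverse_nat_le_powr:
  assumes "1 \<le> N" "r < 1/2"
  shows "1 / real N \<le> real N powr (-2*r)"
proof -
  have "real N powr (-1) \<le> real N powr (-2*r)" using assms by (intro powr_mono) auto
  moreover have "real N powr (-1) = 1 / real N" using assms powr_minus_divide[of "real N" 1] by simp
  ultimately show ?thesis by (simp only:)
qed

text \<open>The parameter is fixed in components, and the alternatives for the initial condition are
  merged into \<open>initial\<close> with its constant P, so the estimates below are made once for
  both.\<close>

locale spde_field = prob_space M for M :: "'w measure" +
  fixes \<alpha> \<theta>0 \<theta>1 \<eta>1 \<theta>2 \<sigma> P :: real
    and w :: "nat \<Rightarrow> nat \<Rightarrow> real \<Rightarrow> 'w \<Rightarrow> real"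
    and \<xi> :: "'w \<Rightarrow> real \<times> real \<Rightarrow> real"
    and X :: "real \<Rightarrow> real \<times> real \<Rightarrow> 'w \<Rightarrow> real"
  assumes alpha: "0 < \<alpha>" "\<alpha> < 1" and theta2: "0 < \<theta>2"
    and eigenval_1_1: "0 < eigenval (\<theta>0, \<theta>1, \<eta>1, \<theta>2) 1 1"
    and noise: "independent_brownian_motions M w"
    and solution: "mild_solution M \<alpha> (\<theta>0, \<theta>1, \<eta>1, \<theta>2) \<sigma> w \<xi> X"
    and initial: "weighted_l2_bound M modes (\<lambda>m. eigenval (\<theta>0, \<theta>1, \<eta>1, \<theta>2) (fst m) (snd m) powr (1 + \<alpha>))
      (\<lambda>m \<omega>. fourier_coeff (\<theta>0, \<theta>1, \<eta>1, \<theta>2) (\<xi> \<omega>) (fst m) (snd m)) P"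
begin

definition lam :: "nat \<times> nat \<Rightarrow> real" where
  "lam m = eigenval (\<theta>0, \<theta>1, \<eta>1, \<theta>2) (fst m) (snd m)"

definition ef :: "nat \<times> nat \<Rightarrow> real \<times> real \<Rightarrow> real" where
  "ef m p = eigenfun (\<theta>0, \<theta>1, \<eta>1, \<theta>2) (fst m) (snd m) p"

definition fc :: "nat \<times> nat \<Rightarrow> 'w \<Rightarrow> real" where
  "fc m \<omega> = fourier_coeff (\<theta>0, \<theta>1, \<eta>1, \<theta>2) (\<xi> \<omega>) (fst m) (snd m)"

definition la :: real where "la = pi\<^sup>2 * \<theta>2"
definition lc :: real where "lc = - \<theta>0 + (\<theta>1\<^sup>2 + \<eta>1\<^sup>2) / (4 * \<theta>2)"

lemma lam_eq: "lam (k, l) = quad_eigenval la lc k l"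
  by (simp add: lam_def eigenval_eq la_def lc_def)

lemma la_pos: "0 < la" and la_lc: "0 < 2 * la + lc"
  using theta2 eigenval_1_1 by (simp_all add: la_def lc_def eigenval_eq quad_eigenval_def)

lemma lam_pos: "m \<in> modes \<Longrightarrow> 0 < lam m"
  using quad_eigenval_pos[OF la_pos la_lc] by (cases m) (auto simp: lam_eq modes_def)

sublocale bf: brownian_family M "\<lambda>m. w (fst m) (snd m)" modes
proof
  show "brownian_motion M (w (fst m) (snd m))" if "m \<in> modes" for m
    using noise that by (auto simp: independent_brownian_motions_def)
  have "(\<lambda>(k, l) \<omega>. \<lambda>t\<in>{0..}. w k l t \<omega>) = (\<lambda>m \<omega>. \<lambda>t\<in>{0..}. w (fst m) (snd m) t \<omega>)"
    by (rule ext) (simp add: split_beta)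
  then show "indep_vars (\<lambda>_. PiM {0..} (\<lambda>_. borel)) (\<lambda>m \<omega>. \<lambda>t\<in>{0..}. w (fst m) (snd m) t \<omega>) modes"
    using noise by (simp add: independent_brownian_motions_def)
qed

text \<open>Fixes a version J of every Wiener integral and the convergence of the field along boxes.
  The exceptional null set depends on mode and time; for given N and a given box finitely many of
  them occur.\<close>

definition coordinate_representation :: "(nat \<times> nat \<Rightarrow> real \<Rightarrow> 'w \<Rightarrow> real) \<Rightarrow> (nat \<times> nat \<Rightarrow> real \<Rightarrow> 'w \<Rightarrow> real) \<Rightarrow> bool" where
  "coordinate_representation x J \<longleftrightarrow>
     (\<forall>m\<in>modes. \<forall>t\<in>{0..1}. x m t \<in> borel_measurable M
        \<and> has_wiener_integral M (w (fst m) (snd m)) (\<lambda>s. exp (- lam m * (t - s))) t (J m t)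
        \<and> (AE \<omega> in M. x m t \<omega> = exp (- lam m * t) * fc m \<omega> + \<sigma> * lam m powr (- \<alpha> / 2) * J m t \<omega>))
   \<and> (\<forall>t\<in>{0..1}. \<forall>p\<in>unit_square. X t p \<in> borel_measurable M
        \<and> (\<lambda>n. \<integral>\<^sup>+\<omega>. ennreal ((X t p \<omega> - (\<Sum>m\<in>box n. x m t \<omega> * ef m p))\<^sup>2) \<partial>M) \<longlonglongrightarrow> 0)"

lemma coordinate_representation_exists: "\<exists>x J. coordinate_representation x J"
proof -
  obtain x' where x': "coordinate_processes M \<alpha> (\<theta>0, \<theta>1, \<eta>1, \<theta>2) \<sigma> w \<xi> x'"
    and conv: "\<forall>t\<in>{0..1}. \<forall>p\<in>unit_square. X t p \<in> borel_measurable M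
           \<and> ((\<lambda>F. \<integral>\<^sup>+\<omega>. ennreal ((X t p \<omega> - (\<Sum>(k, l)\<in>F. x' k l t \<omega> * eigenfun (\<theta>0, \<theta>1, \<eta>1, \<theta>2) k l p))\<^sup>2) \<partial>M) \<longlongrightarrow> 0)
               (finite_subsets_at_top modes)"
    using solution unfolding mild_solution_def by blast
  define x where "x m = x' (fst m) (snd m)" for m
  have *: "\<forall>m\<in>modes. \<forall>t\<in>{0..1}. x m t \<in> borel_measurable M \<and>
     (\<exists>I. has_wiener_integral M (w (fst m) (snd m)) (\<lambda>s. exp (- lam m * (t - s))) t I
       \<and> (AE \<omega> in M. x m t \<omega> = exp (- lam m * t) * fc m \<omega> + \<sigma> * lam m powr (- \<alpha> / 2) * I \<omega>))"
    using x' unfolding coordinate_processes_def x_def lam_def fc_def by (simp add: split_beta)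
  define J where "J m t = (SOME I. has_wiener_integral M (w (fst m) (snd m)) (\<lambda>s. exp (- lam m * (t - s))) t I
       \<and> (AE \<omega> in M. x m t \<omega> = exp (- lam m * t) * fc m \<omega> + \<sigma> * lam m powr (- \<alpha> / 2) * I \<omega>))" for m t
  have J: "has_wiener_integral M (w (fst m) (snd m)) (\<lambda>s. exp (- lam m * (t - s))) t (J m t)
       \<and> (AE \<omega> in M. x m t \<omega> = exp (- lam m * t) * fc m \<omega> + \<sigma> * lam m powr (- \<alpha> / 2) * J m t \<omega>)"
    if "m \<in> modes" "t \<in> {0..1}" for m t
  proof -
    have "\<exists>I. has_wiener_integral M (w (fst m) (snd m)) (\<lambda>s. exp (- lam m * (t - s))) t I
       \<and> (AE \<omega> in M. x m t \<omega> = exp (- lam m * t) * fc m \<omega> + \<sigma> * lam m powr (- \<alpha> / 2) * I \<omega>)"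
      using * that by blast
    from someI_ex[OF this] show ?thesis unfolding J_def .
  qed
  have lim: "(\<lambda>n. \<integral>\<^sup>+\<omega>. ennreal ((X t p \<omega> - (\<Sum>m\<in>box n. x m t \<omega> * ef m p))\<^sup>2) \<partial>M) \<longlonglongrightarrow> 0"
    if tp: "t \<in> {0..1}" "p \<in> unit_square" for t p
  proof -
    have "((\<lambda>F. \<integral>\<^sup>+\<omega>. ennreal ((X t p \<omega> - (\<Sum>m\<in>F. x m t \<omega> * ef m p))\<^sup>2) \<partial>M) \<longlongrightarrow> 0) (finite_subsets_at_top modes)"
      using conv tp unfolding x_def ef_def by (simp add: split_beta)
    from filterlim_compose[OF this filterlim_box] show ?thesis .
  qed
  have "coordinate_representation x J"
    unfolding coordinate_representation_def
  proof (intro conjI ballI)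
    fix m t assume mt: "m \<in> modes" "t \<in> {0..1::real}"
    show "x m t \<in> borel_measurable M" using *[rule_format, OF mt] by (rule conjunct1)
    show "has_wiener_integral M (w (fst m) (snd m)) (\<lambda>s. exp (- lam m * (t - s))) t (J m t)"
      using J[OF mt] by (rule conjunct1)
    show "AE \<omega> in M. x m t \<omega> = exp (- lam m * t) * fc m \<omega> + \<sigma> * lam m powr (- \<alpha> / 2) * J m t \<omega>"
      using J[OF mt] by (rule conjunct2)
  next
    fix t p assume tp: "t \<in> {0..1::real}" "p \<in> unit_square"
    show "X t p \<in> borel_measurable M" using conv[rule_format, OF tp] by (rule conjunct1)
    show "(\<lambda>n. \<integral>\<^sup>+\<omega>. ennreal ((X t p \<omega> - (\<Sum>m\<in>box n. x m t \<omega> * ef m p))\<^sup>2) \<partial>M) \<longlonglongrightarrow> 0"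
      by (rule lim[OF tp])
  qed
  then show ?thesis by (intro exI)
qed

definition amp :: "real \<times> real \<Rightarrow> real" where
  "amp p = exp (- (\<theta>1 / \<theta>2 * fst p + \<eta>1 / \<theta>2 * snd p))"

definition amp_max :: real where "amp_max = exp (\<bar>\<theta>1 / \<theta>2\<bar> + \<bar>\<eta>1 / \<theta>2\<bar>)"

lemma amp_le: "p \<in> unit_square \<Longrightarrow> amp p \<le> amp_max"
proof -
  assume p: "p \<in> unit_square"
  have 1: "- (a * u) \<le> \<bar>a\<bar>" if "0 \<le> u" "u \<le> 1" for a u :: real
  proof -
    have "- (a * u) \<le> \<bar>a\<bar> * \<bar>u\<bar>" by (simp add: abs_mult[symmetric])
    also have "\<dots> \<le> \<bar>a\<bar>" using that by (intro mult_left_le) auto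
    finally show ?thesis .
  qed
  show ?thesis
    using p 1[of "fst p" "\<theta>1 / \<theta>2"] 1[of "snd p" "\<eta>1 / \<theta>2"]
    unfolding amp_def amp_max_def by (auto simp: unit_square_def)
qed

lemma ef_sq: "(ef m p)\<^sup>2 = amp p * (4 * (sin (pi * real (fst m) * fst p))\<^sup>2 * (sin (pi * real (snd m) * snd p))\<^sup>2)"
  using eigenfun_sq[of \<theta>0 \<theta>1 \<eta>1 \<theta>2 "fst m" "snd m" "fst p" "snd p"] by (simp add: ef_def amp_def)

lemma ef_sq_le: "p \<in> unit_square \<Longrightarrow> (ef m p)\<^sup>2 \<le> 4 * amp_max"
proof -
  assume p: "p \<in> unit_square"
  have "(sin u)\<^sup>2 \<le> 1" for u :: real by (simp add: abs_square_le_1)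
  then have "(sin (pi * real (fst m) * fst p))\<^sup>2 * (sin (pi * real (snd m) * snd p))\<^sup>2 \<le> 1 * 1"
    by (intro mult_mono) auto
  then have "(ef m p)\<^sup>2 \<le> amp p * (4 * 1)"
    unfolding ef_sq by (intro mult_left_mono) (auto simp: amp_def)
  with amp_le[OF p] show ?thesis by simp
qed

lemma sum_kern_box_le:
  "\<exists>C\<ge>0. \<forall>D. 0 < D \<longrightarrow> D \<le> 1 \<longrightarrow> (\<forall>n. (\<Sum>m\<in>box n. kern \<alpha> D (lam m)) \<le> C * D powr \<alpha>)"
  using sum_kern_le[OF la_pos la_lc alpha] by (simp add: sum_box lam_eq)

text \<open>Up to sign, the initial part of a mode moves in step i by the factor (1 - q) q^(i-1),
  and the squares of these factors sum to at most 1 - q. With the weight lam^(-1-\<alpha>) this is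
  the kernel again: all N increments together are bounded by a single kernel sum, not by N of
  them.\<close>

lemma initial_increment_bound:
  assumes N: "1 \<le> N" and p: "p \<in> unit_square" and F: "finite F" "F \<subseteq> modes"
  defines "Dx \<equiv> \<lambda>i \<omega>. \<Sum>m\<in>F. ((exp (- lam m * (real i / real N)) - exp (- lam m * (real (i - 1) / real N))) * ef m p) * fc m \<omega>"
  shows "sq_integrable M (Dx i)"
    and "(\<Sum>i=1..N. expectation (\<lambda>\<omega>. (Dx i \<omega>)\<^sup>2)) \<le> P * (4 * amp_max) * (\<Sum>m\<in>F. kern \<alpha> (1 / real N) (lam m))"
proof -
  define h where "h i m = (exp (- lam m * (real i / real N)) - exp (- lam m * (real (i - 1) / real N))) * ef m p" for i m
  have P: "0 \<le> P" using initial by (simp add: weighted_l2_bound_def)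
  have I: "sq_integrable M (Dx i) \<and> expectation (\<lambda>\<omega>. (Dx i \<omega>)\<^sup>2) \<le> P * (\<Sum>m\<in>F. (h i m)\<^sup>2 / lam m powr (1 + \<alpha>))" for i
    using initial[unfolded weighted_l2_bound_def, THEN conjunct2, rule_format, OF F, of "h i"]
    unfolding Dx_def h_def lam_def fc_def .
  then show "sq_integrable M (Dx i)" by blast
  have hs: "(\<Sum>i=1..N. (h i m)\<^sup>2) \<le> 4 * amp_max * (1 - exp (-(lam m * (1 / real N))))" if m: "m \<in> F" for m
  proof -
    define q where "q = exp (-(lam m * (1 / real N)))"
    have lp: "0 < lam m" by (rule lam_pos) (use F m in blast)
    then have q: "0 \<le> q" "q \<le> 1" by (auto simp: q_def)
    have qi: "exp (- lam m * (real i / real N)) = q ^ i" for i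
      unfolding q_def exp_of_nat_mult[symmetric] by simp
    have "(\<Sum>i=1..N. (h i m)\<^sup>2) = (\<Sum>i<N. (h (Suc i) m)\<^sup>2)" by (simp add: sum.atLeast1_atMost_eq)
    also have "\<dots> = (\<Sum>i<N. ((1 - q)\<^sup>2 * q ^ (2*i)) * (ef m p)\<^sup>2)"
    proof (intro sum.cong refl)
      fix i
      have "h (Suc i) m = - ((1 - q) * q ^ i) * ef m p"
        unfolding h_def qi by (simp add: left_diff_distrib)
      moreover have "(q ^ i)\<^sup>2 = q ^ (2*i)" by (simp add: power_mult[symmetric] mult.commute)
      ultimately show "(h (Suc i) m)\<^sup>2 = ((1 - q)\<^sup>2 * q ^ (2*i)) * (ef m p)\<^sup>2"
        by (simp only: power_mult_distrib power2_minus)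
    qed
    also have "\<dots> = (\<Sum>i<N. (1 - q)\<^sup>2 * q ^ (2*i)) * (ef m p)\<^sup>2" by (simp add: sum_distrib_right)
    also have "\<dots> \<le> (1 - q) * (4 * amp_max)"
      using sum_sq_geometric_le[OF q] ef_sq_le[OF p] q by (intro mult_mono) auto
    finally show ?thesis by (simp add: q_def mult.commute)
  qed
  have "(\<Sum>i=1..N. expectation (\<lambda>\<omega>. (Dx i \<omega>)\<^sup>2)) \<le> (\<Sum>i=1..N. P * (\<Sum>m\<in>F. (h i m)\<^sup>2 / lam m powr (1 + \<alpha>)))"
    using I by (intro sum_mono) blast
  also have "\<dots> = P * (\<Sum>m\<in>F. (\<Sum>i=1..N. (h i m)\<^sup>2) / lam m powr (1 + \<alpha>))"
    unfolding sum_distrib_left[symmetric] sum_divide_distrib by (subst sum.swap) (rule refl)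
  also have "\<dots> \<le> P * (\<Sum>m\<in>F. 4 * amp_max * (1 - exp (-(lam m * (1 / real N)))) / lam m powr (1 + \<alpha>))"
    using hs P by (intro mult_left_mono sum_mono divide_right_mono) auto
  also have "(\<Sum>m\<in>F. 4 * amp_max * (1 - exp (-(lam m * (1 / real N)))) / lam m powr (1 + \<alpha>))
     = 4 * amp_max * (\<Sum>m\<in>F. kern \<alpha> (1 / real N) (lam m))"
    unfolding sum_distrib_left
  proof (intro sum.cong refl)
    fix m assume "m \<in> F"
    have "lam m powr (-1 - \<alpha>) = lam m powr (-(1 + \<alpha>))" by (rule arg_cong[where f = "\<lambda>a. lam m powr a"]) simp
    also have "\<dots> = 1 / lam m powr (1 + \<alpha>)" by (rule powr_minus_divide)
    finally have e: "lam m powr (-1 - \<alpha>) = 1 / lam m powr (1 + \<alpha>)" .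
    show "4 * amp_max * (1 - exp (-(lam m * (1 / real N)))) / lam m powr (1 + \<alpha>) = 4 * amp_max * kern \<alpha> (1 / real N) (lam m)"
      unfolding kern_def e by simp
  qed
  finally show "(\<Sum>i=1..N. expectation (\<lambda>\<omega>. (Dx i \<omega>)\<^sup>2)) \<le> P * (4 * amp_max) * (\<Sum>m\<in>F. kern \<alpha> (1 / real N) (lam m))"
    by (simp add: mult.assoc)
qed

definition limit_Z :: "real \<times> real \<Rightarrow> real" where
  "limit_Z p = Gamma (1 - \<alpha>) / (4 * pi * \<alpha>) * (\<sigma>\<^sup>2 / \<theta>2) * amp p"

text \<open>With la = pi^2 \<theta>2 the factor pi / (4 la) is 1 / (4 pi \<theta>2), which
  reconciles the constant of the contrast with that of the spectral integral.\<close>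

lemma limit_Z_eq: "limit_Z p = \<sigma>\<^sup>2 * amp p * (Gamma (1 - \<alpha>) * pi / (4 * la * \<alpha>))"
  using theta2 alpha by (simp add: limit_Z_def la_def power2_eq_square field_simps)

lemma limit_Z_nonneg: "0 \<le> limit_Z p"
  using alpha theta2 by (simp add: limit_Z_def amp_def Gamma_real_nonneg)

text \<open>The squared amplitude lam^(-\<alpha>) and the factor 1 / lam of the increment variance
  combine to the power in \<open>kern\<close>.\<close>

lemma noise_coefficient:
  assumes "m \<in> modes"
  shows "(\<sigma> * lam m powr (- \<alpha> / 2) * ef m p)\<^sup>2 * ((1 - exp (-(lam m / real N))) / lam m)
    = \<sigma>\<^sup>2 * (ef m p)\<^sup>2 * kern \<alpha> (1 / real N) (lam m)"
proof -
  have l: "0 < lam m" by (rule lam_pos[OF assms])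
  have 1: "(lam m powr (- \<alpha> / 2))\<^sup>2 = lam m powr (-\<alpha>)"
    by (simp add: power2_eq_square powr_add[symmetric])
  have 2: "lam m powr (-\<alpha>) = lam m * lam m powr (-1-\<alpha>)"
    using powr_mult_base[of "lam m" "-1-\<alpha>"] l by simp
  show ?thesis unfolding power_mult_distrib 1 2 kern_def using l by simp
qed

text \<open>\<open>A\<close> is the error of the rescaled quadratic variation of the noise part and \<open>b\<close> the rescaled
  quadratic variation of everything else, namely of the contribution of the initial condition and
  of the tail of the series after truncation to a large box.\<close>

lemma realized_Z_error:
  assumes r: "0 < r" "r < 1/2" "r \<le> 1 - \<alpha>" and d: "0 < \<delta>" "\<delta> < 1/2"
  shows "\<exists>C\<ge>0. \<forall>N\<ge>1. \<forall>y\<in>{\<delta>..1-\<delta>}. \<forall>z\<in>{\<delta>..1-\<delta>}. \<exists>A b.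
     integrable M (\<lambda>\<omega>. (A \<omega>)\<^sup>2) \<and> expectation (\<lambda>\<omega>. (A \<omega>)\<^sup>2) \<le> C * real N powr (-2*r) \<and>
     integrable M b \<and> (\<forall>\<omega>. 0 \<le> b \<omega>) \<and> expectation b \<le> C / real N \<and>
     (AE \<omega> in M. (realized_Z \<alpha> X N (y, z) \<omega> - limit_Z (y, z))\<^sup>2 \<le> C * ((A \<omega>)\<^sup>2 + b \<omega> + (b \<omega>)\<^sup>2))"
proof -
  obtain x J where "coordinate_representation x J"
    using coordinate_representation_exists by (elim exE)
  then have x: "x m t \<in> borel_measurable M"
    and J: "has_wiener_integral M (w (fst m) (snd m)) (\<lambda>s. exp (- lam m * (t - s))) t (J m t)"
    and xJ: "AE \<omega> in M. x m t \<omega> = exp (- lam m * t) * fc m \<omega> + \<sigma> * lam m powr (- \<alpha> / 2) * J m t \<omega>"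
    and XM': "p \<in> unit_square \<Longrightarrow> X t p \<in> borel_measurable M"
    and Xlim': "p \<in> unit_square \<Longrightarrow> (\<lambda>n. \<integral>\<^sup>+\<omega>. ennreal ((X t p \<omega> - (\<Sum>m\<in>box n. x m t \<omega> * ef m p))\<^sup>2) \<partial>M) \<longlonglongrightarrow> 0"
    if "m \<in> modes" "t \<in> {0..1}" for m t p
    using that by (simp_all only: coordinate_representation_def)
  \<comment> \<open>The facts on the field were obtained under the premise of some mode; the mode
    (1, 1) detaches them from it.\<close>
  have "(1, 1) \<in> modes" by (simp add: modes_def)
  note XM = XM'[OF this] and Xlim = Xlim'[OF this]
  define G where "G = Gamma (1 - \<alpha>) * pi / (4 * la * \<alpha>)"
  have G0: "0 \<le> G" using alpha la_pos by (simp add: G_def Gamma_real_nonneg)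
  have b: "\<alpha> < \<alpha> + r" "\<alpha> + r \<le> 1" "\<alpha> + r < \<alpha> + 1/2" using r by auto
  obtain C1 where C1: "0 \<le> C1" and C1': "\<And>D y z. 0 < D \<Longrightarrow> D \<le> 1 \<Longrightarrow> y \<in> {\<delta>..1-\<delta>} \<Longrightarrow> z \<in> {\<delta>..1-\<delta>} \<Longrightarrow>
    (\<forall>\<^sub>F n in sequentially.
      \<bar>(\<Sum>l=1..n. \<Sum>k=1..n. kern \<alpha> D (quad_eigenval la lc k l) * (4 * (sin (pi * real k * y))\<^sup>2 * (sin (pi * real l * z))\<^sup>2))
        - D powr \<alpha> * Gamma (1 - \<alpha>) * pi / (4 * la * \<alpha>)\<bar> \<le> C1 * D powr (\<alpha> + r))"
    using sum_kern_sin_sq[OF la_pos la_lc alpha b d] by blast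
  obtain C2 where C2: "0 \<le> C2" and C2': "\<And>D n. 0 < D \<Longrightarrow> D \<le> 1 \<Longrightarrow> (\<Sum>m\<in>box n. kern \<alpha> D (lam m)) \<le> C2 * D powr \<alpha>"
    using sum_kern_box_le by blast
  have P: "0 \<le> P" using initial by (simp add: weighted_l2_bound_def)
  have am: "0 < amp_max" by (simp add: amp_max_def)
  \<comment> \<open>\<open>Cs\<close> bounds N^\<alpha> S. \<open>CA\<close> is 2 times 18 Cs^2 for
    the fluctuation plus twice the squared bias constant, \<open>Cb\<close> collects the initial
    condition and the tail, and \<open>Cf\<close> dominates the coefficients 9, 12 f and 9 of
    \<open>perturbed_quadratic_form\<close>.\<close>
  define Cs where "Cs = \<sigma>\<^sup>2 * (4 * amp_max) * C2"
  define CA where "CA = 36 * Cs\<^sup>2 + 2 * (\<sigma>\<^sup>2 * amp_max * C1)\<^sup>2"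
  define Cb where "Cb = 8 * P * amp_max * C2 + 8"
  define Cf where "Cf = 9 + 12 * (\<sigma>\<^sup>2 * amp_max * G)"
  have Cnn: "0 \<le> Cs" "0 \<le> CA" "0 \<le> Cb" "9 \<le> Cf" using am C1 C2 P G0 by (auto simp: Cs_def CA_def Cb_def Cf_def)
  show ?thesis
  proof (intro exI[of _ "CA + Cb + Cf"] conjI allI impI ballI)
    show "0 \<le> CA + Cb + Cf" using Cnn by simp
    fix N :: nat and y z :: real
    assume N: "1 \<le> N" and y: "y \<in> {\<delta>..1-\<delta>}" and z: "z \<in> {\<delta>..1-\<delta>}"
    define p where "p = (y, z)"
    have p: "p \<in> unit_square" using y z d by (auto simp: p_def unit_square_def)
    define D where "D = 1 / real N"
    have D: "0 < D" "D \<le> 1" using N by (auto simp: D_def)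
    define Na where "Na = real N powr \<alpha>"
    have Na: "0 < Na" using N by (simp add: Na_def)
    have DNa: "D powr \<alpha> = 1 / Na" using N by (simp add: D_def Na_def powr_divide)
    have NaN: "Na \<le> real N"
      using powr_mono[of \<alpha> 1 "real N"] N alpha by (simp add: Na_def)
    define tt where "tt i = real i / real N" for i
    have tt: "tt i \<in> {0..1}" if "i \<le> N" for i using that N by (auto simp: tt_def)
    \<comment> \<open>With a truncation error below 1/N^2 at each observation time, the tail
      contributes at most 8/N^2 per increment and 8/N in total.\<close>
    have ev: "\<forall>\<^sub>F n in sequentially. \<forall>i\<in>{..N}.
      (\<integral>\<^sup>+\<omega>. ennreal ((X (tt i) p \<omega> - (\<Sum>m\<in>box n. x m (tt i) \<omega> * ef m p))\<^sup>2) \<partial>M) < ennreal (1 / (real N)\<^sup>2)"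
    proof (intro eventually_ball_finite ballI finite_atMost)
      fix i assume "i \<in> {..N}"
      then have "tt i \<in> {0..1}" by (intro tt) simp
      then show "\<forall>\<^sub>F n in sequentially.
        (\<integral>\<^sup>+\<omega>. ennreal ((X (tt i) p \<omega> - (\<Sum>m\<in>box n. x m (tt i) \<omega> * ef m p))\<^sup>2) \<partial>M) < ennreal (1 / (real N)\<^sup>2)"
        using N by (intro order_tendstoD(2)[OF Xlim[OF _ p]]) auto
    qed
    \<comment> \<open>One n serves the tail at all observation times and the bias at (y, z). It
      depends on N and on the point, but the constants fixed above do not depend on it.\<close>
    from eventually_happens[OF eventually_conj[OF ev C1'[OF D y z]]]
    obtain n where small: "\<And>i. i \<le> N \<Longrightarrow>
        (\<integral>\<^sup>+\<omega>. ennreal ((X (tt i) p \<omega> - (\<Sum>m\<in>box n. x m (tt i) \<omega> * ef m p))\<^sup>2) \<partial>M) < ennreal (1 / (real N)\<^sup>2)"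
      and bias: "\<bar>(\<Sum>l=1..n. \<Sum>k=1..n. kern \<alpha> D (quad_eigenval la lc k l) * (4 * (sin (pi * real k * y))\<^sup>2 * (sin (pi * real l * z))\<^sup>2))
        - D powr \<alpha> * Gamma (1 - \<alpha>) * pi / (4 * la * \<alpha>)\<bar> \<le> C1 * D powr (\<alpha> + r)"
      by auto
    define F where "F = box n"
    have F: "finite F" "F \<subseteq> modes" unfolding F_def by (rule finite_box, rule box_subset)
    define K where "K = (\<Sum>m\<in>F. kern \<alpha> D (lam m))"
    have K: "K \<le> C2 / Na" using C2'[OF D, of n] by (simp add: K_def F_def DNa)
    have kern0: "0 \<le> kern \<alpha> D (lam m)" if "m \<in> F" for m
      using lam_pos[of m] that F D by (intro kern_nonneg) auto
    have K0: "0 \<le> K" unfolding K_def using kern0 by (intro sum_nonneg) auto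
    define bc where "bc m = \<sigma> * lam m powr (- \<alpha> / 2) * ef m p" for m
    define B where "B i \<omega> = (\<Sum>m\<in>F. bc m * (J m (real i / real N) \<omega> - J m (real (i - 1) / real N) \<omega>))" for i \<omega>
    define S where "S = (\<Sum>m\<in>F. (bc m)\<^sup>2 * ((1 - exp (-(lam m / real N))) / lam m))"
    have lamF: "0 < lam m" if "m \<in> F" for m by (rule lam_pos) (use that F in blast)
    have JF: "has_wiener_integral M (w (fst m) (snd m)) (\<lambda>u. exp (- lam m * (t - u))) t (J m t)"
      if "m \<in> F" "t \<in> {0..1}" for m t
      by (rule J) (use that F in blast)+
    note QV = bf.noise_quadratic_variation[where lam = lam and J = J and b = bc and N = N, OF F lamF N JF, folded B_def S_def]
    have S_eq: "S = (\<Sum>m\<in>F. \<sigma>\<^sup>2 * (ef m p)\<^sup>2 * kern \<alpha> D (lam m))"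
      unfolding S_def bc_def D_def using F by (intro sum.cong refl noise_coefficient) auto
    have S0: "0 \<le> S" unfolding S_eq using kern0 by (intro sum_nonneg mult_nonneg_nonneg) auto
    have S_le: "S \<le> Cs / Na"
    proof -
      have "S \<le> (\<Sum>m\<in>F. \<sigma>\<^sup>2 * (4 * amp_max) * kern \<alpha> D (lam m))"
        unfolding S_eq using kern0 ef_sq_le[OF p] by (intro sum_mono mult_right_mono mult_left_mono) auto
      also have "\<dots> = \<sigma>\<^sup>2 * (4 * amp_max) * K" by (simp add: K_def sum_distrib_left)
      also have "\<dots> \<le> \<sigma>\<^sup>2 * (4 * amp_max) * (C2 / Na)" using K am by (intro mult_left_mono) auto
      finally show ?thesis by (simp add: Cs_def)
    qed
    define f where "f = limit_Z p"
    have f: "0 \<le> f" "f = \<sigma>\<^sup>2 * amp p * G"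
      unfolding f_def G_def by (rule limit_Z_nonneg, rule limit_Z_eq)
    have f_le: "f \<le> \<sigma>\<^sup>2 * amp_max * G"
      unfolding f(2) using amp_le[OF p] G0 by (intro mult_right_mono mult_left_mono) auto
    \<comment> \<open>The bias: the error D^(\<alpha>+r) of the spectral sum leaves D^r after
      multiplication by N^\<alpha>.\<close>
    have Sf: "\<bar>Na * S - f\<bar> \<le> \<sigma>\<^sup>2 * amp_max * C1 * D powr r"
    proof -
      let ?T = "\<Sum>l=1..n. \<Sum>k=1..n. kern \<alpha> D (quad_eigenval la lc k l) * (4 * (sin (pi * real k * y))\<^sup>2 * (sin (pi * real l * z))\<^sup>2)"
      have "S = \<sigma>\<^sup>2 * amp p * ?T"
        unfolding S_eq F_def sum_box ef_sq p_def sum_distrib_left lam_eq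
        by (intro sum.cong refl) (simp add: mult_ac)
      then have "Na * S - f = Na * (\<sigma>\<^sup>2 * amp p) * (?T - D powr \<alpha> * G)"
        unfolding f(2) DNa using Na by (simp add: field_simps)
      then have "\<bar>Na * S - f\<bar> = Na * (\<sigma>\<^sup>2 * amp p) * \<bar>?T - D powr \<alpha> * G\<bar>"
        using Na by (simp add: abs_mult amp_def)
      also have "\<dots> \<le> Na * (\<sigma>\<^sup>2 * amp_max) * (C1 * D powr (\<alpha> + r))"
        using bias Na amp_le[OF p] C1 am unfolding G_def
        by (intro mult_mono mult_left_mono) (auto simp: mult.assoc amp_def)
      also have "\<dots> = \<sigma>\<^sup>2 * amp_max * C1 * D powr r"
        using Na by (simp add: powr_add DNa)
      finally show ?thesis .
    qed
    define R where "R i \<omega> = X (tt i) p \<omega> - (\<Sum>m\<in>F. x m (tt i) \<omega> * ef m p)" for i \<omega>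
    have R: "sq_integrable M (R i)" "expectation (\<lambda>\<omega>. (R i \<omega>)\<^sup>2) \<le> 1 / (real N)\<^sup>2" if i: "i \<le> N" for i
    proof -
      have [measurable]: "R i \<in> borel_measurable M"
        unfolding R_def[abs_def] using F x tt[OF i] XM[OF tt[OF i] p]
        by (intro borel_measurable_diff borel_measurable_sum borel_measurable_times borel_measurable_const) auto
      have le: "(\<integral>\<^sup>+\<omega>. ennreal ((R i \<omega>)\<^sup>2) \<partial>M) < ennreal (1 / (real N)\<^sup>2)"
        unfolding R_def F_def by (rule small[OF i])
      then have "(\<integral>\<^sup>+\<omega>. ennreal ((R i \<omega>)\<^sup>2) \<partial>M) < \<infinity>" by (rule less_trans) simp
      then have int: "integrable M (\<lambda>\<omega>. (R i \<omega>)\<^sup>2)" by (intro integrableI_nonneg) auto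
      then show "sq_integrable M (R i)" by (simp add: sq_integrable_def)
      have "(\<integral>\<^sup>+\<omega>. ennreal ((R i \<omega>)\<^sup>2) \<partial>M) = ennreal (expectation (\<lambda>\<omega>. (R i \<omega>)\<^sup>2))"
        using int by (intro nn_integral_eq_integral) auto
      with le have "ennreal (expectation (\<lambda>\<omega>. (R i \<omega>)\<^sup>2)) < ennreal (1 / (real N)\<^sup>2)" by (simp only:)
      then show "expectation (\<lambda>\<omega>. (R i \<omega>)\<^sup>2) \<le> 1 / (real N)\<^sup>2" by (subst (asm) ennreal_less_iff) auto
    qed
    define Dx where "Dx i \<omega> = (\<Sum>m\<in>F. ((exp (- lam m * (real i / real N)) - exp (- lam m * (real (i - 1) / real N))) * ef m p) * fc m \<omega>)" for i \<omega>
    note DX = initial_increment_bound[OF N p F, folded Dx_def]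
    define E where "E i \<omega> = Dx i \<omega> + (R i \<omega> - R (i - 1) \<omega>)" for i \<omega>
    have Esq: "sq_integrable M (E i)" if "i \<in> {1..N}" for i
      unfolding E_def[abs_def] using that by (intro sq_integrable_add sq_integrable_diff DX(1) R(1)) auto
    have EE: "(\<Sum>i=1..N. expectation (\<lambda>\<omega>. (E i \<omega>)\<^sup>2)) \<le> (8 * P * amp_max * C2 + 8) / Na"
    proof -
      have "expectation (\<lambda>\<omega>. (E i \<omega>)\<^sup>2) \<le> 2 * expectation (\<lambda>\<omega>. (Dx i \<omega>)\<^sup>2) + 8 / (real N)\<^sup>2" if i: "i \<in> {1..N}" for i
      proof -
        have i': "i \<le> N" "i - 1 \<le> N" using i by auto
        note int = sq_integrableD[OF Esq[OF i]] sq_integrableD[OF DX(1), of i] sq_integrableD[OF R(1)[OF i'(1)]] sq_integrableD[OF R(1)[OF i'(2)]]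
        have "(E i \<omega>)\<^sup>2 \<le> 2 * (Dx i \<omega>)\<^sup>2 + 4 * (R i \<omega>)\<^sup>2 + 4 * (R (i - 1) \<omega>)\<^sup>2" for \<omega>
        proof -
          have "0 \<le> (Dx i \<omega> - (R i \<omega> - R (i - 1) \<omega>))\<^sup>2 + 2 * (R i \<omega> + R (i - 1) \<omega>)\<^sup>2" by simp
          then show ?thesis unfolding E_def by (simp add: power2_eq_square algebra_simps)
        qed
        then have "expectation (\<lambda>\<omega>. (E i \<omega>)\<^sup>2) \<le> expectation (\<lambda>\<omega>. 2 * (Dx i \<omega>)\<^sup>2 + 4 * (R i \<omega>)\<^sup>2 + 4 * (R (i - 1) \<omega>)\<^sup>2)"
          using int by (intro integral_mono) auto
        also have "\<dots> = 2 * expectation (\<lambda>\<omega>. (Dx i \<omega>)\<^sup>2) + 4 * expectation (\<lambda>\<omega>. (R i \<omega>)\<^sup>2) + 4 * expectation (\<lambda>\<omega>. (R (i - 1) \<omega>)\<^sup>2)"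
          using int by simp
        finally show ?thesis using R(2)[OF i'(1)] R(2)[OF i'(2)] by simp
      qed
      then have "(\<Sum>i=1..N. expectation (\<lambda>\<omega>. (E i \<omega>)\<^sup>2)) \<le> (\<Sum>i=1..N. 2 * expectation (\<lambda>\<omega>. (Dx i \<omega>)\<^sup>2) + 8 / (real N)\<^sup>2)"
        by (intro sum_mono) auto
      also have "\<dots> = 2 * (\<Sum>i=1..N. expectation (\<lambda>\<omega>. (Dx i \<omega>)\<^sup>2)) + 8 / real N"
        using N by (simp add: sum.distrib sum_distrib_left[symmetric] power2_eq_square)
      also have "\<dots> \<le> 2 * (P * (4 * amp_max) * (C2 / Na)) + 8 / Na"
      proof -
        have "(\<Sum>i=1..N. expectation (\<lambda>\<omega>. (Dx i \<omega>)\<^sup>2)) \<le> P * (4 * amp_max) * K"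
          using DX(2) by (simp add: K_def D_def)
        also have "\<dots> \<le> P * (4 * amp_max) * (C2 / Na)" using K P am by (intro mult_left_mono) auto
        finally have 1: "(\<Sum>i=1..N. expectation (\<lambda>\<omega>. (Dx i \<omega>)\<^sup>2)) \<le> P * (4 * amp_max) * (C2 / Na)" .
        have "8 / real N \<le> 8 / Na" using NaN Na by (intro divide_left_mono) auto
        with 1 show ?thesis by linarith
      qed
      also have "\<dots> = (8 * P * amp_max * C2 + 8) / Na" by (simp add: add_divide_distrib)
      finally show ?thesis .
    qed
    define cN where "cN = Na / real N"
    have cN: "0 < cN" using Na N by (simp add: cN_def)
    have cN_eq: "1 / (real N * (1 / real N) powr \<alpha>) = cN"
      using DNa N Na by (simp add: cN_def D_def field_simps)
    define A where "A \<omega> = cN * (\<Sum>i=1..N. (B i \<omega>)\<^sup>2) - f" for \<omega>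
    define bb where "bb \<omega> = cN * (\<Sum>i=1..N. (E i \<omega>)\<^sup>2)" for \<omega>
    have bint: "integrable M bb"
      unfolding bb_def[abs_def] using Esq by (intro integrable_mult_right Bochner_Integration.integrable_sum) (auto intro: sq_integrableD)
    have b0: "0 \<le> bb \<omega>" for \<omega> unfolding bb_def using cN by (intro mult_nonneg_nonneg sum_nonneg) auto
    have bE: "expectation bb \<le> Cb / real N"
    proof -
      have "expectation bb = cN * (\<Sum>i=1..N. expectation (\<lambda>\<omega>. (E i \<omega>)\<^sup>2))"
        unfolding bb_def[abs_def] using Esq by (simp add: Bochner_Integration.integral_sum sq_integrableD)
      also have "\<dots> \<le> cN * (Cb / Na)" using EE cN unfolding Cb_def by (intro mult_left_mono) auto
      also have "\<dots> = Cb / real N" using Na by (simp add: cN_def)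
      finally show ?thesis .
    qed
    \<comment> \<open>The error A splits into the fluctuation Q about N S, rescaled by
      \<open>cN\<close>, and the deterministic bias Na S - f.\<close>
    define Q where "Q \<omega> = (\<Sum>i=1..N. (B i \<omega>)\<^sup>2) - real N * S" for \<omega>
    have A_eq: "A \<omega> = cN * Q \<omega> + (Na * S - f)" for \<omega>
      unfolding A_def Q_def cN_def using N by (simp add: field_simps)
    have Q: "integrable M (\<lambda>\<omega>. (Q \<omega>)\<^sup>2)" "expectation (\<lambda>\<omega>. (Q \<omega>)\<^sup>2) \<le> 18 * real N * S\<^sup>2"
      using QV(2,3) unfolding Q_def by auto
    have A_le: "(A \<omega>)\<^sup>2 \<le> 2 * cN\<^sup>2 * (Q \<omega>)\<^sup>2 + 2 * (Na * S - f)\<^sup>2" for \<omega>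
    proof -
      have "(u + v)\<^sup>2 \<le> 2 * u\<^sup>2 + 2 * v\<^sup>2" for u v :: real
        using zero_le_power2[of "u - v"] by (simp add: power2_sum power2_diff)
      from this[of "cN * Q \<omega>" "Na * S - f"] show ?thesis
        unfolding A_eq by (simp add: power_mult_distrib mult.assoc)
    qed
    have QM: "Q \<in> borel_measurable M"
      unfolding Q_def[abs_def] using QV(1)
      by (intro borel_measurable_diff borel_measurable_sum borel_measurable_power borel_measurable_const) (auto simp: sq_integrable_def)
    have AM: "A \<in> borel_measurable M" unfolding A_eq[abs_def] using QM by measurable
    have Qint: "integrable M (\<lambda>\<omega>. 2 * cN\<^sup>2 * (Q \<omega>)\<^sup>2 + 2 * (Na * S - f)\<^sup>2)" using Q(1) by simp
    have Aint: "integrable M (\<lambda>\<omega>. (A \<omega>)\<^sup>2)"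
      by (rule Bochner_Integration.integrable_bound[OF Qint]) (use AM A_le in \<open>auto intro!: order_trans[OF A_le]\<close>)
    have AE_: "expectation (\<lambda>\<omega>. (A \<omega>)\<^sup>2) \<le> CA * real N powr (-2*r)"
    proof -
      have Dr: "(D powr r)\<^sup>2 = real N powr (-2*r)"
      proof -
        have "D powr r = real N powr (-r)" using N by (simp add: D_def powr_divide powr_minus_divide)
        then have "(D powr r)\<^sup>2 = real N powr (-r) * real N powr (-r)" by (simp only: power2_eq_square)
        also have "\<dots> = real N powr (-2*r)" unfolding powr_add[symmetric] by simp
        finally show ?thesis .
      qed
      \<comment> \<open>The second moment of the rescaled fluctuation is of order 1/N; by r < 1/2 it
        is absorbed into the squared bias of order N^(-2r).\<close>
      have N1: "1 / real N \<le> real N powr (-2*r)"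
        by (rule inverse_nat_le_powr[OF N r(2)])
      have "expectation (\<lambda>\<omega>. (A \<omega>)\<^sup>2) \<le> expectation (\<lambda>\<omega>. 2 * cN\<^sup>2 * (Q \<omega>)\<^sup>2 + 2 * (Na * S - f)\<^sup>2)"
        using Aint Qint A_le by (rule integral_mono)
      also have "\<dots> = 2 * cN\<^sup>2 * expectation (\<lambda>\<omega>. (Q \<omega>)\<^sup>2) + 2 * (Na * S - f)\<^sup>2"
        using Q(1) prob_space by simp
      also have "\<dots> \<le> 2 * cN\<^sup>2 * (18 * real N * (Cs / Na)\<^sup>2) + 2 * (\<sigma>\<^sup>2 * amp_max * C1 * D powr r)\<^sup>2"
      proof (intro add_mono mult_left_mono)
        have "18 * real N * S\<^sup>2 \<le> 18 * real N * (Cs / Na)\<^sup>2"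
          using S_le S0 by (intro mult_left_mono power_mono) auto
        with Q(2) show "expectation (\<lambda>\<omega>. (Q \<omega>)\<^sup>2) \<le> 18 * real N * (Cs / Na)\<^sup>2" by linarith
        show "(Na * S - f)\<^sup>2 \<le> (\<sigma>\<^sup>2 * amp_max * C1 * D powr r)\<^sup>2"
          using power_mono[OF Sf, of 2] by simp
      qed auto
      finally have 1: "expectation (\<lambda>\<omega>. (A \<omega>)\<^sup>2)
        \<le> 2 * cN\<^sup>2 * (18 * real N * (Cs / Na)\<^sup>2) + 2 * (\<sigma>\<^sup>2 * amp_max * C1 * D powr r)\<^sup>2" .
      have 2: "2 * cN\<^sup>2 * (18 * real N * (Cs / Na)\<^sup>2) = 36 * Cs\<^sup>2 * (1 / real N)"
        unfolding cN_def using Na N by (simp add: power2_eq_square)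
      have 3: "(\<sigma>\<^sup>2 * amp_max * C1 * D powr r)\<^sup>2 = (\<sigma>\<^sup>2 * amp_max * C1)\<^sup>2 * real N powr (-2*r)"
        unfolding power_mult_distrib[of _ "D powr r"] Dr ..
      have 4: "36 * Cs\<^sup>2 * (1 / real N) \<le> 36 * Cs\<^sup>2 * real N powr (-2*r)"
        by (rule mult_left_mono[OF N1]) simp
      show ?thesis using 1 4 unfolding 2 3 CA_def by (simp only: distrib_right)
    qed
    \<comment> \<open>Each coordinate formula fails on a null set only, and finitely many modes and
      times enter, so the decomposition holds for all increments simultaneously.\<close>
    have dec: "AE \<omega> in M. \<forall>i\<in>{1..N}. X (tt i) p \<omega> - X (tt (i - 1)) p \<omega> = B i \<omega> + E i \<omega>"
    proof -
      have "AE \<omega> in M. \<forall>i\<in>{..N}. \<forall>m\<in>F. x m (tt i) \<omega> = exp (- lam m * tt i) * fc m \<omega> + \<sigma> * lam m powr (- \<alpha> / 2) * J m (tt i) \<omega>"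
      proof (intro AE_finite_allI finite_atMost F(1))
        fix i m assume "i \<in> {..N}" "m \<in> F"
        then have "m \<in> modes" "tt i \<in> {0..1}" using F tt by auto
        then show "AE \<omega> in M. x m (tt i) \<omega> = exp (- lam m * tt i) * fc m \<omega> + \<sigma> * lam m powr (- \<alpha> / 2) * J m (tt i) \<omega>"
          by (rule xJ)
      qed
      then show ?thesis
      proof eventually_elim
        case (elim \<omega>)
        show ?case
        proof
          fix i assume i: "i \<in> {1..N}"
          have "(\<Sum>m\<in>F. x m (tt i) \<omega> * ef m p) - (\<Sum>m\<in>F. x m (tt (i - 1)) \<omega> * ef m p) = B i \<omega> + Dx i \<omega>"
            unfolding B_def Dx_def sum_subtractf[symmetric] sum.distrib[symmetric]
          proof (rule sum.cong[OF refl])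
            fix m assume m: "m \<in> F"
            have 1: "x m (tt i) \<omega> = exp (- lam m * tt i) * fc m \<omega> + \<sigma> * lam m powr (- \<alpha> / 2) * J m (tt i) \<omega>"
              and 2: "x m (tt (i - 1)) \<omega> = exp (- lam m * tt (i - 1)) * fc m \<omega> + \<sigma> * lam m powr (- \<alpha> / 2) * J m (tt (i - 1)) \<omega>"
              using elim i m by auto
            show "x m (tt i) \<omega> * ef m p - x m (tt (i - 1)) \<omega> * ef m p
              = bc m * (J m (real i / real N) \<omega> - J m (real (i - 1) / real N) \<omega>)
                + (exp (- lam m * (real i / real N)) - exp (- lam m * (real (i - 1) / real N))) * ef m p * fc m \<omega>"
              unfolding 1 2 bc_def tt_def[symmetric] by (simp only: algebra_simps)
          qed
          then show "X (tt i) p \<omega> - X (tt (i - 1)) p \<omega> = B i \<omega> + E i \<omega>"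
            unfolding E_def R_def by linarith
        qed
      qed
    qed
    have main: "AE \<omega> in M. (realized_Z \<alpha> X N p \<omega> - f)\<^sup>2 \<le> Cf * ((A \<omega>)\<^sup>2 + bb \<omega> + (bb \<omega>)\<^sup>2)"
      using dec
    proof eventually_elim
      case (elim \<omega>)
      have 1: "realized_Z \<alpha> X N p \<omega> = cN * (\<Sum>i=1..N. (X (tt i) p \<omega> - X (tt (i - 1)) p \<omega>)\<^sup>2)"
        unfolding realized_Z_def cN_eq tt_def ..
      have 2: "(\<Sum>i=1..N. (X (tt i) p \<omega> - X (tt (i - 1)) p \<omega>)\<^sup>2) = (\<Sum>i=1..N. (B i \<omega> + E i \<omega>)\<^sup>2)"
        using elim by (intro sum.cong refl) simp
      have 3: "(cN * (\<Sum>i=1..N. (B i \<omega> + E i \<omega>)\<^sup>2) - f)\<^sup>2 \<le> 9 * (A \<omega>)\<^sup>2 + 12 * f * bb \<omega> + 9 * (bb \<omega>)\<^sup>2"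
        unfolding A_def bb_def by (rule perturbed_quadratic_form[OF less_imp_le[OF cN] f(1)])
      have 4: "9 * (A \<omega>)\<^sup>2 + 12 * f * bb \<omega> + 9 * (bb \<omega>)\<^sup>2 \<le> Cf * (A \<omega>)\<^sup>2 + Cf * bb \<omega> + Cf * (bb \<omega>)\<^sup>2"
      proof (intro add_mono mult_right_mono)
        show "12 * f \<le> Cf" using f_le by (simp add: Cf_def)
      qed (use Cnn b0[of \<omega>] in auto)
      show ?case unfolding 1 2 distrib_left using 3 4 by (rule order_trans)
    qed
    have le: "CA \<le> CA + Cb + Cf" "Cb \<le> CA + Cb + Cf" "Cf \<le> CA + Cb + Cf" using Cnn by auto
    show "\<exists>A b. integrable M (\<lambda>\<omega>. (A \<omega>)\<^sup>2) \<and> expectation (\<lambda>\<omega>. (A \<omega>)\<^sup>2) \<le> (CA + Cb + Cf) * real N powr (-2*r) \<and>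
     integrable M b \<and> (\<forall>\<omega>. 0 \<le> b \<omega>) \<and> expectation b \<le> (CA + Cb + Cf) / real N \<and>
     (AE \<omega> in M. (realized_Z \<alpha> X N (y, z) \<omega> - limit_Z (y, z))\<^sup>2 \<le> (CA + Cb + Cf) * ((A \<omega>)\<^sup>2 + b \<omega> + (b \<omega>)\<^sup>2))"
    proof (rule exI[of _ A], rule exI[of _ bb], intro conjI allI)
      show "expectation (\<lambda>\<omega>. (A \<omega>)\<^sup>2) \<le> (CA + Cb + Cf) * real N powr (-2*r)"
        using AE_ mult_right_mono[OF le(1), of "real N powr (-2*r)"] by simp
      show "expectation bb \<le> (CA + Cb + Cf) / real N"
        using bE divide_right_mono[OF le(2), of "real N"] by simp
      show "AE \<omega> in M. (realized_Z \<alpha> X N (y, z) \<omega> - limit_Z (y, z))\<^sup>2 \<le> (CA + Cb + Cf) * ((A \<omega>)\<^sup>2 + bb \<omega> + (bb \<omega>)\<^sup>2)"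
        using main
      proof eventually_elim
        case (elim \<omega>)
        have "Cf * ((A \<omega>)\<^sup>2 + bb \<omega> + (bb \<omega>)\<^sup>2) \<le> (CA + Cb + Cf) * ((A \<omega>)\<^sup>2 + bb \<omega> + (bb \<omega>)\<^sup>2)"
          using le(3) b0[of \<omega>] by (intro mult_right_mono) auto
        with elim show ?case unfolding p_def f_def by linarith
      qed
    qed (use Aint bint b0 in auto)
  qed
qed

end

section \<open>Identifiability\<close>

text \<open>Second moment about the mean: the numbers 1, ..., m have mean (m + 1)/2 and variance
  (m^2 - 1)/12.\<close>

lemma sum_affine_sq:
  fixes t s :: real
  shows "(\<Sum>j=1..m. (t + s * real j)\<^sup>2)
    = real m * (t + s * (real m + 1) / 2)\<^sup>2 + s\<^sup>2 * (real m * ((real m)\<^sup>2 - 1)) / 12"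
proof (induction m)
  case (Suc m)
  show ?case
    unfolding sum.cl_ivl_Suc using Suc by (simp add: field_simps power2_eq_square)
qed simp

lemma grid_eq: "grid M mb j = real (M div mb) / real M * real j"
  by (simp add: grid_def)

lemma design_window_grid:
  assumes "design_window \<delta> M mb J m" "j \<in> {1..m}"
  shows "grid M mb (J + j) \<in> {\<delta>..1-\<delta>}"
proof -
  have h: "0 \<le> real (M div mb) / real M" by simp
  have "grid M mb (J + 1) \<le> grid M mb (J + j)" "grid M mb (J + j) \<le> grid M mb (J + m)"
    unfolding grid_eq by (rule mult_left_mono[OF _ h], use assms(2) in simp)+
  then show ?thesis using assms(1) by (auto simp: design_window_def)
qed

text \<open>The sum is m times u^2 plus B^2 times the variance of the grid points, where u is the
  value at the midpoint \<open>yb\<close> of the window. A window that nearly fills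
  [\<delta>, 1-\<delta>] and has at least two points has variance bounded below, which determines
  the slope.\<close>

lemma design_window_sum_affine_sq:
  assumes w: "design_window \<delta> M mb J m" and m: "2 \<le> m" and d: "0 < \<delta>" "\<delta> < 1/2"
  defines "c \<equiv> (1 - 2*\<delta>)\<^sup>2 / 324"
  shows "c * real m * (A\<^sup>2 + B\<^sup>2) \<le> (\<Sum>j=1..m. (A + B * grid M mb (J + j))\<^sup>2)"
proof -
  define h where "h = real (M div mb) / real M"
  have h: "0 \<le> h" by (simp add: h_def)
  have g: "grid M mb j = h * real j" for j by (simp add: grid_eq h_def)
  have w1: "h * real J < \<delta>" "1 - \<delta> < h * real (J + m + 1)" "\<delta> \<le> h * real (J + 1)" "h * real (J + m) \<le> 1 - \<delta>"
    using w by (auto simp: design_window_def g)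
  define yb where "yb = h * real J + h * (real m + 1) / 2"
  define u where "u = A + B * yb"
  have yb: "0 \<le> yb" "yb \<le> 1"
  proof -
    have e: "yb = (h * real (J + 1) + h * real (J + m)) / 2" by (simp add: yb_def field_simps)
    have le: "h * real (J + 1) \<le> h * real (J + m)" using h m by (intro mult_left_mono) auto
    have avg: "0 \<le> (p + q) / 2 \<and> (p + q) / 2 \<le> 1" if "\<delta> \<le> p" "p \<le> q" "q \<le> 1 - \<delta>" for p q :: real
      using that d by auto
    show "0 \<le> yb" "yb \<le> 1" unfolding e using avg[OF w1(3) le w1(4)] by simp_all
  qed
  \<comment> \<open>The two grid points just outside the window are more than 1 - 2\<delta> apart,
    at distance h (m + 1); for m >= 2 the window itself has at least a third of that length.\<close>
  have sp: "(1 - 2*\<delta>) / 3 \<le> h * (real m - 1)"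
  proof -
    have "h * (real m + 1) \<le> h * (3 * (real m - 1))" using h m by (intro mult_left_mono) auto
    moreover have "1 - 2*\<delta> \<le> h * (real m + 1)" using w1 by (simp add: algebra_simps)
    ultimately have "1 - 2*\<delta> \<le> h * (3 * (real m - 1))" by (rule order_trans[rotated])
    then show ?thesis by (simp only: mult.left_commute[of h 3]) simp
  qed
  have "((1 - 2*\<delta>) / 3)\<^sup>2 \<le> (h * (real m - 1))\<^sup>2" using sp d by (intro power_mono) auto
  also have "\<dots> = h\<^sup>2 * ((real m - 1) * (real m - 1))" by (simp add: power2_eq_square)
  also have "\<dots> \<le> h\<^sup>2 * ((real m - 1) * (real m + 1))" using m by (intro mult_left_mono) auto
  also have "\<dots> = h\<^sup>2 * ((real m)\<^sup>2 - 1)" by (simp add: power2_eq_square algebra_simps)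
  \<comment> \<open>Origin of 324 = 9 * 36: the 9 is the square of the third just lost, and 36 = 12
    * 3 combines the grid variance with the coefficient of 3 B^2 below.\<close>
  finally have v: "12 * (3 * c) \<le> h\<^sup>2 * ((real m)\<^sup>2 - 1)" by (simp add: c_def power_divide)
  have c: "0 \<le> c" "c \<le> 1/324"
  proof -
    have "(1 - 2*\<delta>)\<^sup>2 \<le> 1" using d by (simp add: abs_square_le_1)
    then show "c \<le> 1/324" by (simp add: c_def)
  qed (simp add: c_def)
  have "(\<Sum>j=1..m. (A + B * grid M mb (J + j))\<^sup>2) = (\<Sum>j=1..m. ((A + B * (h * real J)) + (B * h) * real j)\<^sup>2)"
    unfolding g by (intro sum.cong refl) (simp add: algebra_simps)
  also have "\<dots> = real m * u\<^sup>2 + (B * h)\<^sup>2 * (real m * ((real m)\<^sup>2 - 1)) / 12"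
    unfolding sum_affine_sq u_def yb_def by (simp add: algebra_simps)
  also have "\<dots> = real m * (u\<^sup>2 + B\<^sup>2 * (h\<^sup>2 * ((real m)\<^sup>2 - 1)) / 12)"
    by (simp add: power_mult_distrib algebra_simps)
  finally have eq: "(\<Sum>j=1..m. (A + B * grid M mb (J + j))\<^sup>2) = real m * (u\<^sup>2 + B\<^sup>2 * (h\<^sup>2 * ((real m)\<^sup>2 - 1)) / 12)" .
  \<comment> \<open>The intercept is recovered from the midpoint value as A = u - B yb with 0 <= yb
    <= 1.\<close>
  have A2: "A\<^sup>2 \<le> 2 * u\<^sup>2 + 2 * B\<^sup>2"
  proof -
    have "(B * yb)\<^sup>2 \<le> B\<^sup>2" using yb by (simp add: power_mult_distrib mult_left_le abs_square_le_1)
    moreover have "A\<^sup>2 \<le> 2 * u\<^sup>2 + 2 * (B * yb)\<^sup>2"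
    proof -
      have "(p - q)\<^sup>2 \<le> 2 * p\<^sup>2 + 2 * q\<^sup>2" for p q :: real
        using zero_le_power2[of "p + q"] by (simp add: power2_sum power2_diff)
      from this[of u "B * yb"] show ?thesis by (simp add: u_def)
    qed
    ultimately show ?thesis by linarith
  qed
  have "c * (A\<^sup>2 + B\<^sup>2) \<le> c * (2 * u\<^sup>2 + 3 * B\<^sup>2)" using A2 c by (intro mult_left_mono) auto
  also have "\<dots> \<le> u\<^sup>2 + B\<^sup>2 * (3 * c)"
  proof -
    have "c * (2 * u\<^sup>2) \<le> u\<^sup>2"
      using mult_right_mono[OF c(2), of "2 * u\<^sup>2"] zero_le_power2[of u] by linarith
    moreover have "c * (2 * u\<^sup>2 + 3 * B\<^sup>2) = c * (2 * u\<^sup>2) + B\<^sup>2 * (3 * c)" by (simp add: algebra_simps)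
    ultimately show ?thesis by linarith
  qed
  also have "\<dots> \<le> u\<^sup>2 + B\<^sup>2 * (h\<^sup>2 * ((real m)\<^sup>2 - 1)) / 12"
    using mult_left_mono[OF v, of "B\<^sup>2"] by simp
  finally have "real m * (c * (A\<^sup>2 + B\<^sup>2)) \<le> real m * (u\<^sup>2 + B\<^sup>2 * (h\<^sup>2 * ((real m)\<^sup>2 - 1)) / 12)"
    by (intro mult_left_mono) auto
  then show ?thesis unfolding eq by (simp add: mult_ac)
qed

text \<open>The one-dimensional bound is used in the second coordinate with A + B y as intercept,
  and in the first coordinate for that intercept. The latter costs a second factor c, and c^2 <= c
  lets E^2 share the constant.\<close>

lemma design_window_double_sum_affine_sq:
  assumes w: "design_window \<delta> M1 mb1 J1 m1" "design_window \<delta> M2 mb2 J2 m2" and m: "2 \<le> m1" "2 \<le> m2"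
    and d: "0 < \<delta>" "\<delta> < 1/2"
  defines "c \<equiv> (1 - 2*\<delta>)\<^sup>2 / 324"
  shows "c\<^sup>2 * real (m1 * m2) * (A\<^sup>2 + B\<^sup>2 + E\<^sup>2)
    \<le> (\<Sum>i=1..m1. \<Sum>j=1..m2. (A + B * grid M1 mb1 (J1 + i) + E * grid M2 mb2 (J2 + j))\<^sup>2)"
proof -
  have c: "0 \<le> c" "c \<le> 1"
  proof -
    have "(1 - 2*\<delta>)\<^sup>2 \<le> 1" using d by (simp add: abs_square_le_1)
    then show "c \<le> 1" by (simp add: c_def)
  qed (simp add: c_def)
  have c2: "c\<^sup>2 \<le> c" using c by (simp add: power2_eq_square mult_left_le)
  have "c\<^sup>2 * real (m1 * m2) * (A\<^sup>2 + B\<^sup>2 + E\<^sup>2) = real m2 * (c * (c * real m1 * (A\<^sup>2 + B\<^sup>2))) + c\<^sup>2 * (real m1 * real m2 * E\<^sup>2)"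
    by (simp add: power2_eq_square algebra_simps)
  also have "\<dots> \<le> real m2 * (c * (c * real m1 * (A\<^sup>2 + B\<^sup>2))) + c * (real m1 * real m2 * E\<^sup>2)"
    using c2 by (intro add_left_mono mult_right_mono) auto
  also have "\<dots> \<le> real m2 * (c * (\<Sum>i=1..m1. (A + B * grid M1 mb1 (J1 + i))\<^sup>2)) + c * (real m1 * real m2 * E\<^sup>2)"
    using design_window_sum_affine_sq[OF w(1) m(1) d, of A B] c unfolding c_def[symmetric]
    by (intro add_right_mono mult_left_mono) auto
  also have "\<dots> = (\<Sum>i=1..m1. c * real m2 * ((A + B * grid M1 mb1 (J1 + i))\<^sup>2 + E\<^sup>2))"
    by (simp add: sum.distrib sum_distrib_left distrib_left mult_ac)
  also have "\<dots> \<le> (\<Sum>i=1..m1. \<Sum>j=1..m2. ((A + B * grid M1 mb1 (J1 + i)) + E * grid M2 mb2 (J2 + j))\<^sup>2)"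
    unfolding c_def by (intro sum_mono design_window_sum_affine_sq[OF w(2) m(2) d])
  finally show ?thesis .
qed

section \<open>Separation of exponential surfaces over the design\<close>

definition exp_model :: "real \<Rightarrow> real \<times> real \<times> real \<Rightarrow> real \<times> real \<Rightarrow> real" where
  "exp_model g v p = g * fst v * exp (- (fst (snd v) * fst p + snd (snd v) * snd p))"

text \<open>The derivative of exp is at least e^L on [L, infinity).\<close>

lemma exp_diff_sq_ge:
  fixes a b :: real
  assumes "L \<le> a" "L \<le> b"
  shows "exp (2 * L) * (a - b)\<^sup>2 \<le> (exp a - exp b)\<^sup>2"
proof -
  have *: "exp L * (a - b) \<le> exp a - exp b" if "b \<le> a" "L \<le> b" for a b :: real
  proof -
    have "exp L * (a - b) \<le> exp b * (a - b)" using that by (intro mult_right_mono) auto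
    also have "\<dots> \<le> exp b * (exp (a - b) - 1)"
    proof -
      have "a - b \<le> exp (a - b) - 1" using exp_ge_add_one_self[of "a - b"] by linarith
      then show ?thesis by (rule mult_left_mono) simp
    qed
    also have "\<dots> = exp a - exp b" by (simp add: right_diff_distrib exp_add[symmetric])
    finally show ?thesis .
  qed
  have "exp L * \<bar>a - b\<bar> \<le> \<bar>exp a - exp b\<bar>"
  proof (cases "b \<le> a")
    case True
    then show ?thesis using *[of b a] assms by simp
  next
    case False
    then show ?thesis using *[of a b] assms by (simp add: abs_if not_le)
  qed
  then have "(exp L * \<bar>a - b\<bar>)\<^sup>2 \<le> \<bar>exp a - exp b\<bar>\<^sup>2" by (intro power_mono) auto
  then show ?thesis by (simp add: power_mult_distrib exp_double[symmetric])
qed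

text \<open>The derivative of ln is at least 1/H on (0, H].\<close>

lemma ln_diff_sq_ge:
  fixes s t :: real
  assumes "0 < s" "0 < t" "s \<le> H" "t \<le> H"
  shows "(s - t)\<^sup>2 \<le> H\<^sup>2 * (ln s - ln t)\<^sup>2"
proof -
  have *: "s - t \<le> H * (ln s - ln t)" if "0 < t" "t \<le> s" "s \<le> H" for s t :: real
  proof -
    have "ln t - ln s \<le> (t - s) / s" using that by (intro ln_diff_le) auto
    then have "s - t \<le> s * (ln s - ln t)" using that by (simp add: field_simps)
    also have "\<dots> \<le> H * (ln s - ln t)" using that by (intro mult_right_mono) auto
    finally show ?thesis .
  qed
  have "\<bar>s - t\<bar> \<le> H * \<bar>ln s - ln t\<bar>"
  proof (cases "t \<le> s")
    case True
    then show ?thesis using *[of t s] assms by simp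
  next
    case False
    then show ?thesis using *[of s t] assms by simp
  qed
  then have "\<bar>s - t\<bar>\<^sup>2 \<le> (H * \<bar>ln s - ln t\<bar>)\<^sup>2" by (intro power_mono) auto
  then show ?thesis by (simp add: power_mult_distrib)
qed

text \<open>The logarithm of a surface is affine in (y, z), with coefficients -\<kappa> and -\<eta>
  and a constant term containing ln s, so separation reduces to the bound for affine functions.
  Compactness keeps s away from 0 and the parameters bounded; the passage through exp and ln
  therefore has constants that do not depend on the design.\<close>

lemma exp_model_separation:
  assumes \<Xi>: "compact \<Xi>" "\<Xi> \<subseteq> {0<..} \<times> UNIV \<times> UNIV" and v0: "v0 \<in> \<Xi>" and g: "0 < g"
    and d: "0 < \<delta>" "\<delta> < 1/2"
  shows "\<exists>K>0. \<forall>v\<in>\<Xi>. \<forall>M1 mb1 J1 m1 M2 mb2 J2 m2.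
     design_window \<delta> M1 mb1 J1 m1 \<longrightarrow> design_window \<delta> M2 mb2 J2 m2 \<longrightarrow> 2 \<le> m1 \<longrightarrow> 2 \<le> m2 \<longrightarrow>
     real (m1 * m2) * (norm (v - v0))\<^sup>2
       \<le> K * (\<Sum>i=1..m1. \<Sum>j=1..m2. (exp_model g v (grid M1 mb1 (J1 + i), grid M2 mb2 (J2 + j))
            - exp_model g v0 (grid M1 mb1 (J1 + i), grid M2 mb2 (J2 + j)))\<^sup>2)"
proof -
  obtain H where H: "\<And>v. v \<in> \<Xi> \<Longrightarrow> norm v \<le> H"
    using compact_imp_bounded[OF \<Xi>(1)] by (auto simp: bounded_iff)
  have "compact (fst ` \<Xi>)" using \<Xi>(1) by (intro compact_continuous_image continuous_on_fst continuous_on_id)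
  then obtain s0 where s0: "s0 \<in> fst ` \<Xi>" "\<And>s. s \<in> fst ` \<Xi> \<Longrightarrow> s0 \<le> s"
    using compact_attains_inf[of "fst ` \<Xi>"] v0 by blast
  have s0pos: "0 < s0" using s0(1) \<Xi>(2) by auto
  have comp: "fst v \<le> H" "\<bar>fst (snd v)\<bar> \<le> H" "\<bar>snd (snd v)\<bar> \<le> H" "s0 \<le> fst v" if "v \<in> \<Xi>" for v
  proof -
    have "norm (fst v) \<le> norm v" "norm (snd v) \<le> norm v" "norm (fst (snd v)) \<le> norm (snd v)" "norm (snd (snd v)) \<le> norm (snd v)"
      by (metis norm_fst_le norm_snd_le prod.collapse)+
    with H[OF that] show "fst v \<le> H" "\<bar>fst (snd v)\<bar> \<le> H" "\<bar>snd (snd v)\<bar> \<le> H" by auto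
    show "s0 \<le> fst v" using s0(2) that by blast
  qed
  have H0: "0 < H" using comp(1,4)[OF v0] s0pos by linarith
  \<comment> \<open>A lower bound for the exponent of all surfaces on the unit square: ln s is at
    least ln s0, and each of the two linear terms is at most H in size.\<close>
  define L where "L = ln s0 - 2 * H"
  define c where "c = (1 - 2*\<delta>)\<^sup>2 / 324"
  have c: "0 < c" using d by (simp add: c_def)
  define k where "k = g\<^sup>2 * exp (2 * L) * c\<^sup>2"
  have k: "0 < k" using g c by (simp add: k_def)
  define K where "K = (H\<^sup>2 + 1) / k"
  have K: "0 < K" using k by (auto simp: K_def intro!: divide_pos_pos add_nonneg_pos)
  have "real (m1 * m2) * (norm (v - v0))\<^sup>2
       \<le> K * (\<Sum>i=1..m1. \<Sum>j=1..m2. (exp_model g v (grid M1 mb1 (J1 + i), grid M2 mb2 (J2 + j))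
            - exp_model g v0 (grid M1 mb1 (J1 + i), grid M2 mb2 (J2 + j)))\<^sup>2)"
    if v: "v \<in> \<Xi>" and w: "design_window \<delta> M1 mb1 J1 m1" "design_window \<delta> M2 mb2 J2 m2" and m: "2 \<le> m1" "2 \<le> m2"
    for v M1 mb1 J1 m1 M2 mb2 J2 m2
  proof -
    define e where "e u p = ln (fst u) - fst (snd u) * fst p - snd (snd u) * snd p" for u :: "real \<times> real \<times> real" and p :: "real \<times> real"
    have em: "exp_model g u p = g * exp (e u p)" if "u \<in> \<Xi>" for u p
    proof -
      have "0 < fst u" using comp(4)[OF that] s0pos by linarith
      then have "exp (e u p) = fst u * exp (- (fst (snd u) * fst p + snd (snd u) * snd p))"
        unfolding e_def by (simp add: exp_diff exp_minus exp_add field_simps)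
      then show ?thesis by (simp add: exp_model_def)
    qed
    have eL: "L \<le> e u p" if u: "u \<in> \<Xi>" and p: "0 \<le> fst p" "fst p \<le> 1" "0 \<le> snd p" "snd p \<le> 1" for u p
    proof -
      have b: "x * y \<le> H" if "\<bar>x\<bar> \<le> H" "0 \<le> y" "y \<le> 1" for x y :: real
      proof -
        have "x * y \<le> \<bar>x\<bar> * y" using that by (intro mult_right_mono) auto
        also have "\<dots> \<le> \<bar>x\<bar>" using that by (intro mult_left_le) auto
        finally show ?thesis using that by linarith
      qed
      have "ln s0 \<le> ln (fst u)" using comp(4)[OF u] s0pos by simp
      then show ?thesis
        using b[OF comp(2)[OF u] p(1,2)] b[OF comp(3)[OF u] p(3,4)] unfolding L_def e_def by linarith
    qed
    define A where "A = ln (fst v) - ln (fst v0)"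
    define B where "B = fst (snd v0) - fst (snd v)"
    define E where "E = snd (snd v0) - snd (snd v)"
    let ?y = "\<lambda>i. grid M1 mb1 (J1 + i)" and ?z = "\<lambda>j. grid M2 mb2 (J2 + j)"
    have pos: "0 < fst v" "0 < fst v0" using comp(4)[OF v] comp(4)[OF v0] s0pos by linarith+
    have nrm: "(norm (v - v0))\<^sup>2 = (fst v - fst v0)\<^sup>2 + B\<^sup>2 + E\<^sup>2"
    proof -
      have nq: "(norm u)\<^sup>2 = (norm (fst u))\<^sup>2 + (norm (snd u))\<^sup>2" for u :: "'x::real_normed_vector \<times> 'y::real_normed_vector"
        by (simp add: norm_prod_def)
      show ?thesis unfolding nq[of "v - v0"] nq[of "snd (v - v0)"]
        by (simp add: B_def E_def power2_commute)
    qed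
    have "(norm (v - v0))\<^sup>2 \<le> H\<^sup>2 * A\<^sup>2 + B\<^sup>2 + E\<^sup>2"
      unfolding nrm A_def using ln_diff_sq_ge[OF pos comp(1)[OF v] comp(1)[OF v0]] by simp
    also have "\<dots> \<le> (H\<^sup>2 + 1) * (A\<^sup>2 + B\<^sup>2 + E\<^sup>2)"
      by (simp add: algebra_simps add_nonneg_nonneg)
    finally have n: "(norm (v - v0))\<^sup>2 \<le> (H\<^sup>2 + 1) * (A\<^sup>2 + B\<^sup>2 + E\<^sup>2)" .
    have "k * (real (m1 * m2) * (A\<^sup>2 + B\<^sup>2 + E\<^sup>2)) = g\<^sup>2 * exp (2 * L) * (c\<^sup>2 * real (m1 * m2) * (A\<^sup>2 + B\<^sup>2 + E\<^sup>2))"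
      by (simp add: k_def mult_ac)
    also have "\<dots> \<le> g\<^sup>2 * exp (2 * L) * (\<Sum>i=1..m1. \<Sum>j=1..m2. (A + B * ?y i + E * ?z j)\<^sup>2)"
      unfolding c_def by (intro mult_left_mono design_window_double_sum_affine_sq w m d) auto
    also have "\<dots> = (\<Sum>i=1..m1. \<Sum>j=1..m2. g\<^sup>2 * (exp (2 * L) * (A + B * ?y i + E * ?z j)\<^sup>2))"
      by (simp add: sum_distrib_left mult.assoc)
    also have "\<dots> \<le> (\<Sum>i=1..m1. \<Sum>j=1..m2. (exp_model g v (?y i, ?z j) - exp_model g v0 (?y i, ?z j))\<^sup>2)"
    proof (intro sum_mono)
      fix i j assume ij: "i \<in> {1..m1}" "j \<in> {1..m2}"
      have yz: "0 \<le> ?y i" "?y i \<le> 1" "0 \<le> ?z j" "?z j \<le> 1"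
        using design_window_grid[OF w(1) ij(1)] design_window_grid[OF w(2) ij(2)] d by auto
      have "A + B * ?y i + E * ?z j = e v (?y i, ?z j) - e v0 (?y i, ?z j)"
        by (simp add: A_def B_def E_def e_def algebra_simps)
      then have "exp (2 * L) * (A + B * ?y i + E * ?z j)\<^sup>2 \<le> (exp (e v (?y i, ?z j)) - exp (e v0 (?y i, ?z j)))\<^sup>2"
        using eL[OF v, of "(?y i, ?z j)"] eL[OF v0, of "(?y i, ?z j)"] yz by (simp add: exp_diff_sq_ge)
      then have "g\<^sup>2 * (exp (2 * L) * (A + B * ?y i + E * ?z j)\<^sup>2) \<le> g\<^sup>2 * (exp (e v (?y i, ?z j)) - exp (e v0 (?y i, ?z j)))\<^sup>2"
        by (intro mult_left_mono) auto
      also have "\<dots> = (exp_model g v (?y i, ?z j) - exp_model g v0 (?y i, ?z j))\<^sup>2"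
        unfolding em[OF v] em[OF v0] by (simp add: power_mult_distrib flip: right_diff_distrib)
      finally show "g\<^sup>2 * (exp (2 * L) * (A + B * ?y i + E * ?z j)\<^sup>2) \<le> (exp_model g v (?y i, ?z j) - exp_model g v0 (?y i, ?z j))\<^sup>2" .
    qed
    finally have S: "real (m1 * m2) * (A\<^sup>2 + B\<^sup>2 + E\<^sup>2)
      \<le> (\<Sum>i=1..m1. \<Sum>j=1..m2. (exp_model g v (?y i, ?z j) - exp_model g v0 (?y i, ?z j))\<^sup>2) / k"
      using k by (simp add: field_simps)
    have "real (m1 * m2) * (norm (v - v0))\<^sup>2 \<le> real (m1 * m2) * ((H\<^sup>2 + 1) * (A\<^sup>2 + B\<^sup>2 + E\<^sup>2))"
      using n by (intro mult_left_mono) auto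
    also have "\<dots> = (H\<^sup>2 + 1) * (real (m1 * m2) * (A\<^sup>2 + B\<^sup>2 + E\<^sup>2))" by (simp only: mult_ac)
    also have "\<dots> \<le> (H\<^sup>2 + 1) * ((\<Sum>i=1..m1. \<Sum>j=1..m2. (exp_model g v (?y i, ?z j) - exp_model g v0 (?y i, ?z j))\<^sup>2) / k)"
      using S by (intro mult_left_mono) auto
    finally show ?thesis by (simp add: K_def)
  qed
  with K show ?thesis by blast
qed

section \<open>Errors summed over the design\<close>

context spde_field
begin

lemma limit_Z_exp_model:
  "limit_Z p = exp_model (Gamma (1 - \<alpha>) / (4 * pi * \<alpha>)) (\<sigma>\<^sup>2 / \<theta>2, \<theta>1 / \<theta>2, \<eta>1 / \<theta>2) p"
  by (simp add: limit_Z_def exp_model_def amp_def)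

text \<open>U is the sum of all A^2 and b. As the b are nonnegative, the sum of their squares is at
  most the square of their sum, hence at most U^2. The quadratic term is thereby expressed through
  U, so the bound on E U can serve for both terms once U is known to be small.\<close>

lemma sum_realized_Z_error:
  assumes r: "0 < r" "r < 1/2" "r \<le> 1 - \<alpha>" and d: "0 < \<delta>" "\<delta> < 1/2"
  shows "\<exists>C\<ge>0. \<forall>N\<ge>1. \<forall>m1 m2 y z. (\<forall>i\<in>{1..m1}. y i \<in> {\<delta>..1-\<delta>}) \<longrightarrow> (\<forall>j\<in>{1..m2}. z j \<in> {\<delta>..1-\<delta>}) \<longrightarrow>
    (\<exists>U. integrable M U \<and> (\<forall>\<omega>. 0 \<le> U \<omega>) \<and> expectation U \<le> C * real (m1 * m2) * real N powr (-2*r) \<and>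
     (AE \<omega> in M. (\<Sum>i=1..m1. \<Sum>j=1..m2. (realized_Z \<alpha> X N (y i, z j) \<omega> - limit_Z (y i, z j))\<^sup>2)
        \<le> C * (U \<omega> + (U \<omega>)\<^sup>2)))"
proof -
  obtain C where C: "0 \<le> C" and err: "\<forall>N\<ge>1. \<forall>y\<in>{\<delta>..1-\<delta>}. \<forall>z\<in>{\<delta>..1-\<delta>}. \<exists>A b.
     integrable M (\<lambda>\<omega>. (A \<omega>)\<^sup>2) \<and> expectation (\<lambda>\<omega>. (A \<omega>)\<^sup>2) \<le> C * real N powr (-2*r) \<and>
     integrable M b \<and> (\<forall>\<omega>. 0 \<le> b \<omega>) \<and> expectation b \<le> C / real N \<and>
     (AE \<omega> in M. (realized_Z \<alpha> X N (y, z) \<omega> - limit_Z (y, z))\<^sup>2 \<le> C * ((A \<omega>)\<^sup>2 + b \<omega> + (b \<omega>)\<^sup>2))"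
    using realized_Z_error[OF r d] by (elim exE conjE)
  show ?thesis
  proof (intro exI[of _ "2 * C"] conjI allI impI)
    show "0 \<le> 2 * C" using C by simp
    fix N m1 m2 :: nat and y z :: "nat \<Rightarrow> real"
    assume N: "1 \<le> N" and y: "\<forall>i\<in>{1..m1}. y i \<in> {\<delta>..1-\<delta>}" and z: "\<forall>j\<in>{1..m2}. z j \<in> {\<delta>..1-\<delta>}"
    define I where "I = {1..m1} \<times> {1..m2}"
    have I: "finite I" "card I = m1 * m2" by (auto simp: I_def card_cartesian_product)
    have "\<forall>ij\<in>I. \<exists>Ab. integrable M (\<lambda>\<omega>. (fst Ab \<omega>)\<^sup>2) \<and> expectation (\<lambda>\<omega>. (fst Ab \<omega>)\<^sup>2) \<le> C * real N powr (-2*r) \<and>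
     integrable M (snd Ab) \<and> (\<forall>\<omega>. 0 \<le> snd Ab \<omega>) \<and> expectation (snd Ab) \<le> C / real N \<and>
     (AE \<omega> in M. (realized_Z \<alpha> X N (y (fst ij), z (snd ij)) \<omega> - limit_Z (y (fst ij), z (snd ij)))\<^sup>2
        \<le> C * ((fst Ab \<omega>)\<^sup>2 + snd Ab \<omega> + (snd Ab \<omega>)\<^sup>2))"
    proof
      fix ij assume "ij \<in> I"
      then have "y (fst ij) \<in> {\<delta>..1-\<delta>}" "z (snd ij) \<in> {\<delta>..1-\<delta>}" using y z by (auto simp: I_def)
      from err[rule_format, OF N this]
      show "\<exists>Ab. integrable M (\<lambda>\<omega>. (fst Ab \<omega>)\<^sup>2) \<and> expectation (\<lambda>\<omega>. (fst Ab \<omega>)\<^sup>2) \<le> C * real N powr (-2*r) \<and>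
       integrable M (snd Ab) \<and> (\<forall>\<omega>. 0 \<le> snd Ab \<omega>) \<and> expectation (snd Ab) \<le> C / real N \<and>
       (AE \<omega> in M. (realized_Z \<alpha> X N (y (fst ij), z (snd ij)) \<omega> - limit_Z (y (fst ij), z (snd ij)))\<^sup>2
          \<le> C * ((fst Ab \<omega>)\<^sup>2 + snd Ab \<omega> + (snd Ab \<omega>)\<^sup>2))"
        by (elim exE) (rule exI[of _ "(_, _)"], simp only: fst_conv snd_conv)
    qed
    from bchoice[OF this] obtain Ab where Ab: "\<forall>ij\<in>I. integrable M (\<lambda>\<omega>. (fst (Ab ij) \<omega>)\<^sup>2) \<and> expectation (\<lambda>\<omega>. (fst (Ab ij) \<omega>)\<^sup>2) \<le> C * real N powr (-2*r) \<and>
     integrable M (snd (Ab ij)) \<and> (\<forall>\<omega>. 0 \<le> snd (Ab ij) \<omega>) \<and> expectation (snd (Ab ij)) \<le> C / real N \<and>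
     (AE \<omega> in M. (realized_Z \<alpha> X N (y (fst ij), z (snd ij)) \<omega> - limit_Z (y (fst ij), z (snd ij)))\<^sup>2
        \<le> C * ((fst (Ab ij) \<omega>)\<^sup>2 + snd (Ab ij) \<omega> + (snd (Ab ij) \<omega>)\<^sup>2))"
      by (elim exE)
    define A where "A ij = fst (Ab ij)" for ij
    define b where "b ij = snd (Ab ij)" for ij
    have Aint: "integrable M (\<lambda>\<omega>. (A ij \<omega>)\<^sup>2)" and AE': "expectation (\<lambda>\<omega>. (A ij \<omega>)\<^sup>2) \<le> C * real N powr (-2*r)"
      and bint: "integrable M (b ij)" and b0: "0 \<le> b ij \<omega>" and bE: "expectation (b ij) \<le> C / real N"
      and err': "AE \<omega> in M. (realized_Z \<alpha> X N (y (fst ij), z (snd ij)) \<omega> - limit_Z (y (fst ij), z (snd ij)))\<^sup>2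
        \<le> C * ((A ij \<omega>)\<^sup>2 + b ij \<omega> + (b ij \<omega>)\<^sup>2)" if "ij \<in> I" for ij \<omega>
      using Ab[rule_format, OF that] unfolding A_def b_def by blast+
    define U where "U \<omega> = (\<Sum>ij\<in>I. (A ij \<omega>)\<^sup>2) + (\<Sum>ij\<in>I. b ij \<omega>)" for \<omega>
    have N1: "1 / real N \<le> real N powr (-2*r)" by (rule inverse_nat_le_powr[OF N r(2)])
    have i1: "integrable M (\<lambda>\<omega>. \<Sum>ij\<in>I. (A ij \<omega>)\<^sup>2)" and i2: "integrable M (\<lambda>\<omega>. \<Sum>ij\<in>I. b ij \<omega>)"
      using Aint bint by (auto intro!: Bochner_Integration.integrable_sum)
    have "expectation U = (\<Sum>ij\<in>I. expectation (\<lambda>\<omega>. (A ij \<omega>)\<^sup>2)) + (\<Sum>ij\<in>I. expectation (b ij))"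
      unfolding U_def[abs_def] using i1 i2 Aint bint by (simp add: Bochner_Integration.integral_sum)
    also have "\<dots> \<le> (\<Sum>ij\<in>I. C * real N powr (-2*r)) + (\<Sum>ij\<in>I. C / real N)"
      using AE' bE by (intro add_mono sum_mono) auto
    also have "\<dots> = real (m1 * m2) * (C * real N powr (-2*r)) + real (m1 * m2) * (C * (1 / real N))"
      using I by simp
    also have "\<dots> \<le> real (m1 * m2) * (C * real N powr (-2*r)) + real (m1 * m2) * (C * real N powr (-2*r))"
      using N1 C by (intro add_left_mono mult_left_mono) auto
    finally have EU: "expectation U \<le> 2 * C * real (m1 * m2) * real N powr (-2*r)"
    proof -
      have "u * (C * v) + u * (C * v) = 2 * C * u * v" for u v :: real by simp
      moreover assume "expectation U \<le> real (m1 * m2) * (C * real N powr (-2*r)) + real (m1 * m2) * (C * real N powr (-2*r))"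
      ultimately show ?thesis by (simp only:)
    qed
    have U0: "0 \<le> U \<omega>" for \<omega> unfolding U_def using b0 by (intro add_nonneg_nonneg sum_nonneg) auto
    have "AE \<omega> in M. \<forall>ij\<in>I. (realized_Z \<alpha> X N (y (fst ij), z (snd ij)) \<omega> - limit_Z (y (fst ij), z (snd ij)))\<^sup>2
        \<le> C * ((A ij \<omega>)\<^sup>2 + b ij \<omega> + (b ij \<omega>)\<^sup>2)"
      using I(1) err' by (intro AE_finite_allI)
    then have "AE \<omega> in M. (\<Sum>i=1..m1. \<Sum>j=1..m2. (realized_Z \<alpha> X N (y i, z j) \<omega> - limit_Z (y i, z j))\<^sup>2)
        \<le> 2 * C * (U \<omega> + (U \<omega>)\<^sup>2)"
    proof eventually_elim
      case (elim \<omega>)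
      have "(\<Sum>i=1..m1. \<Sum>j=1..m2. (realized_Z \<alpha> X N (y i, z j) \<omega> - limit_Z (y i, z j))\<^sup>2)
        = (\<Sum>ij\<in>I. (realized_Z \<alpha> X N (y (fst ij), z (snd ij)) \<omega> - limit_Z (y (fst ij), z (snd ij)))\<^sup>2)"
        unfolding I_def by (simp add: sum.cartesian_product split_beta)
      also have "\<dots> \<le> (\<Sum>ij\<in>I. C * ((A ij \<omega>)\<^sup>2 + b ij \<omega> + (b ij \<omega>)\<^sup>2))"
        using elim by (intro sum_mono) auto
      also have "\<dots> = C * (U \<omega> + (\<Sum>ij\<in>I. (b ij \<omega>)\<^sup>2))"
        unfolding U_def sum_distrib_left[symmetric] by (simp only: sum.distrib)
      also have "\<dots> \<le> C * (U \<omega> + (U \<omega>)\<^sup>2)"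
      proof -
        have "(\<Sum>ij\<in>I. (b ij \<omega>)\<^sup>2) \<le> (\<Sum>ij\<in>I. b ij \<omega> * (\<Sum>ij\<in>I. b ij \<omega>))"
        proof (rule sum_mono)
          fix ij assume ij: "ij \<in> I"
          have "b ij \<omega> \<le> (\<Sum>ij\<in>I. b ij \<omega>)" using ij I(1) b0 by (intro member_le_sum) auto
          then show "(b ij \<omega>)\<^sup>2 \<le> b ij \<omega> * (\<Sum>ij\<in>I. b ij \<omega>)"
            unfolding power2_eq_square using b0[OF ij] by (intro mult_left_mono) auto
        qed
        also have "\<dots> = (\<Sum>ij\<in>I. b ij \<omega>)\<^sup>2" by (simp add: power2_eq_square sum_distrib_right)
        also have "\<dots> \<le> (U \<omega>)\<^sup>2"
          unfolding U_def using b0 by (intro power_mono) (auto intro!: sum_nonneg)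
        finally show ?thesis using C by (intro mult_left_mono) auto
      qed
      also have "\<dots> \<le> 2 * C * (U \<omega> + (U \<omega>)\<^sup>2)" using C U0[of \<omega>] by (intro mult_right_mono) auto
      finally show ?case .
    qed
    then show "\<exists>U. integrable M U \<and> (\<forall>\<omega>. 0 \<le> U \<omega>) \<and> expectation U \<le> 2 * C * real (m1 * m2) * real N powr (-2*r) \<and>
     (AE \<omega> in M. (\<Sum>i=1..m1. \<Sum>j=1..m2. (realized_Z \<alpha> X N (y i, z j) \<omega> - limit_Z (y i, z j))\<^sup>2)
        \<le> 2 * C * (U \<omega> + (U \<omega>)\<^sup>2))"
      using EU U0 i1 i2 by (intro exI[of _ U]) (auto simp: U_def[abs_def])
  qed
qed

end

section \<open>Rate of convergence\<close>

text \<open>Squared triangle inequality through the data u; minimality replaces the distance to v1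
  by the distance to v0, and 2 + 2 = 4.\<close>

lemma minimizer_error:
  fixes u v0 v1 :: "'i \<Rightarrow> 'j \<Rightarrow> real"
  assumes "(\<Sum>i\<in>I. \<Sum>j\<in>J. (u i j - v1 i j)\<^sup>2) \<le> (\<Sum>i\<in>I. \<Sum>j\<in>J. (u i j - v0 i j)\<^sup>2)"
  shows "(\<Sum>i\<in>I. \<Sum>j\<in>J. (v1 i j - v0 i j)\<^sup>2) \<le> 4 * (\<Sum>i\<in>I. \<Sum>j\<in>J. (u i j - v0 i j)\<^sup>2)"
proof -
  have "(v1 i j - v0 i j)\<^sup>2 \<le> 2 * (u i j - v1 i j)\<^sup>2 + 2 * (u i j - v0 i j)\<^sup>2" for i j
    using zero_le_power2[of "(u i j - v1 i j) + (u i j - v0 i j)"] by (simp add: power2_eq_square algebra_simps)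
  then have "(\<Sum>i\<in>I. \<Sum>j\<in>J. (v1 i j - v0 i j)\<^sup>2) \<le> (\<Sum>i\<in>I. \<Sum>j\<in>J. 2 * (u i j - v1 i j)\<^sup>2 + 2 * (u i j - v0 i j)\<^sup>2)"
    by (intro sum_mono)
  also have "\<dots> = 2 * (\<Sum>i\<in>I. \<Sum>j\<in>J. (u i j - v1 i j)\<^sup>2) + 2 * (\<Sum>i\<in>I. \<Sum>j\<in>J. (u i j - v0 i j)\<^sup>2)"
    by (simp only: sum.distrib sum_distrib_left)
  finally show ?thesis using assms by linarith
qed

theorem theorem3p2:
  fixes M :: "'w measure"
    and \<alpha> \<theta>0 \<theta>1 \<eta>1 \<theta>2 \<sigma> \<rho> \<delta> \<gamma> :: real
    and \<theta> :: drift
    and \<Theta> :: "(real \<times> real \<times> real \<times> real \<times> real) set"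
    and \<Xi>1 :: "(real \<times> real \<times> real) set"
    and w :: "nat \<Rightarrow> nat \<Rightarrow> real \<Rightarrow> 'w \<Rightarrow> real"
    and \<xi> :: "'w \<Rightarrow> real \<times> real \<Rightarrow> real"
    and X :: "real \<Rightarrow> real \<times> real \<Rightarrow> 'w \<Rightarrow> real"
    and M1 M2 mb1 mb2 J1 J2 m1 m2 :: "nat \<Rightarrow> nat"
    and est :: "nat \<Rightarrow> 'w \<Rightarrow> real \<times> real \<times> real"
  assumes prob: "prob_space M"
    and theta: "\<theta> = (\<theta>0, \<theta>1, \<eta>1, \<theta>2)"
    and alpha: "0 < \<alpha>" "\<alpha> < 1"
    and Theta: "compact \<Theta>" "convex \<Theta>" "\<Theta> \<subseteq> UNIV \<times> UNIV \<times> UNIV \<times> {0<..} \<times> {0<..}"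
      "(\<theta>0, \<theta>1, \<eta>1, \<theta>2, \<sigma>) \<in> interior \<Theta>"
    and pos: "eigenval \<theta> 1 1 > 0"
    and bm: "independent_brownian_motions M w"
    and init: "random_element_H M \<theta> \<xi>" "independent_of_noise M \<theta> \<xi> w"
    and X: "mild_solution M \<alpha> \<theta> \<sigma> w \<xi> X"
    and xi_indep: "prob_space.indep_vars M (\<lambda>_. borel) (\<lambda>(k, l) \<omega>. fourier_coeff \<theta> (\<xi> \<omega>) k l) modes"
    and xi_fourth: "(SUP (k, l)\<in>modes. ennreal (eigenval \<theta> k l powr (1 + \<alpha>))
          * (\<integral>\<^sup>+\<omega>. ennreal (fourier_coeff \<theta> (\<xi> \<omega>) k l ^ 4) \<partial>M)) < \<infinity>"
    and xi_cases:
      "((\<forall>(k, l)\<in>modes. integrable M (\<lambda>\<omega>. fourier_coeff \<theta> (\<xi> \<omega>) k l)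
             \<and> prob_space.expectation M (\<lambda>\<omega>. fourier_coeff \<theta> (\<xi> \<omega>) k l) = 0)
         \<and> (SUP (k, l)\<in>modes. ennreal (eigenval \<theta> k l powr (1 + \<alpha>))
              * (\<integral>\<^sup>+\<omega>. ennreal ((fourier_coeff \<theta> (\<xi> \<omega>) k l)\<^sup>2) \<partial>M)) < \<infinity>)
       \<or> (\<integral>\<^sup>+\<omega>. power_norm_sq \<theta> ((1 + \<alpha>) / 2) (\<xi> \<omega>) \<partial>M) < \<infinity>"
    and rho: "0 < \<rho>" "\<rho> < min 1 (2 * (1 - \<alpha>))"
    and delta: "0 < \<delta>" "\<delta> < 1/2"
    and design: "\<forall>\<^sub>F N in sequentially. design_window \<delta> (M1 N) (mb1 N) (J1 N) (m1 N)
          \<and> design_window \<delta> (M2 N) (mb2 N) (J2 N) (m2 N)"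
    and nondegenerate: "\<forall>\<^sub>F N in sequentially. 2 \<le> m1 N \<and> 2 \<le> m2 N"
    and growth: "(\<lambda>N. real (mb1 N * mb2 N)) \<in> O(\<lambda>N. real N powr \<rho>)"
    and m_lim: "filterlim (\<lambda>N. m1 N * m2 N) at_top sequentially"
    and Xi: "compact \<Xi>1" "convex \<Xi>1" "\<Xi>1 \<subseteq> {0<..} \<times> UNIV \<times> UNIV" "(\<sigma>\<^sup>2 / \<theta>2, \<theta>1 / \<theta>2, \<eta>1 / \<theta>2) \<in> interior \<Xi>1"
    and est_meas: "\<And>N. est N \<in> borel_measurable M"
    and est_min: "\<And>N \<omega>. 1 \<le> N \<Longrightarrow> \<omega> \<in> space M \<Longrightarrow>
          is_arg_min
            (contrast \<alpha> X N (m1 N) (m2 N)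
               (\<lambda>j. grid (M1 N) (mb1 N) (J1 N + j)) (\<lambda>j. grid (M2 N) (mb2 N) (J2 N + j)) \<omega>)
            (\<lambda>v. v \<in> \<Xi>1) (est N \<omega>)"
    and gamma: "\<gamma> < min (1/2) (1 - \<alpha>) - \<rho> / 2"
  shows "tends_to_0_in_prob M
    (\<lambda>N \<omega>. (sqrt (real (m1 N * m2 N)) * real N powr \<gamma>) *\<^sub>R (est N \<omega> - (\<sigma>\<^sup>2 / \<theta>2, \<theta>1 / \<theta>2, \<eta>1 / \<theta>2)))"
proof -
  interpret prob_space M by (rule prob)
  have "(\<theta>0, \<theta>1, \<eta>1, \<theta>2, \<sigma>) \<in> \<Theta>" using Theta(4) interior_subset by blast
  then have th2: "0 < \<theta>2" using Theta(3) by auto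
  have lam_pos: "0 < eigenval \<theta> k l" if "(k, l) \<in> modes" for k l
  proof -
    have "0 < pi\<^sup>2 * \<theta>2" "0 < 2 * (pi\<^sup>2 * \<theta>2) + (- \<theta>0 + (\<theta>1\<^sup>2 + \<eta>1\<^sup>2) / (4 * \<theta>2))"
      using th2 pos by (simp_all add: theta eigenval_eq quad_eigenval_def)
    then show ?thesis
      unfolding theta eigenval_eq using that by (intro quad_eigenval_pos) (auto simp: modes_def)
  qed
  define Lw where "Lw m = eigenval \<theta> (fst m) (snd m) powr (1 + \<alpha>)" for m
  define Y where "Y m \<omega> = fourier_coeff \<theta> (\<xi> \<omega>) (fst m) (snd m)" for m \<omega>
  have Lw: "0 < Lw m" if "m \<in> modes" for m
    using lam_pos[of "fst m" "snd m"] that by (simp add: Lw_def)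
  have "(\<lambda>(k, l) \<omega>. fourier_coeff \<theta> (\<xi> \<omega>) k l) = Y"
    by (rule ext, rule ext) (simp add: Y_def split_beta)
  then have ind: "indep_vars (\<lambda>_. borel) Y modes" using xi_indep by simp
  have Ym: "Y m \<in> borel_measurable M" if "m \<in> modes" for m
    using ind that by (auto simp: indep_vars_def)
  \<comment> \<open>The two alternatives for the initial condition meet here: orthogonality in the
    first, a finite expected norm in the second.\<close>
  have "\<exists>P. weighted_l2_bound M modes Lw Y P"
    using xi_cases
  proof
    assume *: "(\<forall>(k, l)\<in>modes. integrable M (\<lambda>\<omega>. fourier_coeff \<theta> (\<xi> \<omega>) k l)
             \<and> prob_space.expectation M (\<lambda>\<omega>. fourier_coeff \<theta> (\<xi> \<omega>) k l) = 0)
         \<and> (SUP (k, l)\<in>modes. ennreal (eigenval \<theta> k l powr (1 + \<alpha>))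
              * (\<integral>\<^sup>+\<omega>. ennreal ((fourier_coeff \<theta> (\<xi> \<omega>) k l)\<^sup>2) \<partial>M)) < \<infinity>"
    show ?thesis
    proof (rule weighted_l2_bound_indep[OF ind Lw])
      show "integrable M (Y m)" "expectation (Y m) = 0" if "m \<in> modes" for m
        using conjunct1[OF *] that unfolding Y_def[abs_def] by auto
      show "(SUP m\<in>modes. ennreal (Lw m) * (\<integral>\<^sup>+\<omega>. ennreal ((Y m \<omega>)\<^sup>2) \<partial>M)) < \<infinity>"
        using conjunct2[OF *] by (simp add: Lw_def Y_def split_beta)
    qed
  next
    assume *: "(\<integral>\<^sup>+\<omega>. power_norm_sq \<theta> ((1 + \<alpha>) / 2) (\<xi> \<omega>) \<partial>M) < \<infinity>"
    have "power_norm_sq \<theta> ((1 + \<alpha>) / 2) (\<xi> \<omega>) = (\<Sum>\<^sub>\<infinity>m\<in>modes. ennreal (Lw m * (Y m \<omega>)\<^sup>2))" for \<omega>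
    proof -
      have sq: "(u powr ((1 + \<alpha>) / 2))\<^sup>2 = u powr (1 + \<alpha>)" for u :: real
        by (simp only: power2_eq_square powr_add[symmetric] field_sum_of_halves)
      show ?thesis
        unfolding power_norm_sq_def Lw_def Y_def by (simp add: case_prod_unfold power_mult_distrib sq)
    qed
    with * show ?thesis by (intro weighted_l2_bound_norm[OF Ym Lw]) simp_all
  qed
  then obtain P where P: "weighted_l2_bound M modes Lw Y P" ..
  interpret spde_field M \<alpha> \<theta>0 \<theta>1 \<eta>1 \<theta>2 \<sigma> P w \<xi> X
  proof
    show "weighted_l2_bound M modes (\<lambda>m. eigenval (\<theta>0, \<theta>1, \<eta>1, \<theta>2) (fst m) (snd m) powr (1 + \<alpha>))
      (\<lambda>m \<omega>. fourier_coeff (\<theta>0, \<theta>1, \<eta>1, \<theta>2) (\<xi> \<omega>) (fst m) (snd m)) P"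
      using P unfolding Lw_def[abs_def] Y_def[abs_def] theta .
  qed (use alpha th2 pos bm X in \<open>simp_all add: theta\<close>)
  define g where "g = Gamma (1 - \<alpha>) / (4 * pi * \<alpha>)"
  have g: "0 < g" using alpha by (simp add: g_def Gamma_real_pos)
  define v0 where "v0 = (\<sigma>\<^sup>2 / \<theta>2, \<theta>1 / \<theta>2, \<eta>1 / \<theta>2)"
  have v0: "v0 \<in> \<Xi>1" using Xi(4) interior_subset unfolding v0_def by blast
  obtain K where K: "0 < K" and sep: "\<forall>v\<in>\<Xi>1. \<forall>M1 mb1 J1 m1 M2 mb2 J2 m2.
     design_window \<delta> M1 mb1 J1 m1 \<longrightarrow> design_window \<delta> M2 mb2 J2 m2 \<longrightarrow> 2 \<le> m1 \<longrightarrow> 2 \<le> m2 \<longrightarrow>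
     real (m1 * m2) * (norm (v - v0))\<^sup>2
       \<le> K * (\<Sum>i=1..m1. \<Sum>j=1..m2. (exp_model g v (grid M1 mb1 (J1 + i), grid M2 mb2 (J2 + j))
            - exp_model g v0 (grid M1 mb1 (J1 + i), grid M2 mb2 (J2 + j)))\<^sup>2)"
    using exp_model_separation[OF Xi(1,3) v0 g delta] by (elim exE conjE)
  \<comment> \<open>A negative \<gamma> is raised to 0, so that q = N^(2\<gamma>') is at least 1 and
    U is bounded by its rescaled version V below. The upper bound on \<rho> leaves room for the
    value 0.\<close>
  define \<gamma>' where "\<gamma>' = max \<gamma> 0"
  have rb: "0 < min (1/2) (1 - \<alpha>) - \<rho> / 2" using rho by (simp add: min_def split: if_splits)
  \<comment> \<open>The midpoint between \<gamma>' + \<rho>/2 and min (1/2) (1-\<alpha>): strictly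
    above the former for the final convergence, strictly below the latter because r < 1/2 is
    required.\<close>
  define r where "r = (\<gamma>' + \<rho> / 2 + min (1/2) (1 - \<alpha>)) / 2"
  have gr: "\<gamma>' + \<rho> / 2 < min (1/2) (1 - \<alpha>)"
  proof (cases "\<gamma> \<le> 0")
    case True
    then show ?thesis using rb by (simp only: \<gamma>'_def max_absorb2)
  next
    case False
    then show ?thesis using gamma by (simp only: \<gamma>'_def max_absorb1 not_le less_imp_le)
  qed
  then have r: "0 < r" "r < 1/2" "r \<le> 1 - \<alpha>" "\<gamma>' + \<rho> / 2 < r"
    using rho(1) unfolding r_def \<gamma>'_def by (auto simp: min_def max_def split: if_splits)
  have g0: "0 \<le> \<gamma>'" "\<gamma> \<le> \<gamma>'" by (auto simp: \<gamma>'_def)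
  obtain C where C: "0 \<le> C" and err: "\<forall>N\<ge>1. \<forall>m1 m2 y z. (\<forall>i\<in>{1..m1}. y i \<in> {\<delta>..1-\<delta>}) \<longrightarrow> (\<forall>j\<in>{1..m2}. z j \<in> {\<delta>..1-\<delta>}) \<longrightarrow>
    (\<exists>U. integrable M U \<and> (\<forall>\<omega>. 0 \<le> U \<omega>) \<and> expectation U \<le> C * real (m1 * m2) * real N powr (-2*r) \<and>
     (AE \<omega> in M. (\<Sum>i=1..m1. \<Sum>j=1..m2. (realized_Z \<alpha> X N (y i, z j) \<omega> - limit_Z (y i, z j))\<^sup>2)
        \<le> C * (U \<omega> + (U \<omega>)\<^sup>2)))"
    using sum_realized_Z_error[OF r(1-3) delta] by (elim exE conjE)
  obtain Cg where Cg: "0 < Cg" and grow: "\<forall>\<^sub>F N in sequentially. norm (real (mb1 N * mb2 N)) \<le> Cg * norm (real N powr \<rho>)"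
    using growth by (rule landau_o.bigE)
  show ?thesis
    unfolding tends_to_0_in_prob_def v0_def[symmetric]
  proof (intro allI impI)
    fix \<epsilon> :: real assume eps: "0 < \<epsilon>"
    \<comment> \<open>Threshold for V: at most 1, so that U^2 can be bounded by U, and small enough
      for 8 K C \<kappa>0 <= \<epsilon>^2. The added 1 keeps the denominator positive when C =
      0.\<close>
    define \<kappa>0 where "\<kappa>0 = min 1 (\<epsilon>\<^sup>2 / (8 * K * C + 1))"
    have den: "0 < 8 * K * C + 1" using K C by (intro add_nonneg_pos) auto
    have \<kappa>0: "0 < \<kappa>0" "\<kappa>0 \<le> 1" "8 * K * C * \<kappa>0 \<le> \<epsilon>\<^sup>2"
    proof -
      show "0 < \<kappa>0" "\<kappa>0 \<le> 1" using eps den by (auto simp: \<kappa>0_def)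
      have "8 * K * C * \<kappa>0 \<le> (8 * K * C + 1) * \<kappa>0" using \<open>0 < \<kappa>0\<close> by (intro mult_right_mono) auto
      also have "\<dots> \<le> (8 * K * C + 1) * (\<epsilon>\<^sup>2 / (8 * K * C + 1))" using den by (intro mult_left_mono) (auto simp: \<kappa>0_def)
      also have "\<dots> = \<epsilon>\<^sup>2" using den by simp
      finally show "8 * K * C * \<kappa>0 \<le> \<epsilon>\<^sup>2" .
    qed
    let ?Y = "\<lambda>N \<omega>. (sqrt (real (m1 N * m2 N)) * real N powr \<gamma>) *\<^sub>R (est N \<omega> - v0)"
    have bound: "\<forall>\<^sub>F N in sequentially. measure M {\<omega> \<in> space M. norm (?Y N \<omega>) > \<epsilon>}
        \<le> C * Cg / \<kappa>0 * real N powr (2*\<gamma>' + \<rho> - 2*r)"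
      using design nondegenerate grow eventually_ge_at_top[of 1]
    proof eventually_elim
      case (elim N)
      note dw = conjunct1[OF elim(1)] conjunct2[OF elim(1)] and N = elim(4)
      let ?y = "\<lambda>i. grid (M1 N) (mb1 N) (J1 N + i)" and ?z = "\<lambda>j. grid (M2 N) (mb2 N) (J2 N + j)"
      let ?Z = "\<lambda>i j. realized_Z \<alpha> X N (?y i, ?z j)"
      let ?m = "real (m1 N * m2 N)"
      obtain U where U: "integrable M U" "\<And>\<omega>. 0 \<le> U \<omega>" "expectation U \<le> C * ?m * real N powr (-2*r)"
        and UE: "AE \<omega> in M. (\<Sum>i=1..m1 N. \<Sum>j=1..m2 N. (?Z i j \<omega> - limit_Z (?y i, ?z j))\<^sup>2) \<le> C * (U \<omega> + (U \<omega>)\<^sup>2)"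
        using err[rule_format, OF N, of "m1 N" ?y "m2 N" ?z] design_window_grid[OF dw(1)] design_window_grid[OF dw(2)] by blast
      define q where "q = real N powr (2*\<gamma>')"
      have q1: "1 \<le> q" using N g0 by (auto simp: q_def intro!: ge_one_powr_ge_zero)
      define V where "V \<omega> = q * U \<omega>" for \<omega>
      have V: "integrable M V" "0 \<le> V \<omega>" for \<omega> using U q1 by (auto simp: V_def[abs_def])
      have contr: "contrast \<alpha> X N (m1 N) (m2 N) ?y ?z \<omega> v = (\<Sum>i=1..m1 N. \<Sum>j=1..m2 N. (?Z i j \<omega> - exp_model g v (?y i, ?z j))\<^sup>2)" for \<omega> v
        by (cases v) (simp add: contrast_def exp_model_def g_def)
      \<comment> \<open>Deterministic at each sample point: minimality costs the factor 4,
        separation the factor K, and q dominates N^(2\<gamma>).\<close>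
      have det: "(norm (?Y N \<omega>))\<^sup>2 \<le> q * (K * (4 * (\<Sum>i=1..m1 N. \<Sum>j=1..m2 N. (?Z i j \<omega> - limit_Z (?y i, ?z j))\<^sup>2)))"
        if \<omega>: "\<omega> \<in> space M" for \<omega>
      proof -
        have est: "est N \<omega> \<in> \<Xi>1"
          and min: "contrast \<alpha> X N (m1 N) (m2 N) ?y ?z \<omega> (est N \<omega>) \<le> contrast \<alpha> X N (m1 N) (m2 N) ?y ?z \<omega> v0"
        proof -
          note am = est_min[OF N \<omega>, unfolded is_arg_min_def]
          show "est N \<omega> \<in> \<Xi>1" by (rule conjunct1[OF am])
          show "contrast \<alpha> X N (m1 N) (m2 N) ?y ?z \<omega> (est N \<omega>) \<le> contrast \<alpha> X N (m1 N) (m2 N) ?y ?z \<omega> v0"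
            using conjunct2[OF am] v0 by (meson leI)
        qed
        have lim: "limit_Z p = exp_model g v0 p" for p by (simp add: limit_Z_exp_model g_def v0_def)
        have "(\<Sum>i=1..m1 N. \<Sum>j=1..m2 N. (exp_model g (est N \<omega>) (?y i, ?z j) - exp_model g v0 (?y i, ?z j))\<^sup>2)
          \<le> 4 * (\<Sum>i=1..m1 N. \<Sum>j=1..m2 N. (?Z i j \<omega> - exp_model g v0 (?y i, ?z j))\<^sup>2)"
          using min unfolding contr by (rule minimizer_error)
        then have "K * (\<Sum>i=1..m1 N. \<Sum>j=1..m2 N. (exp_model g (est N \<omega>) (?y i, ?z j) - exp_model g v0 (?y i, ?z j))\<^sup>2)
          \<le> K * (4 * (\<Sum>i=1..m1 N. \<Sum>j=1..m2 N. (?Z i j \<omega> - limit_Z (?y i, ?z j))\<^sup>2))"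
          unfolding lim using K by (intro mult_left_mono) auto
        moreover have "?m * (norm (est N \<omega> - v0))\<^sup>2
          \<le> K * (\<Sum>i=1..m1 N. \<Sum>j=1..m2 N. (exp_model g (est N \<omega>) (?y i, ?z j) - exp_model g v0 (?y i, ?z j))\<^sup>2)"
          using sep[rule_format, OF est dw] elim(2) by blast
        ultimately have a: "?m * (norm (est N \<omega> - v0))\<^sup>2 \<le> K * (4 * (\<Sum>i=1..m1 N. \<Sum>j=1..m2 N. (?Z i j \<omega> - limit_Z (?y i, ?z j))\<^sup>2))"
          by linarith
        have "(real N powr \<gamma>)\<^sup>2 \<le> q"
        proof -
          have "(real N powr \<gamma>)\<^sup>2 = real N powr (2*\<gamma>)" by (simp add: power2_eq_square powr_add[symmetric])
          also have "\<dots> \<le> q" unfolding q_def using N g0 by (intro powr_mono) auto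
          finally show ?thesis .
        qed
        moreover have "(norm (?Y N \<omega>))\<^sup>2 = (real N powr \<gamma>)\<^sup>2 * (?m * (norm (est N \<omega> - v0))\<^sup>2)"
          by (simp add: power_mult_distrib)
        ultimately have "(norm (?Y N \<omega>))\<^sup>2 \<le> q * (?m * (norm (est N \<omega> - v0))\<^sup>2)"
          by (simp only:) (intro mult_right_mono, auto)
        also have "\<dots> \<le> q * (K * (4 * (\<Sum>i=1..m1 N. \<Sum>j=1..m2 N. (?Z i j \<omega> - limit_Z (?y i, ?z j))\<^sup>2)))"
          using a q1 by (intro mult_left_mono) auto
        finally show ?thesis .
      qed
      have VM [measurable]: "V \<in> borel_measurable M" using V(1) by (rule borel_measurable_integrable)
      \<comment> \<open>Where V < \<kappa>0, the scaled estimation error cannot exceed \<epsilon>.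
        The bound through U holds almost everywhere, so the inclusion is asserted up to a null
        set.\<close>
      have "measure M {\<omega> \<in> space M. norm (?Y N \<omega>) > \<epsilon>} \<le> measure M {\<omega> \<in> space M. \<kappa>0 \<le> V \<omega>}"
      proof (rule finite_measure_mono_AE)
        show "AE \<omega> in M. \<omega> \<in> {\<omega> \<in> space M. norm (?Y N \<omega>) > \<epsilon>} \<longrightarrow> \<omega> \<in> {\<omega> \<in> space M. \<kappa>0 \<le> V \<omega>}"
          using UE
        proof eventually_elim
          case (elim \<omega>)
          show ?case
          proof (intro impI CollectI conjI)
            assume "\<omega> \<in> {\<omega> \<in> space M. norm (?Y N \<omega>) > \<epsilon>}"
            then have \<omega>: "\<omega> \<in> space M" and big: "\<epsilon> < norm (?Y N \<omega>)" by auto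
            show "\<omega> \<in> space M" by (rule \<omega>)
            show "\<kappa>0 \<le> V \<omega>"
            proof (rule ccontr)
              assume "\<not> ?thesis"
              then have Vk: "V \<omega> < \<kappa>0" by simp
              have "\<epsilon>\<^sup>2 < (norm (?Y N \<omega>))\<^sup>2" using big eps by (intro power_strict_mono) auto
              also have "\<dots> \<le> q * (K * (4 * (C * (U \<omega> + (U \<omega>)\<^sup>2))))"
                using elim K q1 by (intro order_trans[OF det[OF \<omega>]] mult_left_mono) auto
              also have "\<dots> = 4 * K * C * (V \<omega> + q * (U \<omega>)\<^sup>2)" by (simp add: V_def algebra_simps)
              also have "\<dots> \<le> 4 * K * C * (2 * \<kappa>0)"
              proof (rule mult_left_mono)
                \<comment> \<open>From q >= 1 follows U <= V < \<kappa>0 <= 1, so q U^2 = V U <= V;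
                  the quadratic term only doubles the bound.\<close>
                have UV: "U \<omega> \<le> V \<omega>" unfolding V_def using q1 U(2)[of \<omega>] by (simp add: mult_le_cancel_right1)
                have "q * (U \<omega>)\<^sup>2 = V \<omega> * U \<omega>" by (simp add: V_def power2_eq_square)
                also have "\<dots> \<le> V \<omega> * 1" using UV Vk \<kappa>0(2) V(2)[of \<omega>] by (intro mult_left_mono) auto
                finally show "V \<omega> + q * (U \<omega>)\<^sup>2 \<le> 2 * \<kappa>0" using Vk by simp
              qed (use K C in simp)
              also have "\<dots> = 8 * K * C * \<kappa>0" by simp
              also have "\<dots> \<le> \<epsilon>\<^sup>2" by (rule \<kappa>0(3))
              finally show False by simp
            qed
          qed
        qed
      qed measurable
      also have "\<dots> \<le> expectation V / \<kappa>0"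
        using V \<kappa>0(1) by (intro integral_Markov_inequality_measure[where A = "{}"]) auto
      also have "\<dots> \<le> (q * (C * (Cg * real N powr \<rho>) * real N powr (-2*r))) / \<kappa>0"
      proof (rule divide_right_mono)
        \<comment> \<open>The window is part of the index range of the thinned grid, so the growth
          condition on that grid bounds the number of design points.\<close>
        have "m1 N * m2 N \<le> mb1 N * mb2 N" using dw by (intro mult_le_mono) (auto simp: design_window_def)
        then have "?m \<le> real (mb1 N * mb2 N)" by (rule of_nat_mono)
        also have "\<dots> \<le> Cg * real N powr \<rho>" using elim(3) by simp
        finally have m: "?m \<le> Cg * real N powr \<rho>" .
        have "expectation V = q * expectation U" by (simp add: V_def[abs_def])
        also have "\<dots> \<le> q * (C * ?m * real N powr (-2*r))" using U(3) q1 by (intro mult_left_mono) auto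
        also have "\<dots> \<le> q * (C * (Cg * real N powr \<rho>) * real N powr (-2*r))"
          using m C q1 by (intro mult_left_mono mult_right_mono) auto
        finally show "expectation V \<le> q * (C * (Cg * real N powr \<rho>) * real N powr (-2*r))" .
      qed (use \<kappa>0 in simp)
      also have "\<dots> = C * Cg / \<kappa>0 * real N powr (2*\<gamma>' + \<rho> - 2*r)"
      proof -
        have "real N powr (2*\<gamma>' + \<rho> - 2*r) = q * real N powr \<rho> * real N powr (-2*r)"
          unfolding q_def powr_add[symmetric] by simp
        then show ?thesis by simp
      qed
      finally show ?case .
    qed
    \<comment> \<open>The exponent is negative because r > \<gamma>' + \<rho>/2.\<close>
    have "(\<lambda>N. C * Cg / \<kappa>0 * real N powr (2*\<gamma>' + \<rho> - 2*r)) \<longlonglongrightarrow> C * Cg / \<kappa>0 * 0"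
      using r(4) by (intro tendsto_mult tendsto_const tendsto_neg_powr filterlim_real_sequentially) auto
    then have lim0: "(\<lambda>N. C * Cg / \<kappa>0 * real N powr (2*\<gamma>' + \<rho> - 2*r)) \<longlonglongrightarrow> 0" by simp
    show "(\<lambda>N. measure M {\<omega> \<in> space M. norm (?Y N \<omega>) > \<epsilon>}) \<longlonglongrightarrow> 0"
      by (rule tendsto_sandwich[OF _ bound tendsto_const lim0]) simp
  qed
qed

end
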